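(* The modal theory $\mathsf{iH}^*_\sigma$ is decidable, i.e. the set of modal propositions $A$ with $\mathsf{iH}^*_\sigma\vdash A$ is decidable.
   Context: **Modal language.** Modal propositions are built from atomic variables and $\bot$ (and a provable constant $\top$) with $\wedge,\vee,\to,\square$. "Boxed" means of the form $\square B$. Sets denoted $X,Z$ of propositions are finite; the empty conjunction is $\top$, the empty disjunction is $\bot$. **Modal theories.** $\mathsf{IPC}_\square$ is intuitionistic propositional logic over the modal language (no axioms for $\square$, so boxed formulas behave like atoms). $\mathsf{iK4}$ is the theory with axioms: all theorems of $\mathsf{IPC}_\square$; $\square(A\to B)\to(\square A\to\square B)$; $\square A\to\square\square A$; and rules modus ponens and necessitation $A/\square A$. $\mathsf{iGL}$ is $\mathsf{iK4}$ plus Löb's axiom $\square(\square A\to A)\to\square A$. $\mathsf{CP}$ is the schema $A\to\square A$. Adding axioms to a theory with $+$ means closing under modus ponens and necessitation. **Bracket.** For modal $A,B$, $[A]B$ is defined by induction on $B$: $[A]B=B$ if $B$ is an atomic variable, $\top$, $\bot$, or boxed; $[A](B_1\circ B_2)=[A]B_1\circ[A]B_2$ for $\circ\in\{\wedge,\vee\}$; $[A](B_1\to B_2)=A\to(B_1\to B_2)$. For a set $Z$, $[A]Z:=\bigvee\{[A]E\mid E\in Z\}$. **The relation $\blacktriangleright^*$** is the smallest relation on modal propositions satisfying: - A1. If $\mathsf{iK4}\vdash A\to B$, then $A\blacktriangleright^*B$. - A2. If $A\blacktriangleright^*B$ and $B\blacktriangleright^*C$, then $A\blacktriangleright^*C$.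 - A3. If $C\blacktriangleright^*A$ and $C\blacktriangleright^*B$, then $C\blacktriangleright^*A\wedge B$. - A4. If $A\blacktriangleright^*B$, then $\square A\blacktriangleright^*\square B$. - B1. If $A\blacktriangleright^*C$ and $B\blacktriangleright^*C$, then $A\vee B\blacktriangleright^*C$. - B2. If $X$ is a set of implications, $B:=\bigwedge X$, $A:=B\to C$ and $Z:=\{E\mid E\to F\in X\}\cup\{C\}$, then $A\wedge\square B\blacktriangleright^*[B]Z$. - B3. If $A\blacktriangleright^*B$, then $(p\to A)\blacktriangleright^*(p\to B)$, for $p$ atomic or boxed. **The theory.** $\mathsf{iH}^*_\sigma:=\mathsf{iGL}+\mathsf{CP}+\{\square A\to\square B\mid A\blacktriangleright^*B\}$. *)

theory Defs
  imports Main "HOL-Library.Nat_Bijection"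
begin

section \<open>Modal propositions\<close>

datatype form =
    Var nat
  | Bot
  | Top
  | And form form
  | Or form form
  | Imp form form
  | Box form

fun Conj :: "form list \<Rightarrow> form" where
  "Conj [] = Top"
| "Conj [A] = A"
| "Conj (A # B # As) = And A (Conj (B # As))"

fun Disj :: "form list \<Rightarrow> form" where
  "Disj [] = Bot"
| "Disj [A] = A"
| "Disj (A # B # As) = Or A (Disj (B # As))"

section \<open>Modal theories\<close>

inductive_set IPC :: "form set" where
  K: "Imp A (Imp B A) \<in> IPC"
| S: "Imp (Imp A (Imp B C)) (Imp (Imp A B) (Imp A C)) \<in> IPC"
| AndI: "Imp A (Imp B (And A B)) \<in> IPC"
| AndE1: "Imp (And A B) A \<in> IPC"
| AndE2: "Imp (And A B) B \<in> IPC"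
| OrI1: "Imp A (Or A B) \<in> IPC"
| OrI2: "Imp B (Or A B) \<in> IPC"
| OrE: "Imp (Imp A C) (Imp (Imp B C) (Imp (Or A B) C)) \<in> IPC"
| BotE: "Imp Bot A \<in> IPC"
| TopI: "Top \<in> IPC"
| mp: "Imp A B \<in> IPC \<Longrightarrow> A \<in> IPC \<Longrightarrow> B \<in> IPC"

inductive_set closure :: "form set \<Rightarrow> form set" for Ax :: "form set" where
  ax: "A \<in> Ax \<Longrightarrow> A \<in> closure Ax"
| mp: "Imp A B \<in> closure Ax \<Longrightarrow> A \<in> closure Ax \<Longrightarrow> B \<in> closure Ax"
| nec: "A \<in> closure Ax \<Longrightarrow> Box A \<in> closure Ax"

definition extend :: "form set \<Rightarrow> form set \<Rightarrow> form set"  (infixl "\<oplus>" 65) where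
  "T \<oplus> Ax = closure (T \<union> Ax)"

definition iK4 :: "form set" where
  "iK4 = closure (IPC
      \<union> {Imp (Box (Imp A B)) (Imp (Box A) (Box B)) | A B. True}
      \<union> {Imp (Box A) (Box (Box A)) | A. True})"

definition iGL :: "form set" where
  "iGL = iK4 \<oplus> {Imp (Box (Imp (Box A) A)) (Box A) | A. True}"

definition CP :: "form set" where
  "CP = {Imp A (Box A) | A. True}"

section \<open>The preservativity relation\<close>

primrec bracket :: "form \<Rightarrow> form \<Rightarrow> form" where
  "bracket A (Var n) = Var n"
| "bracket A Bot = Bot"
| "bracket A Top = Top"
| "bracket A (And B C) = And (bracket A B) (bracket A C)"
| "bracket A (Or B C) = Or (bracket A B) (bracket A C)"
| "bracket A (Imp B C) = Imp A (Imp B C)"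
| "bracket A (Box B) = Box B"

text \<open>
  In rule B2 the finite sets of propositions are given by lists enumerating them. The rule
  admits every enumeration, so no order of the conjuncts and disjuncts is singled out; by A1
  and A2 the choice of enumeration does not affect the relation.
\<close>

inductive bt :: "form \<Rightarrow> form \<Rightarrow> bool"  (infix "\<triangleright>" 50) where
  A1: "Imp A B \<in> iK4 \<Longrightarrow> A \<triangleright> B"
| A2: "A \<triangleright> B \<Longrightarrow> B \<triangleright> C \<Longrightarrow> A \<triangleright> C"
| A3: "C \<triangleright> A \<Longrightarrow> C \<triangleright> B \<Longrightarrow> C \<triangleright> And A B"
| A4: "A \<triangleright> B \<Longrightarrow> Box A \<triangleright> Box B"
| B1: "A \<triangleright> C \<Longrightarrow> B \<triangleright> C \<Longrightarrow> Or A B \<triangleright> C"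
| B2: "\<lbrakk>\<forall>D \<in> set Xs. \<exists>E F. D = Imp E F;
        B = Conj Xs;
        A = Imp B C;
        set Zs = {E. \<exists>F. Imp E F \<in> set Xs} \<union> {C}\<rbrakk>
       \<Longrightarrow> And A (Box B) \<triangleright> Disj (map (bracket B) Zs)"
| B3: "A \<triangleright> B \<Longrightarrow> (\<exists>n. p = Var n) \<or> (\<exists>D. p = Box D) \<Longrightarrow> Imp p A \<triangleright> Imp p B"

definition iH :: "form set" where
  "iH = iGL \<oplus> CP \<oplus> {Imp (Box A) (Box B) | A B. A \<triangleright> B}"

section \<open>Decidability\<close>

text \<open>
  \<open>recursive n f\<close>: on argument lists of length \<open>n\<close>, \<open>f\<close> is a total recursive function. As usual
  for total functions, minimisation is only applied to regular functions, i.e. when a zero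
  exists for all arguments. The values of \<open>f\<close> on lists of other lengths are irrelevant.
\<close>

inductive recursive :: "nat \<Rightarrow> (nat list \<Rightarrow> nat) \<Rightarrow> bool" where
  zero: "recursive n (\<lambda>xs. 0)"
| succ: "recursive 1 (\<lambda>xs. Suc (xs ! 0))"
| proj: "i < n \<Longrightarrow> recursive n (\<lambda>xs. xs ! i)"
| comp: "recursive (length gs) f \<Longrightarrow> (\<forall>g \<in> set gs. recursive n g)
          \<Longrightarrow> recursive n (\<lambda>xs. f (map (\<lambda>g. g xs) gs))"
| prim_rec: "recursive n f \<Longrightarrow> recursive (Suc (Suc n)) g
          \<Longrightarrow> recursive (Suc n)
                (\<lambda>xs. rec_nat (f (tl xs)) (\<lambda>k r. g (k # r # tl xs)) (hd xs))"
| minimise: "recursive (Suc n) g \<Longrightarrow> (\<forall>xs. length xs = n \<longrightarrow> (\<exists>k. g (k # xs) = 0))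
          \<Longrightarrow> recursive n (\<lambda>xs. LEAST k. g (k # xs) = 0)"

definition recursive_set :: "nat set \<Rightarrow> bool" where
  "recursive_set N \<longleftrightarrow> (\<exists>f. recursive 1 f \<and> (\<forall>n. f [n] = (if n \<in> N then 1 else 0)))"

primrec goedel :: "form \<Rightarrow> nat" where
  "goedel (Var n) = prod_encode (0, n)"
| "goedel Bot = prod_encode (1, 0)"
| "goedel Top = prod_encode (2, 0)"
| "goedel (And A B) = prod_encode (3, prod_encode (goedel A, goedel B))"
| "goedel (Or A B) = prod_encode (4, prod_encode (goedel A, goedel B))"
| "goedel (Imp A B) = prod_encode (5, prod_encode (goedel A, goedel B))"
| "goedel (Box A) = prod_encode (6, goedel A)"

lemma goedel_inject: "goedel A = goedel B \<longleftrightarrow> A = B"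
proof (induction A arbitrary: B)
  case (Var x) then show ?case by (cases B) (auto simp: prod_encode_eq)
next
  case Bot then show ?case by (cases B) (auto simp: prod_encode_eq)
next
  case Top then show ?case by (cases B) (auto simp: prod_encode_eq)
next
  case (And A1 A2) then show ?case by (cases B) (auto simp: prod_encode_eq)
next
  case (Or A1 A2) then show ?case by (cases B) (auto simp: prod_encode_eq)
next
  case (Imp A1 A2) then show ?case by (cases B) (auto simp: prod_encode_eq)
next
  case (Box A) then show ?case by (cases B) (auto simp: prod_encode_eq)
qed

definition decidable :: "form set \<Rightarrow> bool" where
  "decidable T \<longleftrightarrow> recursive_set (goedel ` T)"

end

theory Submission
  imports Defs
begin

text \<open>
  The theory is recursive because both it and its complement are recursively enumerable, by Post's
  theorem. Theorems are enumerated by their proofs; what has to be found is a finite certificate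
  for being a non-theorem. It comes from a Kripke semantics for which the theory is complete.

  \<^bold>\<open>Semantics.\<close> Take worlds with a preorder and a transitive, conversely well-founded modal
  relation \<open>R\<close>. Formulas are not evaluated at worlds but at finite trees whose nodes are labelled by
  worlds, increasing along the branches. Above a tree lie its subtrees and all trees rooted at
  an \<open>R\<close>-successor of its root; the latter alone are relevant for \<open>\<box>\<close>. As an
  implication also looks at the latter, \<open>A \<rightarrow> \<box>A\<close> is valid. If all trees over a world force \<open>A\<close> and
  \<open>A \<triangleright> B\<close>, then all trees over this world force \<open>B\<close>: new trees can be grafted from old ones (rules B1
  and B3), and subtrees that do not force a given formula can be pruned (rule B2). This gives
  soundness, \<open>iH_sound\<close>.

  \<^bold>\<open>Stable formulas.\<close> These are formulas in which implications only have atoms or boxes on the left. In the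
  models used for completeness, a stable formula that is recorded as true at a world holds in all
  trees over it. Rewriting with B2, as in the computation of approximations without implications
  nested to the left in intuitionistic propositional logic, every \<open>A\<close> receives a stable \<open>N\<close> such
  that \<open>\<box>A \<rightarrow> \<box>N\<close> and \<open>N \<rightarrow> A\<close> are theorems (\<open>ex_stable_approximation\<close>).

  \<^bold>\<open>Certificates.\<close> A finite countermodel is described by sequents \<open>G \<Rightarrow> D\<close>, where \<open>G\<close> is to be
  true and \<open>D\<close> to be false at a tree. That all trees over a successor force the formulas
  boxed in \<open>G\<close> cannot be read off from one sequent, so \<open>G\<close> has to contain boxed stable
  approximations of those that are not stable; then it is automatic.
  Refuted sequents are never provable because of soundness (\<open>refuted_not_iH\<close>), and the
  usual saturation argument refutes every unprovable formula inside the finite set of its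
  subformulas and their approximations (\<open>not_iH_refuted\<close>).

  \<^bold>\<open>Enumerability.\<close> All the notions involved, including derivability itself, are inductive definitions with
  rules that are patterns in the codes of their arguments. Logic programs over natural numbers
  capture this uniformly: whatever a program derives is enumerated by a decidable check of
  derivations (\<open>recursive_set_of_program\<close>), and one program derives both the theorems and the
  non-theorems.
\<close>

section \<open>Deduction from hypotheses\<close>

text \<open>
  Derivability from hypotheses with modus ponens as the only rule: necessitation is not applicable to
  hypotheses, so the deduction theorem holds over every base logic.
\<close>

inductive ded :: "form set \<Rightarrow> form set \<Rightarrow> form \<Rightarrow> bool" for L \<Gamma> where
  base: "A \<in> L \<Longrightarrow> ded L \<Gamma> A"
| hyp: "A \<in> \<Gamma> \<Longrightarrow> ded L \<Gamma> A"
| mp: "ded L \<Gamma> (Imp A B) \<Longrightarrow> ded L \<Gamma> A \<Longrightarrow> ded L \<Gamma> B"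

lemma ded_mono: "ded L \<Gamma> A \<Longrightarrow> L \<subseteq> L' \<Longrightarrow> \<Gamma> \<subseteq> \<Gamma>' \<Longrightarrow> ded L' \<Gamma>' A"
  by (induction rule: ded.induct) (blast intro: ded.base, blast intro: ded.hyp, rule ded.mp)

locale ilogic =
  fixes L :: "form set"
  assumes IPC_subset: "IPC \<subseteq> L" and closed_mp: "Imp A B \<in> L \<Longrightarrow> A \<in> L \<Longrightarrow> B \<in> L"
begin

abbreviation entails :: "form set \<Rightarrow> form \<Rightarrow> bool" (infix "\<turnstile>" 50) where "\<Gamma> \<turnstile> A \<equiv> ded L \<Gamma> A"

lemma ded_IPC: "A \<in> IPC \<Longrightarrow> \<Gamma> \<turnstile> A"
  using IPC_subset by (auto intro: ded.base)

lemma ded_thm_iff: "{} \<turnstile> A \<longleftrightarrow> A \<in> L"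
proof
  show "{} \<turnstile> A \<Longrightarrow> A \<in> L"
    by (induction rule: ded.induct) (auto dest: closed_mp)
qed (rule ded.base)

lemma ded_Imp: "\<Gamma> \<turnstile> Imp A B \<longleftrightarrow> insert A \<Gamma> \<turnstile> B"
proof
  assume "\<Gamma> \<turnstile> Imp A B"
  then have "insert A \<Gamma> \<turnstile> Imp A B" by (rule ded_mono) auto
  then show "insert A \<Gamma> \<turnstile> B" by (rule ded.mp) (simp add: ded.hyp)
next
  assume "insert A \<Gamma> \<turnstile> B"
  then show "\<Gamma> \<turnstile> Imp A B"
  proof (induction rule: ded.induct)
    case (base B)
    then show ?case using ded.mp[OF ded_IPC[OF IPC.K] ded.base[OF base]] by simp
  next
    case (hyp B)
    have "\<Gamma> \<turnstile> Imp A A"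
      using ded.mp[OF ded.mp[OF ded_IPC[OF IPC.S] ded_IPC[OF IPC.K]] ded_IPC[OF IPC.K]] .
    show ?case
    proof (cases "B = A")
      case False
      with hyp show ?thesis by (intro ded.mp[OF ded_IPC[OF IPC.K] ded.hyp]) simp
    qed (simp add: \<open>\<Gamma> \<turnstile> Imp A A\<close>)
  next
    case (mp B C)
    show ?case by (rule ded.mp[OF ded.mp[OF ded_IPC[OF IPC.S]]]) (fact mp.IH)+
  qed
qed

lemma in_L_Imp: "Imp A B \<in> L \<longleftrightarrow> {A} \<turnstile> B"
  by (simp add: ded_thm_iff[symmetric] ded_Imp)

lemma ded_Top [simp]: "\<Gamma> \<turnstile> Top"
  by (rule ded_IPC[OF IPC.TopI])

lemma ded_Bot_left [simp]: "insert Bot \<Gamma> \<turnstile> A"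
  using ded_IPC[OF IPC.BotE] by (simp add: ded_Imp[symmetric])

lemma ded_And: "\<Gamma> \<turnstile> And A B \<longleftrightarrow> \<Gamma> \<turnstile> A \<and> \<Gamma> \<turnstile> B"
  by (intro iffI conjI; (elim conjE)?)
    (erule ded.mp[OF ded_IPC[OF IPC.AndE1]] ded.mp[OF ded_IPC[OF IPC.AndE2]]
      ded.mp[OF ded.mp[OF ded_IPC[OF IPC.AndI]]], assumption?)+

lemma ded_cut: "\<Gamma> \<turnstile> A \<Longrightarrow> insert A \<Gamma> \<turnstile> B \<Longrightarrow> \<Gamma> \<turnstile> B"
  using ded.mp[of L \<Gamma> A B] by (simp add: ded_Imp)

lemma ded_cut_set:
  assumes "\<Delta> \<turnstile> B" "\<And>A. A \<in> \<Delta> \<Longrightarrow> \<Gamma> \<turnstile> A"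
  shows "\<Gamma> \<turnstile> B"
  using assms(1) by (induction rule: ded.induct) (blast intro: ded.base, blast intro: assms(2), rule ded.mp)

lemma ded_OrI1: "\<Gamma> \<turnstile> A \<Longrightarrow> \<Gamma> \<turnstile> Or A B" and ded_OrI2: "\<Gamma> \<turnstile> B \<Longrightarrow> \<Gamma> \<turnstile> Or A B"
  by (erule ded.mp[OF ded_IPC[OF IPC.OrI1]], erule ded.mp[OF ded_IPC[OF IPC.OrI2]])

lemma ded_And_left: "insert (And A B) \<Gamma> \<turnstile> C \<longleftrightarrow> insert A (insert B \<Gamma>) \<turnstile> C"
proof
  assume *: "insert (And A B) \<Gamma> \<turnstile> C"
  show "insert A (insert B \<Gamma>) \<turnstile> C"
    by (rule ded_cut_set[OF *]) (auto simp: ded_And intro: ded.hyp)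
next
  assume *: "insert A (insert B \<Gamma>) \<turnstile> C"
  have "insert (And A B) \<Gamma> \<turnstile> And A B" by (simp add: ded.hyp)
  then show "insert (And A B) \<Gamma> \<turnstile> C"
    by - (rule ded_cut_set[OF *], auto simp: ded_And intro: ded.hyp)
qed

lemma ded_Or_left: "insert (Or A B) \<Gamma> \<turnstile> C \<longleftrightarrow> insert A \<Gamma> \<turnstile> C \<and> insert B \<Gamma> \<turnstile> C"
proof
  assume *: "insert (Or A B) \<Gamma> \<turnstile> C"
  show "insert A \<Gamma> \<turnstile> C \<and> insert B \<Gamma> \<turnstile> C"
    by (intro conjI; rule ded_cut_set[OF *]) (auto intro: ded.hyp ded_OrI1 ded_OrI2)
next
  assume "insert A \<Gamma> \<turnstile> C \<and> insert B \<Gamma> \<turnstile> C"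
  then have "\<Gamma> \<turnstile> Imp (Or A B) C"
    using ded.mp[OF ded.mp[OF ded_IPC[OF IPC.OrE]]] by (simp add: ded_Imp)
  then show "insert (Or A B) \<Gamma> \<turnstile> C" by (simp add: ded_Imp)
qed

lemma ded_OrE: "\<Gamma> \<turnstile> Or A B \<Longrightarrow> insert A \<Gamma> \<turnstile> C \<Longrightarrow> insert B \<Gamma> \<turnstile> C \<Longrightarrow> \<Gamma> \<turnstile> C"
  using ded_cut[of \<Gamma> "Or A B" C] by (simp add: ded_Or_left)

lemma ded_Conj: "\<Gamma> \<turnstile> Conj As \<longleftrightarrow> (\<forall>A \<in> set As. \<Gamma> \<turnstile> A)"
  by (induction As rule: Conj.induct) (auto simp: ded_And)

lemma ded_Conj_left: "insert (Conj As) \<Gamma> \<turnstile> C \<longleftrightarrow> set As \<union> \<Gamma> \<turnstile> C"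
proof
  assume *: "insert (Conj As) \<Gamma> \<turnstile> C"
  show "set As \<union> \<Gamma> \<turnstile> C"
    by (rule ded_cut_set[OF *]) (auto simp: ded_Conj intro: ded.hyp)
next
  assume *: "set As \<union> \<Gamma> \<turnstile> C"
  have "insert (Conj As) \<Gamma> \<turnstile> Conj As" by (simp add: ded.hyp)
  then show "insert (Conj As) \<Gamma> \<turnstile> C"
    by - (rule ded_cut_set[OF *], auto simp: ded_Conj intro: ded.hyp)
qed

lemma ded_Disj: "A \<in> set As \<Longrightarrow> \<Gamma> \<turnstile> A \<Longrightarrow> \<Gamma> \<turnstile> Disj As"
  by (induction As rule: Disj.induct) (auto intro: ded_OrI1 ded_OrI2)

lemma ded_Disj_left: "insert (Disj As) \<Gamma> \<turnstile> C \<longleftrightarrow> (\<forall>A \<in> set As. insert A \<Gamma> \<turnstile> C)"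
  by (induction As rule: Disj.induct) (auto simp: ded_Or_left)

lemma ded_Disj_subset: "set As \<subseteq> set Bs \<Longrightarrow> {Disj As} \<turnstile> Disj Bs"
  unfolding ded_Disj_left by (auto intro: ded_Disj[OF _ ded.hyp])

lemma ded_Imp_left: "Imp A B \<in> \<Gamma> \<Longrightarrow> \<Gamma> \<turnstile> A \<Longrightarrow> \<Gamma> \<turnstile> B"
  by (rule ded.mp[OF ded.hyp])

end

lemma iK4_nec: "A \<in> iK4 \<Longrightarrow> Box A \<in> iK4"
  unfolding iK4_def by (rule closure.nec)

global_interpretation K4: ilogic iK4
proof
  show "IPC \<subseteq> iK4" unfolding iK4_def by (auto intro: closure.ax)
  show "Imp A B \<in> iK4 \<Longrightarrow> A \<in> iK4 \<Longrightarrow> B \<in> iK4" for A B unfolding iK4_def by (rule closure.mp)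
qed

lemma iK4_K: "Imp (Box (Imp A B)) (Imp (Box A) (Box B)) \<in> iK4"
  and iK4_4: "Imp (Box A) (Box (Box A)) \<in> iK4"
  unfolding iK4_def by (rule closure.ax; blast)+

lemma iK4_subset_iH: "iK4 \<subseteq> iH"
  unfolding iH_def iGL_def extend_def by (auto intro!: closure.ax)

lemma iH_Loeb: "Imp (Box (Imp (Box A) A)) (Box A) \<in> iH"
  unfolding iH_def iGL_def extend_def
  by (rule closure.ax, rule UnI1, rule closure.ax, rule UnI1, rule closure.ax) blast

lemma iH_CP: "Imp A (Box A) \<in> iH"
  unfolding iH_def extend_def CP_def
  by (rule closure.ax, rule UnI1, rule closure.ax) blast

lemma iH_bt: "A \<triangleright> B \<Longrightarrow> Imp (Box A) (Box B) \<in> iH"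
  unfolding iH_def extend_def by (rule closure.ax) blast

lemma iH_mp: "Imp A B \<in> iH \<Longrightarrow> A \<in> iH \<Longrightarrow> B \<in> iH"
  unfolding iH_def extend_def by (rule closure.mp)

global_interpretation H: ilogic iH
  using iK4_subset_iH K4.IPC_subset by unfold_locales (blast, erule iH_mp)

lemma closure_least:
  assumes "Ax \<subseteq> T" "\<And>A B. Imp A B \<in> T \<Longrightarrow> A \<in> T \<Longrightarrow> B \<in> T" "\<And>A. A \<in> T \<Longrightarrow> Box A \<in> T"
  shows "closure Ax \<subseteq> T"
proof
  fix A assume "A \<in> closure Ax"
  then show "A \<in> T"
  proof (induction rule: closure.induct)
    case (mp A B)
    show ?case by (rule assms(2)[OF mp.IH])
  qed (use assms(1,3) in blast)+
qed

text \<open>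
  The nested extensions that define the theory collapse to one closure under modus ponens, since the completeness
  axioms make necessitation derivable.
\<close>

lemma iH_least:
  assumes "iK4 \<subseteq> T" "\<And>A. Imp (Box (Imp (Box A) A)) (Box A) \<in> T" "\<And>A. Imp A (Box A) \<in> T"
    and "\<And>A B. A \<triangleright> B \<Longrightarrow> Imp (Box A) (Box B) \<in> T"
    and mp: "\<And>A B. Imp A B \<in> T \<Longrightarrow> A \<in> T \<Longrightarrow> B \<in> T"
  shows "iH \<subseteq> T"
proof -
  have nec: "\<And>A. A \<in> T \<Longrightarrow> Box A \<in> T" by (rule mp[OF assms(3)])
  have "closure (iK4 \<union> {Imp (Box (Imp (Box A) A)) (Box A) | A. True}) \<subseteq> T"
    by (rule closure_least[OF _ mp nec]) (use assms(1,2) in blast)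
  then have "closure (closure (iK4 \<union> {Imp (Box (Imp (Box A) A)) (Box A) | A. True})
      \<union> {Imp A (Box A) | A. True}) \<subseteq> T"
    by - (rule closure_least[OF _ mp nec], use assms(3) in blast)
  then show ?thesis
    unfolding iH_def iGL_def extend_def CP_def
    by - (rule closure_least[OF _ mp nec], use assms(4) in blast)
qed


text \<open>
  The normal rule for \<open>\<box>\<close>, in the form in which boxes of hypotheses may come from anywhere.
\<close>

lemma ded_Box: 
  assumes "ded iH \<Delta> B" "\<And>A. A \<in> \<Delta> \<Longrightarrow> ded iH \<Gamma> (Box A)"
  shows "ded iH \<Gamma> (Box B)"
  using assms(1)
proof (induction rule: ded.induct)
  case (base A)
  then show ?case using ded.base[OF iH_mp[OF iH_CP]] by simp
next
  case (mp A B)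
  have "ded iH \<Gamma> (Imp (Box (Imp A B)) (Imp (Box A) (Box B)))"
    by (rule ded.base, rule subsetD[OF iK4_subset_iH], rule iK4_K)
  then show ?case using ded.mp[OF ded.mp[OF _ mp.IH(1)] mp.IH(2)] by simp
qed (use assms(2) in auto)

lemma ded_CP: "ded iH \<Gamma> A \<Longrightarrow> ded iH \<Gamma> (Box A)"
  by (rule ded.mp[OF ded.base[OF iH_CP]])

section \<open>Trees over Kripke models\<close>

text \<open>
  A world records which atoms and boxes hold; a tree over it chooses which of the higher worlds are
  seen by implications. A world may label several nodes, even along one branch.
\<close>

datatype 'w tree = Node (world: 'w) (children: "'w tree list")

fun subtrees :: "'w tree \<Rightarrow> 'w tree set" where
  "subtrees (Node w ts) = insert (Node w ts) (\<Union>t \<in> set ts. subtrees t)"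

lemma subtrees_refl [simp]: "t \<in> subtrees t"
  by (cases t) auto

lemma subtrees_trans: "s \<in> subtrees t \<Longrightarrow> r \<in> subtrees s \<Longrightarrow> r \<in> subtrees t"
  by (induction t rule: subtrees.induct) auto

lemma finite_subtrees: "finite (subtrees t)"
  by (induction t rule: subtrees.induct) auto

text \<open>
  The second half of the mixed transitivity laws, \<open>R_le\<close>, keeps everything above an \<open>R\<close>-successor an
  \<open>R\<close>-successor. It is needed because the trees over an \<open>R\<close>-successor branch into higher worlds.
\<close>

locale model =
  fixes W :: "'w set" and le R :: "'w \<Rightarrow> 'w \<Rightarrow> bool" and Val :: "'w \<Rightarrow> nat set"
  assumes le_refl: "le x x" and le_trans: "le x y \<Longrightarrow> le y z \<Longrightarrow> le x z"
    and R_trans: "R x y \<Longrightarrow> R y z \<Longrightarrow> R x z"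
    and le_R: "le x y \<Longrightarrow> R y z \<Longrightarrow> R x z" and R_le: "R x y \<Longrightarrow> le y z \<Longrightarrow> R x z"
    and wf_R: "wfp (\<lambda>y x. R x y)"
    and Val_le: "le x y \<Longrightarrow> Val x \<subseteq> Val y" and Val_R: "R x y \<Longrightarrow> Val x \<subseteq> Val y"
begin

fun valid :: "'w tree \<Rightarrow> bool" where
  "valid (Node w ts) \<longleftrightarrow> w \<in> W \<and> (\<forall>t \<in> set ts. le w (world t) \<and> valid t)"

definition steps :: "'w tree \<Rightarrow> 'w tree \<Rightarrow> bool" where
  "steps t t' \<longleftrightarrow> valid t' \<and> R (world t) (world t')"

text \<open>
  The accessible trees for implication. Including all trees over \<open>R\<close>-successors, and not only the subtrees, is
  what validates \<open>A \<rightarrow> \<box>A\<close>.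
\<close>

definition reaches :: "'w tree \<Rightarrow> 'w tree \<Rightarrow> bool" where
  "reaches t t' \<longleftrightarrow> t' \<in> subtrees t \<or> steps t t'"

primrec forces :: "'w tree \<Rightarrow> form \<Rightarrow> bool" where
  "forces t (Var n) \<longleftrightarrow> n \<in> Val (world t)"
| "forces t Bot \<longleftrightarrow> False"
| "forces t Top \<longleftrightarrow> True"
| "forces t (And A B) \<longleftrightarrow> forces t A \<and> forces t B"
| "forces t (Or A B) \<longleftrightarrow> forces t A \<or> forces t B"
| "forces t (Imp A B) \<longleftrightarrow> (\<forall>t'. reaches t t' \<longrightarrow> forces t' A \<longrightarrow> forces t' B)"
| "forces t (Box A) \<longleftrightarrow> (\<forall>t'. steps t t' \<longrightarrow> forces t' A)"

text \<open>
  The property of worlds that \<open>A \<triangleright> B\<close> transports from \<open>A\<close> to \<open>B\<close>. By \<open>stably_R\<close> below it is also what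
  boxes assert of the \<open>R\<close>-successors.
\<close>

definition stably :: "'w \<Rightarrow> form \<Rightarrow> bool" where
  "stably w A \<longleftrightarrow> (\<forall>t. valid t \<longrightarrow> world t = w \<longrightarrow> forces t A)"

lemma subtree_valid: "valid t \<Longrightarrow> t' \<in> subtrees t \<Longrightarrow> valid t' \<and> le (world t) (world t')"
proof (induction t rule: subtrees.induct)
  case (1 w ts)
  show ?case
  proof (cases "t' = Node w ts")
    case True
    then show ?thesis using 1 by (simp add: le_refl)
  next
    case False
    then obtain t where t: "t \<in> set ts" "t' \<in> subtrees t" using 1 by auto
    then have "valid t' \<and> le (world t) (world t')" using 1 by auto
    moreover have "le w (world t)" using t 1 by auto
    ultimately show ?thesis using le_trans by auto
  qed
qed

lemma reaches_valid: "valid t \<Longrightarrow> reaches t t' \<Longrightarrow> valid t'"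
  by (auto simp: reaches_def steps_def dest: subtree_valid)

lemma reaches_refl [simp]: "reaches t t"
  by (simp add: reaches_def)

lemma reaches_steps: "valid t \<Longrightarrow> reaches t t' \<Longrightarrow> steps t' t'' \<Longrightarrow> steps t t''"
  unfolding reaches_def steps_def using subtree_valid le_R R_trans by blast

lemma reaches_trans: "valid t \<Longrightarrow> reaches t t' \<Longrightarrow> reaches t' t'' \<Longrightarrow> reaches t t''"
  using reaches_steps subtree_valid R_le subtrees_trans unfolding reaches_def steps_def by meson

lemma forces_mono: "valid t \<Longrightarrow> reaches t t' \<Longrightarrow> forces t A \<Longrightarrow> forces t' A"
proof (induction A arbitrary: t t')
  case (Var n)
  then show ?case
    using subtree_valid[of t t'] Val_le[of "world t" "world t'"] Val_R[of "world t" "world t'"]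
    unfolding reaches_def steps_def by auto
next
  case (Imp A B)
  then show ?case using reaches_trans by auto
next
  case (Box A)
  then show ?case using reaches_steps by auto
qed auto

lemma forces_ImpI:
  "valid t \<Longrightarrow> (\<And>t'. valid t' \<Longrightarrow> reaches t t' \<Longrightarrow> forces t' A \<Longrightarrow> forces t' B) \<Longrightarrow> forces t (Imp A B)"
  using reaches_valid by auto

lemma forces_ImpD: "forces t (Imp A B) \<Longrightarrow> forces t A \<Longrightarrow> forces t B"
  using reaches_refl by auto

lemma IPC_sound: "A \<in> IPC \<Longrightarrow> valid t \<Longrightarrow> forces t A"
proof (induction arbitrary: t rule: IPC.induct)
  case (K A B)
  then show ?case by (blast intro: forces_ImpI forces_mono)
next
  case (S A B C)
  show ?case
  proof (intro forces_ImpI S)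
    fix t1 t2 t3
    assume t: "valid t1" "valid t2" "reaches t1 t2" "reaches t2 t3"
      and f: "forces t1 (Imp A (Imp B C))" "forces t2 (Imp A B)" "forces t3 A"
    have "forces t3 (Imp A (Imp B C))" "forces t3 (Imp A B)"
      using forces_mono[OF t(1) reaches_trans[OF t(1,3,4)] f(1)] forces_mono[OF t(2,4) f(2)] .
    then show "forces t3 C" using f(3) forces_ImpD[of t3 A] forces_ImpD[of t3 B C] by blast
  qed
next
  case (AndI A B)
  have "forces t2 (And A B)" if "valid t1" "reaches t1 t2" "forces t1 A" "forces t2 B" for t1 t2
    using forces_mono[OF that(1,2,3)] that(4) by simp
  then show ?case by (intro forces_ImpI AndI)
next
  case (OrE A C B)
  show ?case
  proof (intro forces_ImpI OrE)
    fix t1 t2 t3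
    assume t: "valid t1" "valid t2" "reaches t1 t2" "reaches t2 t3"
      and f: "forces t1 (Imp A C)" "forces t2 (Imp B C)" "forces t3 (Or A B)"
    have "forces t3 (Imp A C)" "forces t3 (Imp B C)"
      using forces_mono[OF t(1) reaches_trans[OF t(1,3,4)] f(1)] forces_mono[OF t(2,4) f(2)] .
    then show "forces t3 C" using f(3) forces_ImpD[of t3 A C] forces_ImpD[of t3 B C] by (auto simp del: forces.simps(6))
  qed
next
  case (mp A B)
  then show ?case using forces_ImpD[of t A B] by blast
qed auto

lemma iK4_sound: "A \<in> iK4 \<Longrightarrow> valid t \<Longrightarrow> forces t A"
  unfolding iK4_def
proof (induction arbitrary: t rule: closure.induct)
  case (ax A)
  then consider "A \<in> IPC" | B C where "A = Imp (Box (Imp B C)) (Imp (Box B) (Box C))"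
    | B where "A = Imp (Box B) (Box (Box B))" by blast
  then show ?case
  proof cases
    case 2
    show ?thesis unfolding \<open>A = _\<close>
    proof (intro forces_ImpI ax)
      fix t1 t2
      assume t: "valid t1" "reaches t1 t2" and f: "forces t1 (Box (Imp B C))" "forces t2 (Box B)"
      have "forces t2 (Box (Imp B C))" using forces_mono[OF t f(1)] .
      then show "forces t2 (Box C)" using f(2) forces_ImpD[of _ B C] by (simp del: forces.simps(6))
    qed
  next
    case 3
    have "forces t1 (Box (Box B))" if "valid t1" "forces t1 (Box B)" for t1
      using that reaches_steps[OF that(1)] by (auto simp: reaches_def)
    then show ?thesis unfolding \<open>A = _\<close> by (intro forces_ImpI ax)
  qed (use IPC_sound ax in blast)
next
  case (mp A B)
  then show ?case using forces_ImpD[of t A B] by blast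
next
  case (nec A)
  then show ?case by (simp add: steps_def)
qed

lemma stably_R: "valid t \<Longrightarrow> forces t (Box A) \<longleftrightarrow> (\<forall>w \<in> W. R (world t) w \<longrightarrow> stably w A)"
proof -
  have "valid t' \<Longrightarrow> world t' \<in> W" for t' by (cases t') auto
  then show "valid t \<Longrightarrow> forces t (Box A) \<longleftrightarrow> (\<forall>w \<in> W. R (world t) w \<longrightarrow> stably w A)"
    by (auto simp: steps_def stably_def)
qed

text \<open>
  The pruned tree \<open>s\<close> differs from \<open>t\<close> only in that its implications ignore points where \<open>B\<close> fails. Prefixing
  the outermost implications with \<open>B\<close> makes \<open>t\<close> ignore these points too, and the bracket does just that.
\<close>

lemma forces_bracket:
  assumes "valid t" and s: "world s = world t" "\<And>t'. reaches s t' \<longleftrightarrow> t' = s \<or> (reaches t t' \<and> forces t' B)"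
    and "forces s E"
  shows "forces t (bracket B E)"
  using \<open>forces s E\<close>
proof (induction E)
  case (Imp C D)
  have "forces t' (Imp C D)" if t': "reaches t t'" "forces t' B" for t'
  proof (rule forces_ImpI)
    show "valid t'" using reaches_valid assms(1) t' by blast
    then show "forces t'' D" if "reaches t' t''" "forces t'' C" for t''
      using Imp.prems s(2)[of t''] that t' reaches_trans[OF assms(1)] forces_mono by auto
  qed
  then show ?case unfolding bracket.simps by - (rule forces_ImpI[OF assms(1)])
qed (auto simp: s(1) steps_def)

text \<open>
  Pruning a tree to the subtrees forcing \<open>B\<close>. Trees over \<open>R\<close>-successors cannot be pruned away, and need
  not be, because \<open>\<box>B\<close> holds; this is where B2 uses its premise \<open>\<box>B\<close>.
\<close>

lemma prune:
  assumes t: "valid t" and Box: "forces t (Box B)"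
  obtains s where "valid s" "world s = world t" "\<And>t'. reaches s t' \<longleftrightarrow> t' = s \<or> (reaches t t' \<and> forces t' B)"
proof -
  obtain ts where ts: "set ts = {t' \<in> subtrees t. forces t' B}"
    using finite_list[of "{t' \<in> subtrees t. forces t' B}"] finite_subtrees[of t] by auto
  let ?s = "Node (world t) ts"
  have "world t \<in> W" using t by (cases t) auto
  then have "valid ?s" using t ts by (auto dest: subtree_valid)
  moreover have "reaches ?s t' \<longleftrightarrow> t' = ?s \<or> (reaches t t' \<and> forces t' B)" for t'
  proof
    assume "reaches ?s t'"
    then consider "t' = ?s" | t'' where "t'' \<in> set ts" "t' \<in> subtrees t''" | "steps t t'"
      by (auto simp: reaches_def steps_def)
    then show "t' = ?s \<or> (reaches t t' \<and> forces t' B)"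
    proof cases
      case 2
      then have "t'' \<in> subtrees t" "forces t'' B" using ts by auto
      then show ?thesis using 2 forces_mono[of t'' t'] subtree_valid[OF t] subtrees_trans
        by (auto simp: reaches_def)
    next
      case 3
      then show ?thesis using Box by (auto simp: reaches_def)
    qed simp
  next
    assume "t' = ?s \<or> (reaches t t' \<and> forces t' B)"
    then show "reaches ?s t'"
      using ts subtrees_refl by (auto simp: reaches_def steps_def)
  qed
  ultimately show thesis using that[of ?s] by simp
qed

text \<open>
  In the pruned tree \<open>s\<close>, everything strictly above the root forces \<open>B\<close>. Hence either the root forces \<open>B\<close>,
  and then \<open>C\<close>, or the only place where one of the implications \<open>E \<rightarrow> F\<close> in \<open>B\<close> can fail is the root, which
  therefore forces \<open>E\<close>.
\<close>

lemma stably_B2: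
  assumes Xs: "\<forall>D \<in> set Xs. \<exists>E F. D = Imp E F" and B: "B = Conj Xs"
    and Zs: "set Zs = {E. \<exists>F. Imp E F \<in> set Xs} \<union> {C}"
    and A: "stably w (And (Imp B C) (Box B))"
  shows "stably w (Disj (map (bracket B) Zs))"
  unfolding stably_def
proof (intro allI impI)
  fix t assume t: "valid t" "world t = w"
  have Conj: "forces s (Conj As) \<longleftrightarrow> (\<forall>A \<in> set As. forces s A)" for s As
    by (induction As rule: Conj.induct) auto
  have Disj: "forces s (Disj As) \<longleftrightarrow> (\<exists>A \<in> set As. forces s A)" for s As
    by (induction As rule: Disj.induct) auto
  obtain s where s: "valid s" "world s = world t"
      "\<And>t'. reaches s t' \<longleftrightarrow> t' = s \<or> (reaches t t' \<and> forces t' B)"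
    using prune[OF t(1), of B] A t unfolding stably_def by auto
  have "\<exists>E \<in> set Zs. forces s E"
  proof (cases "forces s B")
    case True
    have "forces s (Imp B C)" using A s t unfolding stably_def by simp
    then have "forces s C" using True forces_ImpD[of s B C] by blast
    then show ?thesis using Zs by auto
  next
    case False
    then obtain D where D: "D \<in> set Xs" "\<not> forces s D" using B Conj by auto
    then obtain E F where EF: "D = Imp E F" using Xs by blast
    then obtain t' where t': "reaches s t'" "forces t' E" "\<not> forces t' F" using D by auto
    have "t' = s"
    proof (rule ccontr)
      assume "t' \<noteq> s"
      then have "forces t' B" using s(3) t'(1) by blast
      then have "forces t' (Imp E F)" using D EF B Conj by blast
      then show False using t' forces_ImpD[of t' E F] by blast
    qed
    then show ?thesis using t' Zs D EF by auto
  qed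
  then show "forces t (Disj (map (bracket B) Zs))"
    using forces_bracket[OF t(1) s(2,3)] Disj by auto
qed

text \<open>
  The reason why B3 is restricted to atoms and boxes: only their truth depends on the root label alone.
\<close>

lemma atom_invariant:
  "(\<exists>n. p = Var n) \<or> (\<exists>D. p = Box D) \<Longrightarrow> world s = world t \<Longrightarrow> forces s p = forces t p"
  by (auto simp: steps_def)

text \<open>
  Every tree \<open>s\<close> over a world above \<open>w\<close> occurs above some tree over \<open>w\<close>, namely the one with \<open>s\<close> as its only
  child. So all trees over such a world in which \<open>p\<close> holds force \<open>A\<close>.
\<close>

lemma stably_B3:
  assumes p: "(\<exists>n. p = Var n) \<or> (\<exists>D. p = Box D)" and AB: "\<And>w. w \<in> W \<Longrightarrow> stably w A \<Longrightarrow> stably w B"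
    and "stably w (Imp p A)"
  shows "stably w (Imp p B)"
  unfolding stably_def forces.simps
proof (intro allI impI)
  fix t t' assume t: "valid t" "world t = w" "reaches t t'" "forces t' p"
  have t': "valid t'" using reaches_valid t by blast
  have wW: "w \<in> W" "world t' \<in> W" using t t' by (cases t; cases t'; auto)+
  have "stably (world t') A"
    unfolding stably_def
  proof (intro allI impI)
    fix s assume s: "valid s" "world s = world t'"
    have "forces s p" using atom_invariant[OF p s(2)] t by blast
    have "le w (world t') \<or> R w (world t')"
      using t subtree_valid[OF t(1)] by (auto simp: reaches_def steps_def)
    then have "\<exists>r. valid r \<and> world r = w \<and> reaches r s"
    proof
      assume "le w (world t')"
      then have "valid (Node w [s])" "reaches (Node w [s]) s" using s wW by (auto simp: reaches_def)
      then show ?thesis by fastforce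
    next
      assume "R w (world t')"
      then have "reaches t s" using s t by (auto simp: reaches_def steps_def)
      then show ?thesis using t by blast
    qed
    then obtain r where r: "valid r" "world r = w" "reaches r s" by blast
    then have "forces r (Imp p A)" using assms(3) unfolding stably_def by blast
    then show "forces s A" using r(3) \<open>forces s p\<close> by simp
  qed
  then have "stably (world t') B" using AB wW by blast
  then show "forces t' B" using t' unfolding stably_def by blast
qed

lemma bt_sound: "A \<triangleright> B \<Longrightarrow> w \<in> W \<Longrightarrow> stably w A \<Longrightarrow> stably w B"
proof (induction arbitrary: w rule: bt.induct)
  case (A1 A B)
  have "forces t B" if t: "valid t" "world t = w" for t
  proof (rule forces_ImpD)
    show "forces t (Imp A B)" using A1.hyps t(1) by (rule iK4_sound)
    show "forces t A" using A1.prems(2) t unfolding stably_def by blast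
  qed
  then show ?case unfolding stably_def by blast
next
  case (A4 A B)
  have "forces t (Box B)" if t: "valid t" "world t = w" for t
  proof -
    have "forces t (Box A)" using A4.prems t unfolding stably_def by blast
    then have "\<forall>v \<in> W. R (world t) v \<longrightarrow> stably v A" using stably_R[OF t(1)] by simp
    then show ?thesis using A4.IH by (simp only: stably_R[OF t(1)]) simp
  qed
  then show ?case unfolding stably_def by blast
next
  case (B1 A C B)
  have "stably w A \<or> stably w B"
  proof (rule ccontr)
    assume "\<not> (stably w A \<or> stably w B)"
    then obtain s t where st: "valid s" "world s = w" "\<not> forces s A" "valid t" "world t = w" "\<not> forces t B"
      unfolding stably_def by blast
    \<comment> \<open>The trees refuting \<open>A\<close> and \<open>B\<close> may be different. Joined under a new root over the same
      world they refute both at once.\<close>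
    let ?r = "Node w [s, t]"
    have r: "valid ?r" "reaches ?r s" "reaches ?r t" using st B1.prems by (auto simp: reaches_def le_refl)
    then have "\<not> forces ?r A" "\<not> forces ?r B" using st forces_mono by blast+
    then show False using B1.prems(2) r(1) unfolding stably_def by fastforce
  qed
  then show ?case using B1 by blast
next
  case (B2 Xs B A C Zs)
  then show ?case using stably_B2 by blast
next
  case (B3 A B p)
  then show ?case using stably_B3 by blast
qed (auto simp: stably_def)

theorem iH_sound: "A \<in> iH \<Longrightarrow> valid t \<Longrightarrow> forces t A"
proof -
  let ?T = "{A. \<forall>t. valid t \<longrightarrow> forces t A}"
  have "iH \<subseteq> ?T"
  proof (rule iH_least)
    show "iK4 \<subseteq> ?T" using iK4_sound by blast
  next
    fix A
    have Loeb: "forces s A" if "valid t" "steps t s" "forces t (Box (Imp (Box A) A))" for t s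
      using wf_R that
    proof (induction "world s" arbitrary: s t rule: wfp_induct_rule)
      case less
      then have s: "valid s" "forces s (Imp (Box A) A)" by (auto simp: steps_def simp del: forces.simps(6))
      have "forces s (Box (Imp (Box A) A))"
        using forces_mono[of t s] less.prems unfolding reaches_def by blast
      then have "forces s (Box A)"
        using less.hyps s(1) by (simp add: steps_def del: forces.simps(6))
      then show ?case using s(2) forces_ImpD[of s "Box A" A] by blast
    qed
    have "forces t (Box A)" if "valid t" "forces t (Box (Imp (Box A) A))" for t
      using Loeb that by simp
    then show "Imp (Box (Imp (Box A) A)) (Box A) \<in> ?T" by (auto intro!: forces_ImpI simp del: forces.simps)
  next
    fix A
    have "forces t (Box A)" if "valid t" "forces t A" for t
      using that forces_mono by (auto simp: reaches_def)
    then show "Imp A (Box A) \<in> ?T" by (auto intro!: forces_ImpI simp del: forces.simps)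
  next
    fix A B assume "A \<triangleright> B"
    then have "forces t (Box B)" if "valid t" "forces t (Box A)" for t
      using that bt_sound stably_R by blast
    then show "Imp (Box A) (Box B) \<in> ?T" by (auto intro!: forces_ImpI simp del: forces.simps)
  next
    show "Imp A B \<in> ?T \<Longrightarrow> A \<in> ?T \<Longrightarrow> B \<in> ?T" for A B using forces_ImpD[of _ A B] by blast
  qed
  then show "A \<in> iH \<Longrightarrow> valid t \<Longrightarrow> forces t A" by blast
qed

end

section \<open>Stable approximations\<close>

text \<open>
  No implications nested to the left, hereditarily inside boxes. Pruning a tree preserves the truth of such formulas. On
  the left of a refuted sequent they hold in all trees over it (\<open>stable_left_forced\<close>). Boxes may stand on the left like atoms because their truth depends on the root
  label alone.
\<close>

inductive stable :: "form \<Rightarrow> bool" where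
  Var: "stable (Var n)"
| Bot: "stable Bot"
| Top: "stable Top"
| And: "stable A \<Longrightarrow> stable B \<Longrightarrow> stable (And A B)"
| Or: "stable A \<Longrightarrow> stable B \<Longrightarrow> stable (Or A B)"
| Box: "stable A \<Longrightarrow> stable (Box A)"
| Imp_Var: "stable A \<Longrightarrow> stable (Imp (Var n) A)"
| Imp_Box: "stable D \<Longrightarrow> stable A \<Longrightarrow> stable (Imp (Box D) A)"

definition equiv_iH :: "form \<Rightarrow> form \<Rightarrow> bool" where
  "equiv_iH A B \<longleftrightarrow> Imp A B \<in> iH \<and> Imp B A \<in> iH"

lemma equiv_iH_refl: "equiv_iH A A"
  by (simp add: equiv_iH_def H.in_L_Imp ded.hyp)

lemma equiv_iH_trans: "equiv_iH A B \<Longrightarrow> equiv_iH B C \<Longrightarrow> equiv_iH A C"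
  unfolding equiv_iH_def H.in_L_Imp
  using H.ded_cut_set[of "{B}" C "{A}"] H.ded_cut_set[of "{B}" A "{C}"] by auto

lemma ded_weaken: "ded L {A} B \<Longrightarrow> A \<in> \<Gamma> \<Longrightarrow> ded L \<Gamma> B"
  by (erule ded_mono) auto

lemma equiv_iH_And: "equiv_iH A A' \<Longrightarrow> equiv_iH B B' \<Longrightarrow> equiv_iH (And A B) (And A' B')"
  unfolding equiv_iH_def H.in_L_Imp H.ded_And_left H.ded_And
  using ded_weaken[of iH A A'] ded_weaken[of iH A' A] ded_weaken[of iH B B'] ded_weaken[of iH B' B] by auto

lemma equiv_iH_Or: "equiv_iH A A' \<Longrightarrow> equiv_iH B B' \<Longrightarrow> equiv_iH (Or A B) (Or A' B')"
  unfolding equiv_iH_def H.in_L_Imp H.ded_Or_left by (auto intro: H.ded_OrI1 H.ded_OrI2)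

lemma equiv_iH_Imp:
  assumes "equiv_iH A A'" "equiv_iH B B'" shows "equiv_iH (Imp A B) (Imp A' B')"
proof -
  have "ded iH {Imp A B} (Imp A' B')" if "ded iH {A'} A" "ded iH {B} B'" for A A' B B'
  proof -
    have "ded iH {A', Imp A B} A" using ded_mono[OF that(1)] by simp
    then have "ded iH {A', Imp A B} B" by (rule H.ded_Imp_left[rotated]) simp
    moreover have "ded iH (insert B {A', Imp A B}) B'" using ded_mono[OF that(2)] by simp
    ultimately show ?thesis unfolding H.ded_Imp by (rule H.ded_cut)
  qed
  then show ?thesis using assms unfolding equiv_iH_def H.in_L_Imp by blast
qed

lemma equiv_iH_Box: "equiv_iH A A' \<Longrightarrow> equiv_iH (Box A) (Box A')"
  unfolding equiv_iH_def H.in_L_Imp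
  using ded_Box[of "{A}" A' "{Box A}"] ded_Box[of "{A'}" A "{Box A'}"] by (simp add: ded.hyp)

text \<open>
  The approximation of a formula introduces boxes with bodies that are not stable themselves. In \<open>nnil\<close> they are
  carried along as if they were atoms, provided that they are known to be equivalent to stable ones.
\<close>

definition good_box :: "form \<Rightarrow> bool" where
  "good_box D \<longleftrightarrow> (\<exists>D'. stable D' \<and> equiv_iH (Box D) (Box D'))"

primrec good_boxes :: "form \<Rightarrow> bool" where
  "good_boxes (Var n) = True"
| "good_boxes Bot = True"
| "good_boxes Top = True"
| "good_boxes (And A B) = (good_boxes A \<and> good_boxes B)"
| "good_boxes (Or A B) = (good_boxes A \<and> good_boxes B)"
| "good_boxes (Imp A B) = (good_boxes A \<and> good_boxes B)"
| "good_boxes (Box A) = good_box A"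

inductive nnil :: "form \<Rightarrow> bool" where
  Var: "nnil (Var n)"
| Bot: "nnil Bot"
| Top: "nnil Top"
| And: "nnil A \<Longrightarrow> nnil B \<Longrightarrow> nnil (And A B)"
| Or: "nnil A \<Longrightarrow> nnil B \<Longrightarrow> nnil (Or A B)"
| Box: "good_box A \<Longrightarrow> nnil (Box A)"
| Imp_Var: "nnil A \<Longrightarrow> nnil (Imp (Var n) A)"
| Imp_Box: "good_box D \<Longrightarrow> nnil A \<Longrightarrow> nnil (Imp (Box D) A)"

lemma nnil_stable: "nnil N \<Longrightarrow> \<exists>N'. stable N' \<and> equiv_iH N N'"
proof (induction rule: nnil.induct)
  case (And A B)
  then show ?case by (meson stable.And equiv_iH_And)
next
  case (Or A B)
  then show ?case by (meson stable.Or equiv_iH_Or)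
next
  case (Box A)
  then show ?case unfolding good_box_def by (meson stable.Box)
next
  case (Imp_Var A n)
  then show ?case by (meson stable.Imp_Var equiv_iH_Imp equiv_iH_refl)
next
  case (Imp_Box D A)
  then show ?case unfolding good_box_def by (meson stable.Imp_Box equiv_iH_Imp)
qed (meson stable.intros equiv_iH_refl)+

text \<open>
  The converse direction is only asked for in the full theory, since it depends on \<open>B \<rightarrow> \<box>B\<close>, which is
  not available in the relation \<open>\<triangleright>\<close>.
\<close>

definition approximable :: "form \<Rightarrow> bool" where
  "approximable A \<longleftrightarrow> (\<exists>N. nnil N \<and> A \<triangleright> N \<and> Imp N A \<in> iH)"

lemma approximable_good_box:
  assumes "approximable A" shows "good_box A"
proof -
  obtain N where N: "nnil N" "A \<triangleright> N" "Imp N A \<in> iH" using assms approximable_def by blast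
  obtain N' where N': "stable N'" "equiv_iH N N'" using nnil_stable N(1) by blast
  have "ded iH {Box N} (Box A)"
    using ded_Box[of "{N}" A] N(3) by (simp add: H.in_L_Imp ded.hyp)
  then have "equiv_iH (Box A) (Box N)"
    using iH_bt[OF N(2)] by (simp add: equiv_iH_def H.in_L_Imp)
  then show ?thesis
    using N' equiv_iH_Box equiv_iH_trans unfolding good_box_def by blast
qed

lemma bt_K4: "ded iK4 {A} B \<Longrightarrow> A \<triangleright> B"
  by (simp add: bt.A1 K4.in_L_Imp)

lemma ded_K4_iH: "ded iK4 \<Gamma> A \<Longrightarrow> ded iH \<Gamma> A"
  by (erule ded_mono[OF _ iK4_subset_iH]) simp

text \<open>
  Approximations pass along any step that is sound for \<open>\<triangleright>\<close> and reversible in the theory. All rewriting below is an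
  instance.
\<close>

lemma approximable_bt:
  assumes "approximable A'" "A \<triangleright> A'" "ded iH {A'} A" shows "approximable A"
proof -
  obtain N where N: "nnil N" "A' \<triangleright> N" "ded iH {N} A'"
    using assms approximable_def H.in_L_Imp by blast
  have "ded iH {N} A" using H.ded_cut_set[OF assms(3)] N(3) by simp
  then show ?thesis using N bt.A2[OF assms(2) N(2)] approximable_def H.in_L_Imp by blast
qed

lemma approximable_K4: "approximable A' \<Longrightarrow> ded iK4 {A} A' \<Longrightarrow> ded iK4 {A'} A \<Longrightarrow> approximable A"
  by (rule approximable_bt[OF _ bt_K4 ded_K4_iH])

lemma approximable_nnil: "nnil A \<Longrightarrow> approximable A"
  unfolding approximable_def by (auto simp: H.in_L_Imp ded.hyp intro!: exI[of _ A] bt_K4)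

lemma approximable_And:
  assumes "approximable A" "approximable B" shows "approximable (And A B)"
proof -
  obtain M N where M: "nnil M" "A \<triangleright> M" "ded iH {M} A" and N: "nnil N" "B \<triangleright> N" "ded iH {N} B"
    using assms approximable_def H.in_L_Imp by blast
  have "And A B \<triangleright> A" "And A B \<triangleright> B" by (auto intro!: bt_K4 simp: K4.ded_And_left ded.hyp)
  then have "And A B \<triangleright> And M N" using M(2) N(2) bt.A2 bt.A3 by meson
  moreover have "ded iH {And M N} (And A B)"
    using ded_weaken[OF M(3)] ded_weaken[OF N(3)] by (simp add: H.ded_And H.ded_And_left)
  ultimately show ?thesis using M N nnil.And approximable_def H.in_L_Imp by blast
qed

lemma approximable_Or:
  assumes "approximable A" "approximable B" shows "approximable (Or A B)"
proof -
  obtain M N where M: "nnil M" "A \<triangleright> M" "ded iH {M} A" and N: "nnil N" "B \<triangleright> N" "ded iH {N} B"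
    using assms approximable_def H.in_L_Imp by blast
  have "M \<triangleright> Or M N" "N \<triangleright> Or M N" by (auto intro!: bt_K4 intro: K4.ded_OrI1 K4.ded_OrI2 ded.hyp)
  then have "Or A B \<triangleright> Or M N" using M(2) N(2) bt.A2 bt.B1 by meson
  moreover have "ded iH {Or M N} (Or A B)"
    using M(3) N(3) by (auto simp: H.ded_Or_left intro: H.ded_OrI1 H.ded_OrI2)
  ultimately show ?thesis using M N nnil.Or approximable_def H.in_L_Imp by blast
qed

lemma approximable_Imp:
  assumes "approximable A" and p: "(\<exists>n. p = Var n) \<or> (\<exists>D. p = Box D \<and> good_box D)"
  shows "approximable (Imp p A)"
proof -
  obtain N where N: "nnil N" "A \<triangleright> N" "ded iH {N} A"
    using assms approximable_def H.in_L_Imp by blast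
  have "Imp p A \<triangleright> Imp p N" using bt.B3[OF N(2)] p by blast
  moreover have "ded iH {Imp p N} (Imp p A)"
    unfolding H.ded_Imp
    by (rule H.ded_cut_set[OF N(3)]) (auto intro: H.ded_Imp_left ded.hyp)
  moreover have "nnil (Imp p N)" using p N nnil.Imp_Var nnil.Imp_Box by blast
  ultimately show ?thesis using approximable_def H.in_L_Imp by blast
qed

lemma approximable_Conj: "\<forall>A \<in> set As. approximable A \<Longrightarrow> approximable (Conj As)"
  by (induction As rule: Conj.induct) (auto intro: approximable_nnil nnil.Top approximable_And)

lemma approximable_Disj: "\<forall>A \<in> set As. approximable A \<Longrightarrow> approximable (Disj As)"
  by (induction As rule: Disj.induct) (auto intro: approximable_nnil nnil.Bot approximable_Or)

text \<open>
  The outermost implications of a formula, exactly the places that the bracket changes.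
\<close>

primrec parts :: "form \<Rightarrow> form set" where
  "parts (Var n) = {}"
| "parts Bot = {}"
| "parts Top = {}"
| "parts (And A B) = parts A \<union> parts B"
| "parts (Or A B) = parts A \<union> parts B"
| "parts (Imp A B) = {Imp A B}"
| "parts (Box A) = {}"

lemma parts_size: "G \<in> parts E \<Longrightarrow> size G \<le> size E \<and> (good_boxes E \<longrightarrow> good_boxes G) \<and> (\<exists>A B. G = Imp A B)"
  by (induction E) auto

lemma approximable_bracket:
  "\<forall>G \<in> parts E. approximable (Imp B G) \<Longrightarrow> good_boxes E \<Longrightarrow> approximable (bracket B E)"
  by (induction E) (auto intro: approximable_nnil nnil.intros approximable_And approximable_Or)

lemma ded_bracket: "ded iH \<Gamma> B \<Longrightarrow> ded iH \<Gamma> (bracket B E) \<Longrightarrow> ded iH \<Gamma> E"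
proof (induction E arbitrary: \<Gamma>)
  case (Or E1 E2)
  then have "ded iH \<Gamma> (Or (bracket B E1) (bracket B E2))" by simp
  then show ?case
  proof (rule H.ded_OrE)
    have "ded iH (insert X \<Gamma>) B" for X by (rule ded_mono[OF Or.prems(1)]) auto
    then show "ded iH (insert (bracket B E1) \<Gamma>) (Or E1 E2)" "ded iH (insert (bracket B E2) \<Gamma>) (Or E1 E2)"
      using Or.IH ded.hyp by (auto intro: H.ded_OrI1 H.ded_OrI2)
  qed
next
  case (Imp E1 E2)
  then show ?case by (auto intro: ded.mp)
qed (auto simp: H.ded_And)

text \<open>
  Under the hypothesis \<open>E1\<close>, the implication \<open>E1 \<rightarrow> E2\<close> may be replaced by the smaller \<open>E2\<close>. This keeps the
  rewriting of brackets below from growing formulas.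
\<close>

primrec replace_part :: "form \<Rightarrow> form \<Rightarrow> form \<Rightarrow> form" where
  "replace_part G H (Var n) = Var n"
| "replace_part G H Bot = Bot"
| "replace_part G H Top = Top"
| "replace_part G H (And A B) = And (replace_part G H A) (replace_part G H B)"
| "replace_part G H (Or A B) = Or (replace_part G H A) (replace_part G H B)"
| "replace_part G H (Imp A B) = (if Imp A B = G then H else Imp A B)"
| "replace_part G H (Box A) = Box A"

lemma replace_part_size:
  assumes "size H < size G"
  shows "size (replace_part G H E) \<le> size E"
    and "G \<in> parts E \<Longrightarrow> size (replace_part G H E) < size E"
proof -
  show *: "size (replace_part G H E) \<le> size E" for E using assms by (induction E) auto
  show "G \<in> parts E \<Longrightarrow> size (replace_part G H E) < size E"
  proof (induction E)
    case (And A B)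
    then show ?case using *[of A] *[of B] by fastforce
  next
    case (Or A B)
    then show ?case using *[of A] *[of B] by fastforce
  qed (use assms in auto)
qed

lemma good_boxes_replace_part: "good_boxes H \<Longrightarrow> good_boxes E \<Longrightarrow> good_boxes (replace_part G H E)"
  by (induction E) auto

lemma ded_replace_part:
  "E1 \<in> \<Gamma> \<Longrightarrow> ded iK4 \<Gamma> (replace_part (Imp E1 E2) E2 E) = ded iK4 \<Gamma> E"
proof -
  have "E1 \<in> \<Gamma> \<Longrightarrow> ded iK4 (insert (replace_part (Imp E1 E2) E2 E) \<Gamma>) E \<and>
    ded iK4 (insert E \<Gamma>) (replace_part (Imp E1 E2) E2 E)" for \<Gamma>
  proof (induction E arbitrary: \<Gamma>)
    case (And A B)
    have "E1 \<in> insert X \<Gamma>" for X using And.prems by simp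
    note * = And.IH(1)[OF this] And.IH(2)[OF this]
    show ?case
      using *(1)[of B] *(1)[of "replace_part (Imp E1 E2) E2 B"] *(2)[of A] *(2)[of "replace_part (Imp E1 E2) E2 A"]
      by (simp add: K4.ded_And_left K4.ded_And insert_commute)
  next
    case (Or A B)
    note Or.IH(1)[OF Or.prems] Or.IH(2)[OF Or.prems]
    then show ?case by (simp add: K4.ded_Or_left K4.ded_OrI1 K4.ded_OrI2)
  next
    case (Imp A B)
    have "ded iK4 (insert E2 \<Gamma>) (Imp E1 E2)" by (simp add: K4.ded_Imp ded.hyp)
    moreover have "ded iK4 (insert (Imp E1 E2) \<Gamma>) E2"
      by (rule K4.ded_Imp_left[of E1]) (use Imp.prems in \<open>auto intro: ded.hyp\<close>)
    ultimately show ?case by (simp add: ded.hyp)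
  qed (simp_all add: ded.hyp)
  then show "E1 \<in> \<Gamma> \<Longrightarrow> ded iK4 \<Gamma> (replace_part (Imp E1 E2) E2 E) = ded iK4 \<Gamma> E"
    using K4.ded_cut[of \<Gamma> E] K4.ded_cut[of \<Gamma> "replace_part (Imp E1 E2) E2 E"] by blast
qed

text \<open>
  Every rewriting step on a sequent replaces one of its formulas by at most three smaller ones (and may
  drop others), so it decreases the multiset of sizes. Powers of 4 turn this into a decrease of
  natural numbers, because \<open>3 * 4 ^ r < 4 ^ Suc r\<close>.
\<close>

definition weight :: "form list \<Rightarrow> form \<Rightarrow> nat" where
  "weight Y C = (\<Sum>D \<leftarrow> Y. 4 ^ size D) + 4 ^ size C"

lemma weight_Cons [simp]: "weight (D # Y) C = 4 ^ size D + weight Y C"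
  by (simp add: weight_def)

lemma weight_Nil_less: "D \<in> set Y \<Longrightarrow> weight [] D < weight Y C"
  by (induction Y) (auto simp: weight_def)

lemma weight_remove1: "D \<in> set Y \<Longrightarrow> weight Y C = 4 ^ size D + weight (remove1 D Y) C"
  by (induction Y) (auto simp: weight_def)

lemma pow4_less:
  assumes "x < s" "y < s" "z < s" shows "(4::nat) ^ x + 4 ^ y + 4 ^ z < 4 ^ s"
proof -
  obtain r where s: "s = Suc r" using assms(1) by (cases s) auto
  have "(4::nat) ^ x \<le> 4 ^ r" "(4::nat) ^ y \<le> 4 ^ r" "(4::nat) ^ z \<le> 4 ^ r"
    using assms s by (auto intro!: power_increasing)
  moreover have "(0::nat) < 4 ^ r" by simp
  ultimately show ?thesis unfolding s power_Suc by linarith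
qed

lemma pow4_less2:
  assumes "x < s" "y < s" shows "(4::nat) ^ x + 4 ^ y < 4 ^ s"
  using pow4_less[OF assms assms(2)] by simp

lemma pow4_less1: assumes "x < s" shows "(4::nat) ^ x < 4 ^ s"
  using assms by simp

abbreviation seq :: "form list \<Rightarrow> form \<Rightarrow> form" where
  "seq Y C \<equiv> Imp (Conj Y) C"

lemma ded_seq: "ded iK4 \<Gamma> (seq Y C) \<longleftrightarrow> ded iK4 (set Y \<union> \<Gamma>) C"
  by (simp add: K4.ded_Imp K4.ded_Conj_left)

lemma ded_use_seq: "ded iK4 \<Gamma> (seq Y C) \<Longrightarrow> (\<And>D. D \<in> set Y \<Longrightarrow> ded iK4 \<Gamma> D) \<Longrightarrow> ded iK4 \<Gamma> C"
  by (erule ded.mp) (simp add: K4.ded_Conj)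


lemma seq_Nil: "ded iK4 {A} (seq [] A)" "ded iK4 {seq [] A} A"
proof -
  show "ded iK4 {A} (seq [] A)" by (simp add: K4.ded_Imp ded.hyp)
  show "ded iK4 {seq [] A} A" by (rule ded_use_seq[of _ "[]"]) (simp_all add: ded.hyp)
qed

lemma approximable_seq_Nil: "approximable (seq [] A) \<longleftrightarrow> approximable A"
  using approximable_K4 seq_Nil by blast

text \<open>
  Hypotheses that are not implications are decomposed, or moved in front of the
  approximation if they are atoms or boxes. The essential case is a hypothesis \<open>B\<close> that is a conjunction of
  implications. Since \<open>B \<rightarrow> \<box>B\<close> is a theorem, nothing is lost in passing from \<open>B \<rightarrow> C\<close> to \<open>\<box>B \<rightarrow> (B \<rightarrow> C)\<close>, and B3 allows B2
  to be applied behind the box \<open>\<box>B\<close>. The disjunction that results does not give back \<open>B \<rightarrow> C\<close>, because for a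
  disjunct \<open>[B]E\<close> with \<open>E \<rightarrow> F\<close> in \<open>B\<close> only \<open>F\<close> is gained; so the sequents in which \<open>E \<rightarrow> F\<close> is replaced by \<open>F\<close>
  are added as conjuncts.
\<close>

theorem approximable_seq:
  "\<forall>D \<in> set Y. good_boxes D \<Longrightarrow> good_boxes C \<Longrightarrow> approximable (seq Y C)"
proof (induction "weight Y C" arbitrary: Y C rule: less_induct)
  case less
  note IH = less.hyps and gY = less.prems(1) and gC = less.prems(2)
  consider (L) D where "D \<in> set Y" "\<nexists>E F. D = Imp E F" | (Nil) "Y = []"
    | (B) "Y \<noteq> []" "\<forall>D \<in> set Y. \<exists>E F. D = Imp E F" by blast
  then show ?case
  proof cases
    case L
    define Y' where "Y' = remove1 D Y"
    have w: "weight Y C' = 4 ^ size D + weight Y' C'" for C'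
      unfolding Y'_def by (rule weight_remove1[OF L(1)])
    have gY': "\<forall>D \<in> set Y'. good_boxes D" using gY set_remove1_subset[of D Y] Y'_def by auto
    have gD: "good_boxes D" using L gY by blast
    have setY: "set Y = insert D (set Y')"
      using L(1) unfolding Y'_def by (induction Y) auto
    have IH': "approximable (seq Y' C)" using w gY' gC by (intro IH) auto
    have atom: ?thesis if p: "(\<exists>n. D = Var n) \<or> (\<exists>E. D = Box E)"
    proof (rule approximable_K4[OF approximable_Imp[OF IH']])
      show "(\<exists>n. D = Var n) \<or> (\<exists>E. D = Box E \<and> good_box E)" using p gD by auto
      have "ded iK4 (insert D (set Y' \<union> {seq Y C})) C"
        by (rule ded_use_seq[of _ Y]) (auto simp: setY intro: ded.hyp)
      then show "ded iK4 {seq Y C} (Imp D (seq Y' C))"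
        unfolding K4.ded_Imp[of _ D] ded_seq by (simp add: insert_commute Un_commute)
      have "ded iK4 (set Y \<union> {Imp D (seq Y' C)}) (seq Y' C)"
        by (rule K4.ded_Imp_left[of D]) (auto simp: setY intro: ded.hyp)
      then show "ded iK4 {Imp D (seq Y' C)} (seq Y C)"
        by (simp add: ded_seq setY insert_absorb)
    qed
    show ?thesis
    proof (cases D)
      case (Var n)
      then show ?thesis using atom by simp
    next
      case (Box E)
      then show ?thesis using atom by simp
    next
      case Bot
      have "ded iK4 (insert Bot (set Y' \<union> {Top})) C" by (rule K4.ded_Bot_left)
      then have "ded iK4 {Top} (seq Y C)" by (simp only: ded_seq setY Bot Un_insert_left)
      then show ?thesis
        by (intro approximable_K4[OF approximable_nnil[OF nnil.Top]]) simp_all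
    next
      case Top
      show ?thesis
      proof (rule approximable_K4[OF IH'])
        show "ded iK4 {seq Y C} (seq Y' C)" unfolding ded_seq
          by (rule ded_use_seq[of _ Y]) (auto simp: setY Top intro: ded.hyp)
        show "ded iK4 {seq Y' C} (seq Y C)" unfolding ded_seq
          by (rule ded_use_seq[of _ Y']) (auto simp: setY Top intro: ded.hyp)
      qed
    next
      case (And D1 D2)
      have "approximable (seq (D1 # D2 # Y') C)"
        using gY' gD And gC w[of C] pow4_less2[of "size D1" "size D" "size D2"]
        by (intro IH) auto
      then show ?thesis
      proof (rule approximable_K4)
        show "ded iK4 {seq Y C} (seq (D1 # D2 # Y') C)" unfolding ded_seq
          by (rule ded_use_seq[of _ Y]) (auto simp: setY And K4.ded_And intro: ded.hyp)
        have "ded iK4 (set Y \<union> {seq (D1 # D2 # Y') C}) (And D1 D2)"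
          by (simp add: setY And ded.hyp)
        then show "ded iK4 {seq (D1 # D2 # Y') C} (seq Y C)" unfolding ded_seq
          by - (rule ded_use_seq[of _ "D1 # D2 # Y'"], auto simp: K4.ded_And setY intro: ded.hyp)
      qed
    next
      case (Or D1 D2)
      have "approximable (seq (D1 # Y') C)" "approximable (seq (D2 # Y') C)"
        using gY' gD Or gC w[of C] pow4_less1[of "size D1" "size D"] pow4_less1[of "size D2" "size D"]
        by (auto intro!: IH)
      then have "approximable (And (seq (D1 # Y') C) (seq (D2 # Y') C))"
        by (rule approximable_And)
      then show ?thesis
      proof (rule approximable_K4)
        show "ded iK4 {seq Y C} (And (seq (D1 # Y') C) (seq (D2 # Y') C))"
          unfolding ded_seq K4.ded_And
          by (intro conjI; rule ded_use_seq[of _ Y])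
            (auto simp: setY Or intro: ded.hyp K4.ded_OrI1 K4.ded_OrI2)
        let ?\<Gamma> = "set Y \<union> {And (seq (D1 # Y') C) (seq (D2 # Y') C)}"
        have "ded iK4 ?\<Gamma> (And (seq (D1 # Y') C) (seq (D2 # Y') C))" by (simp add: ded.hyp)
        then have S: "ded iK4 ?\<Gamma> (seq (D1 # Y') C)" "ded iK4 ?\<Gamma> (seq (D2 # Y') C)"
          by (simp_all only: K4.ded_And)
        have "ded iK4 (insert D1 ?\<Gamma>) C"
          by (rule ded_use_seq[OF ded_mono[OF S(1)]]) (auto simp: setY intro: ded.hyp)
        moreover have "ded iK4 (insert D2 ?\<Gamma>) C"
          by (rule ded_use_seq[OF ded_mono[OF S(2)]]) (auto simp: setY intro: ded.hyp)
        moreover have "ded iK4 ?\<Gamma> (Or D1 D2)" by (simp add: setY Or ded.hyp)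
        ultimately show "ded iK4 {And (seq (D1 # Y') C) (seq (D2 # Y') C)} (seq Y C)"
          unfolding ded_seq using K4.ded_OrE by simp
      qed
    next
      case (Imp D1 D2)
      then show ?thesis using L by blast
    qed
  next
    case Nil
    have "approximable C"
    proof (cases C)
      case (And C1 C2)
      have "approximable (seq [] C1)" "approximable (seq [] C2)"
        using gC And Nil pow4_less1[of "size C1" "size C"] pow4_less1[of "size C2" "size C"]
        by (intro IH; simp add: weight_def)+
      then show ?thesis unfolding approximable_seq_Nil And by (rule approximable_And)
    next
      case (Or C1 C2)
      have "approximable (seq [] C1)" "approximable (seq [] C2)"
        using gC Or Nil pow4_less1[of "size C1" "size C"] pow4_less1[of "size C2" "size C"]
        by (intro IH; simp add: weight_def)+
      then show ?thesis unfolding approximable_seq_Nil Or by (rule approximable_Or)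
    next
      case (Imp C1 C2)
      have "approximable (seq [C1] C2)"
        using gC Imp Nil pow4_less2[of "size C1" "size C" "size C2"] by (intro IH; simp add: weight_def)
      then show ?thesis using Imp by simp
    qed (use gC in \<open>auto intro!: approximable_nnil nnil.intros\<close>)
    then show ?thesis unfolding Nil approximable_seq_Nil .
  next
    case B
    define B where "B = Conj Y"
    define Zs where "Zs = map (\<lambda>D. case D of Imp E F \<Rightarrow> E | _ \<Rightarrow> D) Y @ [C]"
    define reduced where
      "reduced = map (\<lambda>D. case D of Imp E F \<Rightarrow> seq (F # remove1 D Y) C | _ \<Rightarrow> D) Y"
    let ?N = "And (Imp (Box B) (Disj (map (bracket B) Zs))) (Conj reduced)"
    have Zs: "set Zs = {E. \<exists>F. Imp E F \<in> set Y} \<union> {C}"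
    proof
      show "set Zs \<subseteq> {E. \<exists>F. Imp E F \<in> set Y} \<union> {C}" using B(2) unfolding Zs_def by fastforce
      show "{E. \<exists>F. Imp E F \<in> set Y} \<union> {C} \<subseteq> set Zs" unfolding Zs_def by force
    qed
    have reduced: "set reduced = {seq (F # remove1 (Imp E F) Y) C | E F. Imp E F \<in> set Y}"
    proof
      show "set reduced \<subseteq> {seq (F # remove1 (Imp E F) Y) C | E F. Imp E F \<in> set Y}"
        using B(2) unfolding reduced_def by fastforce
      show "{seq (F # remove1 (Imp E F) Y) C | E F. Imp E F \<in> set Y} \<subseteq> set reduced"
        unfolding reduced_def by force
    qed
    have "approximable D" if D: "D \<in> set Y" for D
    proof -
      have "approximable (seq [] D)" using D gY weight_Nil_less[OF D] by (intro IH) auto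
      then show ?thesis by (simp only: approximable_seq_Nil)
    qed
    \<comment> \<open>The new box is good because each conjunct of \<open>B\<close> has smaller weight than the whole sequent.\<close>
    then have good_B: "good_box B"
      unfolding B_def by (intro approximable_good_box approximable_Conj) blast
    \<comment> \<open>A prefixed implication \<open>B \<rightarrow> (E1 \<rightarrow> E2)\<close> inside \<open>C\<close> is the sequent with \<open>E1\<close> as a new hypothesis and
      \<open>E2\<close> instead of \<open>C\<close>.\<close>
    have bracket_C: "approximable (bracket B C)"
    proof (rule approximable_bracket[OF _ gC], intro ballI)
      fix G assume "G \<in> parts C"
      from parts_size[OF this] gC obtain E1 E2
        where G: "G = Imp E1 E2" "size G \<le> size C" "good_boxes E1" "good_boxes E2" by auto
      have "approximable (seq (E1 # Y) E2)"
        using gY G pow4_less2[of "size E1" "size C" "size E2"] by (intro IH) (auto simp: weight_def)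
      then show "approximable (Imp B G)"
      proof (rule approximable_K4)
        show "ded iK4 {Imp B G} (seq (E1 # Y) E2)" unfolding ded_seq
        proof (rule ded_use_seq[of _ "[E1]"])
          show "ded iK4 (set (E1 # Y) \<union> {Imp B G}) (seq [E1] E2)"
            unfolding B_def by (rule ded_use_seq[of _ Y]) (auto simp: G(1) intro: ded.hyp)
        qed (auto intro: ded.hyp)
        show "ded iK4 {seq (E1 # Y) E2} (Imp B G)"
          unfolding B_def ded_seq G(1) K4.ded_Imp[of _ E1]
          by (rule ded_use_seq[of _ "E1 # Y"]) (auto intro: ded.hyp)
      qed
    qed
    \<comment> \<open>If \<open>E1 \<rightarrow> E2\<close> occurs in the antecedent of a hypothesis \<open>E \<rightarrow> F\<close>, then \<open>E1\<close> and \<open>E2\<close> need not be smaller than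
      \<open>C\<close>. The weight still drops, as \<open>E1\<close> makes it possible to shrink \<open>E \<rightarrow> F\<close> to the formula \<open>D\<close>.\<close>
    have bracket_E: "approximable (bracket B E)" if EF: "Imp E F \<in> set Y" for E F
    proof (rule approximable_bracket, intro ballI)
      show "good_boxes E" using EF gY by fastforce
      then have gF: "good_boxes F" using EF gY by fastforce
      fix G assume GE: "G \<in> parts E"
      from parts_size[OF this] \<open>good_boxes E\<close> obtain E1 E2
        where G: "G = Imp E1 E2" "size G \<le> size E" "good_boxes E1" "good_boxes E2" by auto
      define D where "D = Imp (replace_part G E2 E) F"
      define Y' where "Y' = remove1 (Imp E F) Y"
      have setY: "set Y = insert (Imp E F) (set Y')"
        using EF unfolding Y'_def by (induction Y) auto
      have "size D < size (Imp E F)"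
        using replace_part_size(2)[OF _ GE, of E2] G(1) unfolding D_def by simp
      moreover have "size E1 < size (Imp E F)" "size E2 < size (Imp E F)" using G by auto
      ultimately have "(4::nat) ^ size E1 + 4 ^ size D + 4 ^ size E2 < 4 ^ size (Imp E F)"
        by (intro pow4_less)
      then have "weight (E1 # D # Y') E2 < weight Y C"
        unfolding weight_remove1[OF EF] Y'_def by (simp add: weight_def)
      then have "approximable (seq (E1 # D # Y') E2)"
        using gY G gF setY \<open>good_boxes E\<close> unfolding D_def
        by (intro IH) (auto intro: good_boxes_replace_part)
      then show "approximable (Imp B G)"
      proof (rule approximable_K4)
        show "ded iK4 {Imp B G} (seq (E1 # D # Y') E2)" unfolding ded_seq
        proof (rule ded_use_seq[of _ "[E1]"])
          let ?\<Gamma> = "set (E1 # D # Y') \<union> {Imp B G}"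
          have "ded iK4 (insert E ?\<Gamma>) (replace_part G E2 E)"
            unfolding G(1) by (subst ded_replace_part) (auto intro: ded.hyp)
          then have "ded iK4 (insert E ?\<Gamma>) F"
            by - (rule K4.ded_Imp_left[of "replace_part G E2 E"], auto simp: D_def)
          then have "ded iK4 ?\<Gamma> (Imp E F)" by (simp only: K4.ded_Imp)
          then show "ded iK4 ?\<Gamma> (seq [E1] E2)"
            unfolding B_def by - (rule ded_use_seq[of _ Y], auto simp: G(1) setY intro: ded.hyp)
        qed (auto intro: ded.hyp)
        let ?\<Gamma> = "insert E1 (set Y \<union> {seq (E1 # D # Y') E2})"
        let ?X = "replace_part G E2 E"
        have "ded iK4 (insert ?X ?\<Gamma>) ?X" by (simp add: ded.hyp)
        then have "ded iK4 (insert ?X ?\<Gamma>) E"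
          unfolding G(1) by (subst (asm) ded_replace_part) auto
        then have "ded iK4 (insert ?X ?\<Gamma>) F"
          by - (rule K4.ded_Imp_left[of E], auto simp: EF)
        then have "ded iK4 ?\<Gamma> D" unfolding D_def by (simp only: K4.ded_Imp)
        then show "ded iK4 {seq (E1 # D # Y') E2} (Imp B G)"
          unfolding B_def ded_seq G(1) K4.ded_Imp[of _ E1]
          by - (rule ded_use_seq[of _ "E1 # D # Y'"], auto simp: setY intro: ded.hyp)
      qed
    qed
    have "approximable ?N"
    proof (intro approximable_And approximable_Imp approximable_Disj approximable_Conj)
      show "\<forall>A \<in> set (map (bracket B) Zs). approximable A"
        using Zs bracket_C bracket_E by auto
      show "\<forall>A \<in> set reduced. approximable A"
      proof
        fix A assume "A \<in> set reduced"
        then obtain E F where A: "A = seq (F # remove1 (Imp E F) Y) C" "Imp E F \<in> set Y"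
          unfolding reduced by blast
        have "weight (F # remove1 (Imp E F) Y) C < weight Y C"
          unfolding weight_remove1[OF A(2)] using pow4_less1[of "size F" "size (Imp E F)"] by simp
        moreover have "good_boxes F" using A(2) gY by fastforce
        ultimately show "approximable A"
          unfolding A(1) using gY gC set_remove1_subset[of "Imp E F" Y] by (intro IH) auto
      qed
    qed (use good_B in blast)
    then show ?thesis
    proof (rule approximable_bt)
      have "seq Y C \<triangleright> Imp (Box B) (And (Imp B C) (Box B))"
        unfolding B_def
        by (rule bt_K4) (simp add: K4.ded_Imp[of _ "Box (Conj Y)"] K4.ded_And ded.hyp)
      moreover have "Imp (Box B) (And (Imp B C) (Box B)) \<triangleright> Imp (Box B) (Disj (map (bracket B) Zs))"
        by (rule bt.B3, rule bt.B2[OF B(2) B_def refl Zs]) blast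
      ultimately have 1: "seq Y C \<triangleright> Imp (Box B) (Disj (map (bracket B) Zs))" by (rule bt.A2)
      have "ded iK4 {seq Y C} A" if A_red: "A \<in> set reduced" for A
      proof -
        obtain E F where A: "A = seq (F # remove1 (Imp E F) Y) C" "Imp E F \<in> set Y"
          using A_red unfolding reduced by blast
        let ?\<Gamma> = "set (F # remove1 (Imp E F) Y) \<union> {seq Y C}"
        have "ded iK4 ?\<Gamma> D" if "D \<in> set Y" for D
        proof (cases "D = Imp E F")
          case True
          then show ?thesis by (simp add: K4.ded_Imp ded.hyp)
        qed (use that in \<open>auto intro: ded.hyp\<close>)
        then show ?thesis unfolding A(1) ded_seq
          by - (rule ded_use_seq[of _ Y], simp_all add: ded.hyp)
      qed
      then have "seq Y C \<triangleright> Conj reduced" by (intro bt_K4) (simp add: K4.ded_Conj)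
      with 1 show "seq Y C \<triangleright> ?N" by (rule bt.A3)
      let ?\<Gamma> = "set Y \<union> {?N}"
      have "ded iH ?\<Gamma> ?N" by (simp add: ded.hyp)
      then have N: "ded iH ?\<Gamma> (Imp (Box B) (Disj (map (bracket B) Zs)))"
          "\<And>A. A \<in> set reduced \<Longrightarrow> ded iH ?\<Gamma> A"
        unfolding H.ded_And H.ded_Conj by blast+
      have BG: "ded iH ?\<Gamma> B" unfolding B_def by (simp add: H.ded_Conj ded.hyp)
      from ded.mp[OF N(1) ded_CP[OF BG]] have "ded iH ?\<Gamma> (Disj (map (bracket B) Zs))" .
      moreover have "ded iH (insert (bracket B E) ?\<Gamma>) C" if E: "E \<in> set Zs" for E
      proof -
        let ?\<Delta> = "insert (bracket B E) ?\<Gamma>"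
        have mono: "ded iH ?\<Gamma> A \<Longrightarrow> ded iH ?\<Delta> A" for A by (erule ded_mono) auto
        have dE: "ded iH ?\<Delta> E" by (rule ded_bracket[OF mono[OF BG]]) (simp add: ded.hyp)
        show ?thesis
        proof (cases "E = C")
          case False
          then obtain F where F: "Imp E F \<in> set Y" using E Zs by auto
          have "ded iH ?\<Delta> F" by (rule H.ded_Imp_left[OF _ dE]) (simp add: F)
          moreover have "ded iH ?\<Delta> (seq (F # remove1 (Imp E F) Y) C)"
            by (rule mono[OF N(2)]) (use F reduced in blast)
          moreover have "ded iH ?\<Delta> D" if "D \<in> set (remove1 (Imp E F) Y)" for D
            using that set_remove1_subset[of "Imp E F" Y] by (auto intro: ded.hyp)
          ultimately show ?thesis by (auto intro: ded.mp simp: H.ded_Conj)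
        qed (use dE in simp)
      qed
      ultimately have "ded iH ?\<Gamma> C"
        by - (erule H.ded_cut, simp only: H.ded_Disj_left set_map, blast)
      then show "ded iH {?N} (seq Y C)" by (simp add: H.ded_Imp H.ded_Conj_left)
    qed
  qed
qed

text \<open>
  Boxes are reduced from the inside out.
\<close>

theorem good_boxes: "good_boxes A"
proof (induction A)
  case (Box A)
  have "approximable (seq [] A)" using Box by (intro approximable_seq) auto
  then show ?case unfolding approximable_seq_Nil by (simp add: approximable_good_box)
qed auto

theorem ex_stable_approximation:
  "\<exists>N. stable N \<and> Imp (Box A) (Box N) \<in> iH \<and> Imp N A \<in> iH"
proof -
  have "approximable (seq [] A)" using good_boxes by (intro approximable_seq) auto
  then have "approximable A" by (simp only: approximable_seq_Nil)
  then obtain M where M: "nnil M" "A \<triangleright> M" "ded iH {M} A"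
    unfolding approximable_def H.in_L_Imp by blast
  obtain N where N: "stable N" "equiv_iH M N" using nnil_stable[OF M(1)] by blast
  have "ded iH {Box A} (Box M)" "ded iH {Box M} (Box N)"
    using iH_bt[OF M(2)] equiv_iH_Box[OF N(2)] by (simp_all add: equiv_iH_def H.in_L_Imp)
  then have "ded iH {Box A} (Box N)" using H.ded_cut_set[of "{Box M}" "Box N" "{Box A}"] by simp
  moreover have "ded iH {N} A"
    using N(2) H.ded_cut_set[OF M(3), of "{N}"] by (simp add: equiv_iH_def H.in_L_Imp)
  ultimately show ?thesis using N(1) H.in_L_Imp by blast
qed

section \<open>Refuted sequents\<close>

text \<open>
  A condition under which all trees over every \<open>R\<close>-successor force \<open>F\<close>, where \<open>F\<close> or \<open>\<box>F\<close> belongs to \<open>G\<close>. A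
  single tree over the successor can be inspected locally, but for all trees one has to rely on
  stability.
\<close>

definition secured :: "form list \<Rightarrow> form \<Rightarrow> bool" where
  "secured G F \<longleftrightarrow> stable F \<or> (\<exists>N. stable N \<and> Box N \<in> set G \<and> Imp N F \<in> iH)"

text \<open>
  Implications have to be secured as well as boxes, since they are also evaluated in the trees over
  \<open>R\<close>-successors.
\<close>

primrec left_ok :: "form list \<Rightarrow> form list \<Rightarrow> form \<Rightarrow> bool" where
  "left_ok G D (Var n) \<longleftrightarrow> Var n \<notin> set D"
| "left_ok G D Bot \<longleftrightarrow> False"
| "left_ok G D Top \<longleftrightarrow> True"
| "left_ok G D (And A B) \<longleftrightarrow> A \<in> set G \<and> B \<in> set G"
| "left_ok G D (Or A B) \<longleftrightarrow> A \<in> set G \<or> B \<in> set G"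
| "left_ok G D (Imp A B) \<longleftrightarrow> (A \<in> set D \<or> B \<in> set G) \<and> secured G (Imp A B)"
| "left_ok G D (Box A) \<longleftrightarrow> secured G A"

definition unbox :: "form list \<Rightarrow> form set" where
  "unbox G = {A. Box A \<in> set G}"

text \<open>
  The parameter \<open>Q\<close> stands for the refuted sequents. Along \<open>R\<close> the rank decreases, which makes the model of all refuted
  sequents conversely well-founded; along the intuitionistic order it is enough that the
  derivation of refutedness is well-founded.
\<close>

primrec right_ok :: "(nat \<Rightarrow> form list \<Rightarrow> form list \<Rightarrow> bool) \<Rightarrow> nat \<Rightarrow> form list \<Rightarrow> form list \<Rightarrow> form \<Rightarrow> bool" where
  "right_ok Q k G D (Var n) \<longleftrightarrow> True"
| "right_ok Q k G D Bot \<longleftrightarrow> True"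
| "right_ok Q k G D Top \<longleftrightarrow> False"
| "right_ok Q k G D (And A B) \<longleftrightarrow> A \<in> set D \<or> B \<in> set D"
| "right_ok Q k G D (Or A B) \<longleftrightarrow> A \<in> set D \<and> B \<in> set D"
| "right_ok Q k G D (Imp A B) \<longleftrightarrow> A \<in> set G \<and> B \<in> set D \<or>
     (\<exists>G' D'. Q k G' D' \<and> set G \<subseteq> set G' \<and> A \<in> set G' \<and> B \<in> set D')"
| "right_ok Q k G D (Box A) \<longleftrightarrow>
     (\<exists>k' G' D'. k' < k \<and> Q k' G' D' \<and> set G \<subseteq> set G' \<and> unbox G \<subseteq> set G' \<and> A \<in> set D')"

lemma right_ok_mono [mono]: "Q \<le> Q' \<Longrightarrow> right_ok Q k G D A \<longrightarrow> right_ok Q' k G D A"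
  by (cases A) (auto simp: le_fun_def; blast)+

inductive refuted :: "nat \<Rightarrow> form list \<Rightarrow> form list \<Rightarrow> bool" where
  intro: "\<forall>A \<in> set G. left_ok G D A \<Longrightarrow> \<forall>A \<in> set D. right_ok refuted k G D A \<Longrightarrow> refuted k G D"

text \<open>
  Refuted sequents with their ranks serve as the worlds of a model. A right-hand side is not
  preserved upwards: it is made false by some tree over the world, not by all. So of
  the two sides only the left one enters the relations.
\<close>

definition seq_le :: "nat \<times> form list \<times> form list \<Rightarrow> nat \<times> form list \<times> form list \<Rightarrow> bool" where
  "seq_le = (\<lambda>(k, G, D) (k', G', D'). k' \<le> k \<and> set G \<subseteq> set G')"

definition seq_R :: "nat \<times> form list \<times> form list \<Rightarrow> nat \<times> form list \<times> form list \<Rightarrow> bool" where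
  "seq_R = (\<lambda>(k, G, D) (k', G', D'). k' < k \<and> set G \<subseteq> set G' \<and> unbox G \<subseteq> set G')"

lemma seq_le_iff [simp]: "seq_le (k, G, D) (k', G', D') \<longleftrightarrow> k' \<le> k \<and> set G \<subseteq> set G'"
  by (simp add: seq_le_def)

lemma seq_R_iff [simp]:
  "seq_R (k, G, D) (k', G', D') \<longleftrightarrow> k' < k \<and> set G \<subseteq> set G' \<and> unbox G \<subseteq> set G'"
  by (simp add: seq_R_def)

global_interpretation S: model "{(k, G, D). refuted k G D}" seq_le seq_R "\<lambda>(k, G, D). {n. Var n \<in> set G}"
proof
  have "wfp (\<lambda>y x. fst y < (fst x :: nat))" by (rule wfp_if_convertible_to_nat[where f = fst]) simp
  then show "wfp (\<lambda>y x. seq_R x y)"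
    by (rule wfp_subset) (auto simp: seq_R_def)
qed (auto simp: seq_le_def seq_R_def unbox_def; blast?)+

abbreviation over :: "nat \<Rightarrow> form list \<Rightarrow> form list \<Rightarrow> (nat \<times> form list \<times> form list) tree \<Rightarrow> bool" where
  "over k G D t \<equiv> S.valid t \<and> world t = (k, G, D)"

lemma valid_refuted: "over k G D t \<Longrightarrow> refuted k G D"
  by (cases t) auto

text \<open>
  One tree over the world that takes both sides of the sequent at their word. The following lemmas construct it by induction
  on the rank: realised sequents of smaller rank are what refutes the boxes on the right.
\<close>

definition realised :: "nat \<Rightarrow> form list \<Rightarrow> form list \<Rightarrow> bool" where
  "realised k G D \<longleftrightarrow> (\<exists>t. over k G D t \<and> (\<forall>A \<in> set G. S.forces t A) \<and> (\<forall>A \<in> set D. \<not> S.forces t A))"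

lemma refuted_left: "refuted k G D \<Longrightarrow> A \<in> set G \<Longrightarrow> left_ok G D A"
  by (erule refuted.cases) blast

lemma refuted_right: "refuted k G D \<Longrightarrow> A \<in> set D \<Longrightarrow> right_ok refuted k G D A"
  by (erule refuted.cases) blast

definition realised_below :: "nat \<Rightarrow> bool" where
  "realised_below k \<longleftrightarrow> (\<forall>j < k. \<forall>G D. refuted j G D \<longrightarrow> realised j G D)"

lemma realised_below_mono: "realised_below k \<Longrightarrow> j \<le> k \<Longrightarrow> realised_below j"
  by (simp add: realised_below_def)

lemma right_Box_not_forced:
  assumes k: "realised_below k" and t: "over k G D t" and A: "Box A \<in> set D"
  shows "\<not> S.forces t (Box A)"
proof -
  obtain k' G' D' where *: "k' < k" "refuted k' G' D'" "set G \<subseteq> set G'" "unbox G \<subseteq> set G'" "A \<in> set D'"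
    using refuted_right[OF valid_refuted[OF t] A] by auto
  then obtain t' where t': "over k' G' D' t'" "\<not> S.forces t' A"
    using k unfolding realised_def realised_below_def by blast
  then have "S.steps t t'" using * t by (simp add: S.steps_def seq_R_iff)
  then show ?thesis using t'(2) by auto
qed

lemma over_steps:
  assumes "over k G D t" "S.steps t t'"
  obtains k' G' D' where "over k' G' D' t'" "k' < k" "set G \<subseteq> set G'" "unbox G \<subseteq> set G'"
proof -
  obtain k' G' D' where "world t' = (k', G', D')" by (metis prod_cases3)
  then show thesis using assms by (intro that[of k' G' D']) (auto simp: S.steps_def seq_R_iff)
qed

lemma over_reaches:
  assumes "over k G D t" "S.reaches t t'"
  obtains k' G' D' where "over k' G' D' t'" "k' \<le> k" "set G \<subseteq> set G'"
proof -
  obtain k' G' D' where w: "world t' = (k', G', D')" by (metis prod_cases3)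
  have "seq_le (k, G, D) (k', G', D') \<or> seq_R (k, G, D) (k', G', D')"
    using assms S.subtree_valid[of t t'] w by (auto simp: S.reaches_def S.steps_def)
  moreover have "S.valid t'" using S.reaches_valid assms by blast
  ultimately show thesis using w by (intro that[of k' G' D']) (auto simp: seq_le_iff seq_R_iff)
qed

text \<open>
  If the antecedent \<open>p\<close> of an implication on the left is forced, then it cannot occur on the
  right, since false atoms and boxes are false in all trees over a world. So the local condition for the implication puts the
  succedent on the left.
\<close>

lemma stable_left_forced:
  "realised_below k \<Longrightarrow> over k G D t \<Longrightarrow> A \<in> set G \<Longrightarrow> stable A \<Longrightarrow> S.forces t A"
proof (induction A arbitrary: k G D t)
  case (Var n)
  then show ?case by simp
next
  case Bot
  then show ?case using refuted_left[OF valid_refuted[OF Bot.prems(2)] Bot.prems(3)] by simp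
next
  case (And A B)
  have "stable A" "stable B" using And.prems(4) by (auto elim: stable.cases)
  moreover have "A \<in> set G" "B \<in> set G"
    using refuted_left[OF valid_refuted[OF And.prems(2)] And.prems(3)] by auto
  ultimately show ?case using And.IH And.prems(1,2) by simp
next
  case (Or A B)
  have "stable A" "stable B" using Or.prems(4) by (auto elim: stable.cases)
  moreover have "A \<in> set G \<or> B \<in> set G"
    using refuted_left[OF valid_refuted[OF Or.prems(2)] Or.prems(3)] by auto
  ultimately show ?case using Or.IH Or.prems(1,2) by auto
next
  case (Box A)
  have "stable A" using Box.prems(4) by (auto elim: stable.cases)
  show ?case unfolding S.forces.simps
  proof (intro allI impI)
    fix t' assume step: "S.steps t t'"
    obtain k' G' D' where *: "over k' G' D' t'" "k' < k" "set G \<subseteq> set G'" "unbox G \<subseteq> set G'"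
      by (rule over_steps[OF Box.prems(2) step])
    then have "A \<in> set G'" using Box.prems(3) by (auto simp: unbox_def)
    moreover have "realised_below k'" using realised_below_mono[OF Box.prems(1)] *(2) by simp
    ultimately show "S.forces t' A" using Box.IH[OF _ *(1)] \<open>stable A\<close> by blast
  qed
next
  case Top
  then show ?case by simp
next
  case (Imp p A)
  have A: "stable A" and p: "(\<exists>n. p = Var n) \<or> (\<exists>E. p = Box E)"
    using Imp.prems(4) by (auto elim: stable.cases)
  show ?case unfolding S.forces.simps
  proof (intro allI impI)
    fix t' assume reach: "S.reaches t t'" and fp: "S.forces t' p"
    obtain k' G' D' where *: "over k' G' D' t'" "k' \<le> k" "set G \<subseteq> set G'"
      by (rule over_reaches[OF Imp.prems(2) reach])
    have k': "realised_below k'" by (rule realised_below_mono[OF Imp.prems(1) *(2)])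
    note left = refuted_left[OF valid_refuted[OF *(1)]]
    have "p \<in> set D' \<or> A \<in> set G'" using left[of "Imp p A"] * Imp.prems(3) by auto
    moreover have "p \<notin> set D'"
    proof
      assume D': "p \<in> set D'"
      show False
      proof (cases "\<exists>n. p = Var n")
        case True
        then obtain n where n: "p = Var n" by blast
        then have "Var n \<in> set G'" using fp * by simp
        from left[OF this] show False using D' n by simp
      next
        case False
        then show False using p right_Box_not_forced[OF k' *(1)] D' fp by blast
      qed
    qed
    ultimately show "S.forces t' A" using Imp.IH(2)[OF k' *(1)] A by blast
  qed
qed

text \<open>
  If \<open>F\<close> is not stable, its approximation \<open>N\<close> is moved to the left by the box; all trees force \<open>N\<close>, and
  hence \<open>F\<close> because \<open>N \<rightarrow> F\<close> is a theorem, by soundness.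
\<close>

lemma secured_step:
  assumes k: "realised_below k" and t: "over k G D t" and F: "F \<in> set G \<or> Box F \<in> set G" "secured G F"
    and t': "S.steps t t'"
  shows "S.forces t' F"
proof -
  obtain k' G' D' where *: "over k' G' D' t'" "k' < k" "set G \<subseteq> set G'" "unbox G \<subseteq> set G'"
    by (rule over_steps[OF t t'])
  have stable: "S.forces t' N" if "N \<in> set G'" "stable N" for N
    using stable_left_forced[OF _ *(1) that] realised_below_mono[OF k] *(2) by simp
  show ?thesis
  proof (cases "stable F")
    case True
    then show ?thesis using stable F(1) * by (auto simp: unbox_def)
  next
    case False
    then obtain N where N: "stable N" "Box N \<in> set G" "Imp N F \<in> iH"
      using F(2) unfolding secured_def by blast
    then have "S.forces t' N" using stable * by (auto simp: unbox_def)
    then show ?thesis using S.forces_ImpD S.iH_sound[OF N(3)] * by blast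
  qed
qed

lemma refuted_realised_step:
  assumes k: "realised_below k" and ref: "refuted k G D"
    and wit: "\<And>A B. Imp A B \<in> set D \<Longrightarrow> A \<in> set G \<and> B \<in> set D \<or>
      (\<exists>G' D'. realised k G' D' \<and> set G \<subseteq> set G' \<and> A \<in> set G' \<and> B \<in> set D')"
  shows "realised k G D"
proof -
  \<comment> \<open>The realising tree has one child for each implication on the right that is not refuted at
    the root.\<close>
  define I where "I = {(A, B). Imp A B \<in> set D \<and> \<not> (A \<in> set G \<and> B \<in> set D)}"
  have "I \<subseteq> (\<lambda>F. case F of Imp A B \<Rightarrow> (A, B) | _ \<Rightarrow> (F, F)) ` set D"
    unfolding I_def by (force simp: image_iff)
  then have fin: "finite I" by (rule finite_subset) simp
  have "\<forall>AB \<in> I. \<exists>t. S.valid t \<and> seq_le (k, G, D) (world t) \<and> (\<forall>C \<in> set G. S.forces t C) \<and>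
      S.forces t (fst AB) \<and> \<not> S.forces t (snd AB)"
  proof
    fix AB assume AB: "AB \<in> I"
    obtain A B where AB': "AB = (A, B)" by fastforce
    then obtain G' D' where *: "realised k G' D'" "set G \<subseteq> set G'" "A \<in> set G'" "B \<in> set D'"
      using AB wit[of A B] unfolding I_def by auto
    then obtain t where "over k G' D' t" "\<forall>A \<in> set G'. S.forces t A" "\<forall>A \<in> set D'. \<not> S.forces t A"
      unfolding realised_def by blast
    then show "\<exists>t. S.valid t \<and> seq_le (k, G, D) (world t) \<and> (\<forall>C \<in> set G. S.forces t C) \<and>
      S.forces t (fst AB) \<and> \<not> S.forces t (snd AB)"
      using * AB' by (intro exI[of _ t]) (auto simp: seq_le_iff)
  qed
  then obtain f where f: "\<And>A B. (A, B) \<in> I \<Longrightarrow> S.valid (f (A, B)) \<and> seq_le (k, G, D) (world (f (A, B))) \<and>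
      (\<forall>C \<in> set G. S.forces (f (A, B)) C) \<and> S.forces (f (A, B)) A \<and> \<not> S.forces (f (A, B)) B"
    by (metis fst_conv snd_conv)
  obtain ts where ts: "set ts = f ` I" using finite_list fin by (metis finite_imageI)
  let ?t = "Node (k, G, D) ts"
  have t: "over k G D ?t" using ref f ts by auto
  have child: "S.valid s \<and> (\<forall>C \<in> set G. S.forces s C)" if "s \<in> set ts" for s
    using f ts that by auto
  have reach: "t' = ?t \<or> S.steps ?t t' \<or> (\<exists>s \<in> set ts. S.reaches s t')" if "S.reaches ?t t'" for t'
    using that by (auto simp: S.reaches_def)
  have "(A \<in> set G \<longrightarrow> S.forces ?t A) \<and> (A \<in> set D \<longrightarrow> \<not> S.forces ?t A)" for A
  proof (induction A)
    case (Var n)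
    then show ?case using refuted_left[OF ref, of "Var n"] by auto
  next
    case Bot
    then show ?case using refuted_left[OF ref, of Bot] by auto
  next
    case Top
    then show ?case using refuted_right[OF ref, of Top] by auto
  next
    case (And A B)
    then show ?case using refuted_left[OF ref, of "And A B"] refuted_right[OF ref, of "And A B"] by auto
  next
    case (Or A B)
    then show ?case using refuted_left[OF ref, of "Or A B"] refuted_right[OF ref, of "Or A B"] by auto
  next
    case (Box A)
    have "S.forces ?t (Box A)" if "Box A \<in> set G"
      using secured_step[OF k t, of A] that refuted_left[OF ref that] by simp
    then show ?case using right_Box_not_forced[OF k t] by blast
  next
    case (Imp A B)
    have "S.forces ?t (Imp A B)" if G: "Imp A B \<in> set G"
      unfolding S.forces.simps
    proof (intro allI impI)
      fix t' assume t': "S.reaches ?t t'" "S.forces t' A"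
      from reach[OF t'(1)] consider "t' = ?t" | "S.steps ?t t'" | s where "s \<in> set ts" "S.reaches s t'"
        by blast
      then show "S.forces t' B"
      proof cases
        case 1
        then show ?thesis using Imp.IH t'(2) refuted_left[OF ref G] by auto
      next
        case 2
        have "S.forces t' (Imp A B)"
          using secured_step[OF k t _ _ 2, of "Imp A B"] G refuted_left[OF ref G] by simp
        then show ?thesis using t'(2) S.forces_ImpD by blast
      next
        case 3
        then have "S.forces s (Imp A B)" using child G by blast
        then show ?thesis using 3(2) t'(2) by simp
      qed
    qed
    moreover have "\<not> S.forces ?t (Imp A B)" if D: "Imp A B \<in> set D"
    proof (cases "(A, B) \<in> I")
      case True
      then have "f (A, B) \<in> set ts" using ts by simp
      then have "S.reaches ?t (f (A, B))" using subtrees_refl by (auto simp: S.reaches_def simp del: subtrees_refl)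
      then show ?thesis using f[OF True] by auto
    next
      case False
      then have "A \<in> set G" "B \<in> set D" using D unfolding I_def by auto
      then show ?thesis using Imp.IH S.forces_ImpD by blast
    qed
    ultimately show ?case by blast
  qed
  then show ?thesis unfolding realised_def using t by blast
qed

theorem refuted_realised: "refuted k G D \<Longrightarrow> realised k G D"
proof (induction k arbitrary: G D rule: less_induct)
  case (less k)
  have below: "realised_below k" using less.IH unfolding realised_below_def by blast
  \<comment> \<open>Within one rank the argument is by induction on the derivation; the induction for smaller ranks has to
    come first, as it is needed for all trees over sequents of rank \<open>k\<close>.\<close>
  have "refuted k G D \<and> realised k G D" if "refuted k' G D" "k' = k" for k' G D
    using that
  proof (induction rule: refuted.induct)
    case (intro G D k')
    have "right_ok refuted k' G D A" if "A \<in> set D" for A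
    proof -
      have "right_ok (\<lambda>j G D. refuted j G D \<and> (j = k \<longrightarrow> refuted k G D \<and> realised k G D)) k' G D A"
        using intro.IH that by blast
      then show ?thesis
        by (rule right_ok_mono[THEN HOL.mp, rotated]) (auto simp: le_fun_def)
    qed
    then have ref: "refuted k G D" using intro refuted.intro by blast
    moreover have "realised k G D"
    proof (rule refuted_realised_step[OF below ref])
      fix A B assume "Imp A B \<in> set D"
      with intro.IH have "right_ok (\<lambda>j G D. refuted j G D \<and> (j = k \<longrightarrow> refuted k G D \<and> realised k G D)) k' G D (Imp A B)"
        by blast
      then show "A \<in> set G \<and> B \<in> set D \<or>
          (\<exists>G' D'. realised k G' D' \<and> set G \<subseteq> set G' \<and> A \<in> set G' \<and> B \<in> set D')"
        using \<open>k' = k\<close> by auto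
    qed
    ultimately show ?case by blast
  qed
  then show ?case using less.prems by blast
qed

corollary refuted_not_iH:
  assumes "refuted k G D" "A \<in> set D" shows "A \<notin> iH"
  using refuted_realised[OF assms(1)] assms(2) S.iH_sound unfolding realised_def by blast

primrec subforms :: "form \<Rightarrow> form set" where
  "subforms (Var n) = {Var n}"
| "subforms Bot = {Bot}"
| "subforms Top = {Top}"
| "subforms (And A B) = insert (And A B) (subforms A \<union> subforms B)"
| "subforms (Or A B) = insert (Or A B) (subforms A \<union> subforms B)"
| "subforms (Imp A B) = insert (Imp A B) (subforms A \<union> subforms B)"
| "subforms (Box A) = insert (Box A) (subforms A)"

lemma subforms_refl [simp]: "A \<in> subforms A"
  by (cases A) auto

lemma finite_subforms: "finite (subforms A)"
  by (induction A) auto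

lemma subforms_trans: "B \<in> subforms A \<Longrightarrow> C \<in> subforms B \<Longrightarrow> C \<in> subforms A"
  by (induction A) auto

lemma stable_subforms: "stable A \<Longrightarrow> B \<in> subforms A \<Longrightarrow> stable B"
  by (induction rule: stable.induct) (auto intro: stable.intros)

text \<open>
  A finite set in which saturation takes place. The last assumption makes it contain the approximations that
  \<open>secured\<close> asks for; it is no threat to finiteness because subformulas of the approximations are stable.
\<close>

locale fragment =
  fixes \<Phi> :: "form set"
  assumes finite: "finite \<Phi>" and closed: "A \<in> \<Phi> \<Longrightarrow> subforms A \<subseteq> \<Phi>"
    and secure: "Box F \<in> \<Phi> \<or> (\<exists>A B. F = Imp A B \<and> F \<in> \<Phi>) \<Longrightarrow> stable F \<or>
      (\<exists>N. stable N \<and> Box N \<in> \<Phi> \<and> Imp (Box F) (Box N) \<in> iH \<and> Imp N F \<in> iH)"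
begin

definition saturated :: "form set \<Rightarrow> form \<Rightarrow> bool" where
  "saturated \<Gamma> C \<longleftrightarrow> \<Gamma> \<subseteq> \<Phi> \<and> \<not> ded iH \<Gamma> C \<and> (\<forall>A \<in> \<Phi> - \<Gamma>. ded iH (insert A \<Gamma>) C)"

lemma saturate:
  assumes "\<Gamma> \<subseteq> \<Phi>" "\<not> ded iH \<Gamma> C" shows "\<exists>\<Gamma>'. \<Gamma> \<subseteq> \<Gamma>' \<and> saturated \<Gamma>' C"
proof -
  let ?S = "{\<Gamma>'. \<Gamma> \<subseteq> \<Gamma>' \<and> \<Gamma>' \<subseteq> \<Phi> \<and> \<not> ded iH \<Gamma>' C}"
  have "finite ?S" by (rule finite_subset[of _ "Pow \<Phi>"]) (use finite in auto)
  moreover have "\<Gamma> \<in> ?S" using assms by simp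
  ultimately obtain M where M: "M \<in> ?S" "\<And>N. N \<in> ?S \<Longrightarrow> M \<subseteq> N \<Longrightarrow> M = N"
    by (metis (no_types, lifting) finite_has_maximal2)
  have "ded iH (insert A M) C" if "A \<in> \<Phi> - M" for A
    using M(1) M(2)[of "insert A M"] that by blast
  then show ?thesis using M(1) unfolding saturated_def by blast
qed

definition boxes_left :: "form set \<Rightarrow> nat" where
  "boxes_left \<Gamma> = card {F \<in> \<Phi> - \<Gamma>. \<exists>A. F = Box A}"

text \<open>
  The sets on the left grow along both relations. New boxes appear on the left when a box is
  refuted, so the number of boxes not on the left is a suitable rank.
\<close>

lemma saturated_refuted:
  "saturated (set G) C \<Longrightarrow> set D = \<Phi> - set G \<Longrightarrow> boxes_left (set G) \<le> k \<Longrightarrow> refuted k G D"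
proof (induction "card (\<Phi> - set G)" arbitrary: G D C k rule: less_induct)
  case less
  let ?\<Gamma> = "set G"
  have \<Gamma>: "?\<Gamma> \<subseteq> \<Phi>" "\<not> ded iH ?\<Gamma> C" "\<And>A. A \<in> \<Phi> \<Longrightarrow> A \<notin> ?\<Gamma> \<Longrightarrow> ded iH (insert A ?\<Gamma>) C"
    using less.prems(1) unfolding saturated_def by auto
  have ded: "A \<in> ?\<Gamma>" if "A \<in> \<Phi>" "ded iH ?\<Gamma> A" for A
    using \<Gamma> H.ded_cut that by blast
  have sub: "B \<in> \<Phi>" if "A \<in> \<Phi>" "B \<in> subforms A" for A B using closed that by blast
  have next_refuted: "\<exists>G' D'. refuted k' G' D' \<and> set G' \<supseteq> \<Delta> \<and> A \<in> set D'"
    if \<Delta>: "?\<Gamma> \<subset> \<Delta>" "\<Delta> \<subseteq> \<Phi>" "\<not> ded iH \<Delta> A" "A \<in> \<Phi>" "boxes_left \<Delta> \<le> k'" for \<Delta> A k'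
  proof -
    obtain \<Gamma>' where \<Gamma>': "\<Delta> \<subseteq> \<Gamma>'" "saturated \<Gamma>' A" using saturate[OF \<Delta>(2,3)] by blast
    have "\<Gamma>' \<subseteq> \<Phi>" using \<Gamma>'(2) saturated_def by blast
    then obtain G' D' where G': "set G' = \<Gamma>'" "set D' = \<Phi> - \<Gamma>'"
      using finite_list[OF finite_subset[OF _ finite]] by (metis Diff_subset)
    have "card (\<Phi> - set G') < card (\<Phi> - ?\<Gamma>)"
      unfolding G' by (rule psubset_card_mono) (use finite \<Delta> \<Gamma>' \<open>\<Gamma>' \<subseteq> \<Phi>\<close> in auto)
    moreover have "boxes_left \<Gamma>' \<le> boxes_left \<Delta>"
      unfolding boxes_left_def by (rule card_mono) (use finite \<Gamma>' in auto)
    ultimately have "refuted k' G' D'"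
      using less.hyps[of G' A D' k'] G' \<Gamma>'(2) \<Delta>(5) by simp
    moreover have "A \<notin> \<Gamma>'" using \<Gamma>'(2) ded.hyp[of A \<Gamma>'] unfolding saturated_def by blast
    ultimately show ?thesis using G' \<Gamma>'(1) \<Delta>(4) by (intro exI[of _ G'] exI[of _ D']) simp
  qed
  have secured: "secured G F"
    if F: "ded iH ?\<Gamma> (Box F)" "Box F \<in> \<Phi> \<or> (\<exists>A B. F = Imp A B \<and> F \<in> \<Phi>)" for F
  proof (cases "stable F")
    case False
    then obtain N where N: "stable N" "Box N \<in> \<Phi>" "Imp (Box F) (Box N) \<in> iH" "Imp N F \<in> iH"
      using secure[OF F(2)] by blast
    have "ded iH ?\<Gamma> (Box N)" by (rule ded.mp[OF ded.base[OF N(3)] F(1)])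
    then show ?thesis using ded N unfolding secured_def by blast
  qed (simp add: secured_def)
  show ?case
  proof (rule refuted.intro; intro ballI)
    fix A assume A: "A \<in> set G"
    then have A\<Phi>: "A \<in> \<Phi>" and dA: "ded iH ?\<Gamma> A" using \<Gamma>(1) by (auto intro: ded.hyp)
    show "left_ok G D A"
    proof (cases A)
      case (Var n)
      then show ?thesis using A less.prems by auto
    next
      case Bot
      then have "insert Bot ?\<Gamma> = ?\<Gamma>" using A by auto
      then show ?thesis using \<Gamma>(2) H.ded_Bot_left by metis
    next
      case (And B E)
      then show ?thesis using ded sub[OF A\<Phi>] dA by (auto simp: H.ded_And)
    next
      case (Or B E)
      then have "B \<in> \<Phi>" "E \<in> \<Phi>" using sub[OF A\<Phi>] by auto
      then show ?thesis using \<Gamma> Or dA H.ded_OrE by (metis left_ok.simps(5))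
    next
      case (Imp B E)
      then have BE: "B \<in> \<Phi>" "E \<in> \<Phi>" using sub[OF A\<Phi>] by auto
      have "B \<in> set D \<or> E \<in> set G"
        using BE ded[of E] dA ded.hyp[of B ?\<Gamma> iH] ded.mp[of iH ?\<Gamma> B E] Imp less.prems(2) by blast
      then show ?thesis using secured[of A] A\<Phi> ded_CP[OF dA] Imp by auto
    next
      case (Box B)
      then show ?thesis using secured[of B] A\<Phi> dA by auto
    qed simp
  next
    fix A assume A: "A \<in> set D"
    then have A\<Phi>: "A \<in> \<Phi>" "A \<notin> ?\<Gamma>" using less.prems(2) by auto
    then have dA: "\<not> ded iH ?\<Gamma> A" using ded by blast
    show "right_ok refuted k G D A"
    proof (cases A)
      case Top
      then show ?thesis using dA by simp
    next
      case (And B E)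
      then have "B \<in> \<Phi>" "E \<in> \<Phi>" using sub[OF A\<Phi>(1)] by auto
      then show ?thesis using And dA less.prems(2) ded.hyp by (auto simp: H.ded_And)
    next
      case (Or B E)
      then have "B \<in> \<Phi>" "E \<in> \<Phi>" using sub[OF A\<Phi>(1)] by auto
      then show ?thesis using Or dA less.prems(2) ded.hyp by (auto intro: H.ded_OrI1 H.ded_OrI2)
    next
      case (Imp B E)
      then have BE: "B \<in> \<Phi>" "E \<in> \<Phi>" using sub[OF A\<Phi>(1)] by auto
      have E: "\<not> ded iH (insert B ?\<Gamma>) E" using dA Imp by (simp add: H.ded_Imp)
      show ?thesis
      proof (cases "B \<in> ?\<Gamma>")
        case True
        then have "E \<notin> ?\<Gamma>" using E ded.hyp by blast
        then show ?thesis using True BE less.prems(2) Imp by simp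
      next
        case False
        have "boxes_left (insert B ?\<Gamma>) \<le> k"
          by (rule le_trans[OF _ less.prems(3)], unfold boxes_left_def, rule card_mono) (use finite in auto)
        then show ?thesis
          using next_refuted[of "insert B ?\<Gamma>" E k] False BE \<Gamma>(1) E Imp by auto
      qed
    next
      case (Box B)
      then have B: "B \<in> \<Phi>" using sub[OF A\<Phi>(1)] by auto
      let ?\<Delta> = "insert A (?\<Gamma> \<union> unbox G)"
      have "unbox G \<subseteq> \<Phi>" using \<Gamma>(1) closed unbox_def by fastforce
      moreover have "\<not> ded iH ?\<Delta> B"
      proof
        assume "ded iH ?\<Delta> B"
        then have "ded iH (?\<Gamma> \<union> unbox G) (Imp (Box B) B)" using Box by (simp add: H.ded_Imp)
        \<comment> \<open>Every hypothesis is boxed in \<open>\<Gamma>\<close>: those from \<open>\<Gamma>\<close> by the completeness axioms, those from the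
          boxes by definition. Then Loeb's axiom applies.\<close>
        then have "ded iH ?\<Gamma> (Box (Imp (Box B) B))"
          by (rule ded_Box) (auto simp: unbox_def intro: ded.hyp ded_CP)
        then have "ded iH ?\<Gamma> (Box B)" using ded.mp[OF ded.base[OF iH_Loeb]] by blast
        then show False using dA Box by simp
      qed
      moreover have "boxes_left ?\<Delta> < boxes_left ?\<Gamma>"
        unfolding boxes_left_def by (rule psubset_card_mono) (use finite A\<Phi> Box in auto)
      ultimately obtain G' D' where "refuted (boxes_left ?\<Delta>) G' D'" "?\<Delta> \<subseteq> set G'" "B \<in> set D'"
        using next_refuted[of ?\<Delta> B "boxes_left ?\<Delta>"] A\<Phi> B \<Gamma>(1) by blast
      then show ?thesis
        using \<open>boxes_left ?\<Delta> < boxes_left ?\<Gamma>\<close> less.prems(3) Box by (simp, meson order.strict_trans2 le_supE insert_subset)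
    qed simp_all
  qed
qed

end

theorem not_iH_refuted:
  assumes "A \<notin> iH" shows "\<exists>k G D. refuted k G D \<and> A \<in> set D"
proof -
  obtain N where N: "\<And>F. stable (N F) \<and> Imp (Box F) (Box (N F)) \<in> iH \<and> Imp (N F) F \<in> iH"
    using ex_stable_approximation by metis
  define \<Phi> where "\<Phi> = (\<Union>F \<in> subforms A. subforms F \<union> subforms (Box (N F)))"
  have stable: "stable (Box (N F))" for F using N stable.Box by blast
  interpret fragment \<Phi>
  proof
    show "finite \<Phi>" unfolding \<Phi>_def using finite_subforms by auto
    show "subforms B \<subseteq> \<Phi>" if "B \<in> \<Phi>" for B
      using that subforms_trans unfolding \<Phi>_def by blast
    fix F assume F: "Box F \<in> \<Phi> \<or> (\<exists>A B. F = Imp A B \<and> F \<in> \<Phi>)"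
    then obtain F' where F': "F' \<in> \<Phi>" "F \<in> subforms F'" by fastforce
    show "stable F \<or> (\<exists>N. stable N \<and> Box N \<in> \<Phi> \<and> Imp (Box F) (Box N) \<in> iH \<and> Imp N F \<in> iH)"
    proof (cases "F \<in> subforms A")
      case True
      then have "Box (N F) \<in> \<Phi>" unfolding \<Phi>_def using subforms_refl by blast
      then show ?thesis using N by blast
    next
      case False
      then obtain E where "F \<in> subforms (Box (N E))"
        using F' subforms_trans unfolding \<Phi>_def by blast
      then show ?thesis using stable stable_subforms by blast
    qed
  qed
  have A: "A \<in> \<Phi>" unfolding \<Phi>_def using subforms_refl by blast
  have "\<not> ded iH {} A" using assms H.ded_thm_iff by blast
  then obtain \<Gamma> where \<Gamma>: "saturated \<Gamma> A" using saturate[of "{}"] by blast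
  then have "\<Gamma> \<subseteq> \<Phi>" "A \<notin> \<Gamma>" unfolding saturated_def by (auto intro: ded.hyp)
  then obtain G D where "set G = \<Gamma>" "set D = \<Phi> - \<Gamma>"
    using finite_list[OF finite_subset[OF _ finite]] by (metis Diff_subset)
  then show ?thesis using saturated_refuted[of G A D] \<Gamma> A \<open>A \<notin> \<Gamma>\<close> by blast
qed

section \<open>Recursive functions\<close>

text \<open>
  The values of a recursive function on lists of other lengths are dictated by the way it is built. Restricting
  attention to lists of length \<open>n\<close> allows functions to be given by arbitrary terms in the arguments \<open>xs ! i\<close>.
\<close>

definition computable :: "nat \<Rightarrow> (nat list \<Rightarrow> nat) \<Rightarrow> bool" where
  "computable n f \<longleftrightarrow> (\<exists>g. recursive n g \<and> (\<forall>xs. length xs = n \<longrightarrow> g xs = f xs))"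

lemma computable_recursive: "recursive n f \<Longrightarrow> computable n f"
  unfolding computable_def by blast

lemma computable_cong:
  "computable n f \<Longrightarrow> (\<And>xs. length xs = n \<Longrightarrow> f xs = g xs) \<Longrightarrow> computable n g"
  unfolding computable_def by metis

lemma computable_comp:
  assumes "computable (length gs) f" "\<forall>g \<in> set gs. computable n g"
  shows "computable n (\<lambda>xs. f (map (\<lambda>g. g xs) gs))"
proof -
  obtain f' where f': "recursive (length gs) f'" "\<And>xs. length xs = length gs \<Longrightarrow> f' xs = f xs"
    using assms(1) unfolding computable_def by blast
  from assms(2) obtain h where
    h: "\<forall>g \<in> set gs. recursive n (h g) \<and> (\<forall>xs. length xs = n \<longrightarrow> h g xs = g xs)"
    unfolding computable_def by metis
  have "recursive n (\<lambda>xs. f' (map (\<lambda>g. g xs) (map h gs)))"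
    by (rule recursive.comp) (use f' h in auto)
  moreover have "f' (map (\<lambda>g. g xs) (map h gs)) = f (map (\<lambda>g. g xs) gs)" if "length xs = n" for xs
  proof -
    have "map (\<lambda>g. g xs) (map h gs) = map (\<lambda>g. g xs) gs"
      using h that by auto
    then show ?thesis by (metis f'(2) length_map)
  qed
  ultimately show ?thesis unfolding computable_def by blast
qed

lemma computable_proj: "i < n \<Longrightarrow> computable n (\<lambda>xs. xs ! i)"
  by (intro computable_recursive recursive.proj)

lemma computable_subst1:
  assumes "computable 1 (\<lambda>xs. h (xs ! 0))" "computable n f"
  shows "computable n (\<lambda>xs. h (f xs))"
  using computable_comp[of "[f]" "\<lambda>xs. h (xs ! 0)" n] assms by simp

lemma computable_subst2:
  assumes "computable 2 (\<lambda>xs. h (xs ! 0) (xs ! 1))" "computable n f" "computable n g"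
  shows "computable n (\<lambda>xs. h (f xs) (g xs))"
  using computable_comp[of "[f, g]" "\<lambda>xs. h (xs ! 0) (xs ! 1)" n] assms
  by (simp add: numeral_2_eq_2)

text \<open>
  Substitution for the variable in front, which is the place where recursion and minimisation bind.
\<close>

lemma computable_push:
  assumes "computable (Suc n) f" "computable n c"
  shows "computable n (\<lambda>xs. f (c xs # xs))"
proof -
  have "computable n (\<lambda>xs. f (map (\<lambda>g. g xs) (c # map (\<lambda>i xs. xs ! i) [0..<n])))"
    by (rule computable_comp) (use assms in \<open>auto intro: computable_proj\<close>)
  then show ?thesis
    by (rule computable_cong) (auto simp: comp_def intro!: arg_cong[where f = f] nth_equalityI)
qed

lemma computable_Suc: "computable n f \<Longrightarrow> computable n (\<lambda>xs. Suc (f xs))"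
  by (rule computable_subst1[of Suc]) (intro computable_recursive recursive.succ)

lemma computable_const: "computable n (\<lambda>xs. c)"
  by (induction c) (auto intro: computable_recursive recursive.zero computable_Suc)

lemma computable_prim_rec:
  assumes "computable n a" "computable (Suc (Suc n)) g" "computable n c"
  shows "computable n (\<lambda>xs. rec_nat (a xs) (\<lambda>k r. g (k # r # xs)) (c xs))"
proof -
  obtain a' where a': "recursive n a'" "\<And>xs. length xs = n \<Longrightarrow> a' xs = a xs"
    using assms(1) unfolding computable_def by blast
  obtain g' where g': "recursive (Suc (Suc n)) g'"
      "\<And>xs. length xs = Suc (Suc n) \<Longrightarrow> g' xs = g xs"
    using assms(2) unfolding computable_def by blast
  have "computable (Suc n) (\<lambda>xs. rec_nat (a' (tl xs)) (\<lambda>k r. g' (k # r # tl xs)) (hd xs))"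
    by (intro computable_recursive recursive.prim_rec a' g')
  from computable_push[OF this assms(3)]
  have "computable n (\<lambda>xs. rec_nat (a' xs) (\<lambda>k r. g' (k # r # xs)) (c xs))" by simp
  then show ?thesis
    by (rule computable_cong) (simp add: a' g')
qed

lemma computable_minimise:
  assumes "computable (Suc n) g" "\<And>xs. length xs = n \<Longrightarrow> \<exists>k. g (k # xs) = 0"
  shows "computable n (\<lambda>xs. LEAST k. g (k # xs) = 0)"
proof -
  obtain g' where g': "recursive (Suc n) g'" "\<And>xs. length xs = Suc n \<Longrightarrow> g' xs = g xs"
    using assms(1) unfolding computable_def by blast
  have "computable n (\<lambda>xs. LEAST k. g' (k # xs) = 0)"
    by (intro computable_recursive recursive.minimise) (use g' assms(2) in auto)
  then show ?thesis
    by (rule computable_cong) (simp add: g')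
qed

lemma computable_add:
  assumes "computable n f" "computable n g" shows "computable n (\<lambda>xs. f xs + g xs)"
proof (rule computable_subst2[OF _ assms, where h = "(+)"])
  have "computable 2 (\<lambda>xs. rec_nat (xs ! 1) (\<lambda>k r. (\<lambda>ys. Suc (ys ! 1)) (k # r # xs)) (xs ! 0))"
    by (intro computable_prim_rec computable_Suc computable_proj) auto
  moreover have "rec_nat b (\<lambda>k r. Suc r) a = a + b" for a b :: nat by (induction a) auto
  ultimately show "computable 2 (\<lambda>xs. xs ! 0 + xs ! 1)" by simp
qed

lemma computable_pred:
  assumes "computable n f" shows "computable n (\<lambda>xs. f xs - 1)"
proof (rule computable_subst1[OF _ assms, where h = "\<lambda>x. x - 1"])
  have "computable 1 (\<lambda>xs. rec_nat 0 (\<lambda>k r. (\<lambda>ys. ys ! 0) (k # r # xs)) (xs ! 0))"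
    by (intro computable_prim_rec computable_const computable_proj) auto
  moreover have "rec_nat 0 (\<lambda>k r. k) a = a - 1" for a :: nat by (cases a) auto
  ultimately show "computable 1 (\<lambda>xs. xs ! 0 - 1)" by simp
qed

lemma computable_diff:
  assumes "computable n f" "computable n g" shows "computable n (\<lambda>xs. f xs - g xs)"
proof (rule computable_subst2[OF _ assms, where h = "(-)"])
  have "computable 2 (\<lambda>xs. rec_nat (xs ! 0) (\<lambda>k r. (\<lambda>ys. ys ! 1 - 1) (k # r # xs)) (xs ! 1))"
    by (intro computable_prim_rec computable_pred computable_proj) auto
  moreover have "rec_nat a (\<lambda>k r. r - 1) b = a - b" for a b :: nat by (induction b) auto
  ultimately show "computable 2 (\<lambda>xs. xs ! 0 - xs ! 1)" by simp
qed

lemma computable_triangle: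
  assumes "computable n f" shows "computable n (\<lambda>xs. triangle (f xs))"
proof (rule computable_subst1[OF _ assms, where h = triangle])
  have "computable 1 (\<lambda>xs. rec_nat 0 (\<lambda>k r. (\<lambda>ys. ys ! 1 + Suc (ys ! 0)) (k # r # xs)) (xs ! 0))"
    by (intro computable_prim_rec computable_const computable_add computable_Suc computable_proj) auto
  moreover have "rec_nat 0 (\<lambda>k r. r + Suc k) a = triangle a" for a :: nat by (induction a) auto
  ultimately show "computable 1 (\<lambda>xs. triangle (xs ! 0))" by simp
qed

lemma computable_prod_encode:
  assumes "computable n f" "computable n g"
  shows "computable n (\<lambda>xs. prod_encode (f xs, g xs))"
  unfolding prod_encode_def using assms
  by (simp add: computable_add computable_triangle)

definition pfst :: "nat \<Rightarrow> nat" where "pfst z = fst (prod_decode z)"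
definition psnd :: "nat \<Rightarrow> nat" where "psnd z = snd (prod_decode z)"

lemma pfst_prod_encode [simp]: "pfst (prod_encode (a, b)) = a"
  and psnd_prod_encode [simp]: "psnd (prod_encode (a, b)) = b"
  by (simp_all add: pfst_def psnd_def)

lemma prod_encode_pfst_psnd [simp]: "prod_encode (pfst z, psnd z) = z"
  by (simp add: pfst_def psnd_def)

lemma triangle_mono: "a \<le> b \<Longrightarrow> triangle a \<le> triangle b"
  by (induction b) (auto simp: le_Suc_eq)

text \<open>
  The pairing function enumerates pairs along diagonals, and the diagonal of a code is the first one
  ending beyond it.
\<close>

lemma prod_decode_sum: "(LEAST s. Suc z - triangle (Suc s) = 0) = pfst z + psnd z"
proof (rule Least_equality)
  have z: "z = triangle (pfst z + psnd z) + pfst z"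
    using prod_encode_pfst_psnd[of z] unfolding prod_encode_def by simp
  then show "Suc z - triangle (Suc (pfst z + psnd z)) = 0" by simp
  fix s assume "Suc z - triangle (Suc s) = 0"
  then have "z < triangle (Suc s)" by simp
  then have "triangle (pfst z + psnd z) < triangle (Suc s)" using z by linarith
  then have "\<not> Suc s \<le> pfst z + psnd z" using triangle_mono leD by blast
  then show "pfst z + psnd z \<le> s" by simp
qed

lemma computable_decode_sum: "computable 1 (\<lambda>xs. pfst (xs ! 0) + psnd (xs ! 0))"
proof -
  have "computable 1 (\<lambda>xs. LEAST s. (\<lambda>ys. Suc (ys ! 1) - triangle (Suc (ys ! 0))) (s # xs) = 0)"
  proof (intro computable_minimise computable_diff computable_triangle computable_Suc computable_proj)
    fix xs :: "nat list"
    have "x \<le> triangle x" for x by (induction x) auto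
    then have "Suc (xs ! 0) - triangle (Suc (xs ! 0)) = 0"
      by (metis diff_is_0_eq)
    then show "\<exists>k. Suc ((k # xs) ! 1) - triangle (Suc ((k # xs) ! 0)) = 0"
      by (metis One_nat_def nth_Cons_0 nth_Cons_Suc)
  qed auto
  then show ?thesis
    by (rule computable_cong) (simp only: nth_Cons_0 nth_Cons_Suc One_nat_def prod_decode_sum)
qed

lemma pfst_eq: "pfst z = z - triangle (pfst z + psnd z)"
  using prod_encode_pfst_psnd[of z] unfolding prod_encode_def by simp

lemma computable_pfst:
  assumes "computable n f" shows "computable n (\<lambda>xs. pfst (f xs))"
proof (rule computable_subst1[OF _ assms, where h = pfst])
  have "computable 1 (\<lambda>xs. xs ! 0 - triangle (pfst (xs ! 0) + psnd (xs ! 0)))"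
    by (intro computable_diff computable_triangle computable_decode_sum computable_proj) auto
  then show "computable 1 (\<lambda>xs. pfst (xs ! 0))"
    by (rule computable_cong) (simp add: pfst_eq[symmetric])
qed

lemma computable_psnd:
  assumes "computable n f" shows "computable n (\<lambda>xs. psnd (f xs))"
proof (rule computable_subst1[OF _ assms, where h = psnd])
  have "computable 1 (\<lambda>xs. (pfst (xs ! 0) + psnd (xs ! 0)) - pfst (xs ! 0))"
    by (intro computable_diff computable_pfst computable_decode_sum computable_proj) auto
  then show "computable 1 (\<lambda>xs. psnd (xs ! 0))" by simp
qed

definition decidable_pred :: "nat \<Rightarrow> (nat list \<Rightarrow> bool) \<Rightarrow> bool" where
  "decidable_pred n P \<longleftrightarrow> computable n (\<lambda>xs. of_bool (P xs))"

lemma decidable_less: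
  assumes "computable n f" "computable n g" shows "decidable_pred n (\<lambda>xs. f xs < g xs)"
proof -
  have "computable n (\<lambda>xs. (1::nat) - (1 - (g xs - f xs)))"
    by (intro computable_diff computable_const assms)
  then show ?thesis
    unfolding decidable_pred_def by (rule computable_cong) auto
qed

lemma decidable_not: "decidable_pred n P \<Longrightarrow> decidable_pred n (\<lambda>xs. \<not> P xs)"
  unfolding decidable_pred_def
  by (rule computable_cong[OF computable_diff[OF computable_const[of n 1]]]) auto

lemma decidable_disj:
  assumes "decidable_pred n P" "decidable_pred n Q"
  shows "decidable_pred n (\<lambda>xs. P xs \<or> Q xs)"
proof -
  have "decidable_pred n (\<lambda>xs. 0 < of_bool (P xs) + (of_bool (Q xs) :: nat))"
    using assms by (intro decidable_less computable_const computable_add)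
      (auto simp: decidable_pred_def)
  then show ?thesis by simp
qed

lemma decidable_conj:
  assumes "decidable_pred n P" "decidable_pred n Q"
  shows "decidable_pred n (\<lambda>xs. P xs \<and> Q xs)"
  using decidable_not[OF decidable_disj[OF decidable_not[OF assms(1)] decidable_not[OF assms(2)]]]
  by simp

lemma decidable_eq:
  assumes "computable n f" "computable n g" shows "decidable_pred n (\<lambda>xs. f xs = g xs)"
proof -
  have "decidable_pred n (\<lambda>xs. \<not> (f xs < g xs \<or> g xs < f xs))"
    by (intro decidable_not decidable_disj decidable_less assms)
  then show ?thesis by (simp add: not_less_iff_gr_or_eq[symmetric] nat_neq_iff[symmetric])
qed

lemma decidable_Bex_list:
  "(\<And>c. c \<in> set cs \<Longrightarrow> decidable_pred n (P c)) \<Longrightarrow> decidable_pred n (\<lambda>xs. \<exists>c \<in> set cs. P c xs)"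
proof (induction cs)
  case Nil
  then show ?case by (simp add: decidable_pred_def computable_const)
qed (auto intro: decidable_disj)

lemma decidable_Ball_list:
  "(\<And>c. c \<in> set cs \<Longrightarrow> decidable_pred n (P c)) \<Longrightarrow> decidable_pred n (\<lambda>xs. \<forall>c \<in> set cs. P c xs)"
  using decidable_not[OF decidable_Bex_list[of cs n "\<lambda>c xs. \<not> P c xs"]] decidable_not by simp

lemma decidable_bounded_Ex:
  assumes "decidable_pred (Suc n) P" "computable n b"
  shows "decidable_pred n (\<lambda>xs. \<exists>j < b xs. P (j # xs))"
proof -
  have "computable (Suc (Suc n)) (\<lambda>xs. (\<lambda>ys. of_bool (P ys)) (map (\<lambda>g. g xs)
      ((\<lambda>xs. xs ! 0) # map (\<lambda>i xs. xs ! (i + 2)) [0..<n])))"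
    by (rule computable_comp) (use assms(1) in \<open>auto simp: decidable_pred_def intro: computable_proj\<close>)
  then have P: "computable (Suc (Suc n)) (\<lambda>xs. of_bool (P (xs ! 0 # drop 2 xs)))"
  proof (rule computable_cong)
    fix xs :: "nat list" assume "length xs = Suc (Suc n)"
    then have "map (\<lambda>i. xs ! (i + 2)) [0..<n] = drop 2 xs"
      by (auto intro!: nth_equalityI)
    then show "of_bool (P (map (\<lambda>g. g xs) ((\<lambda>xs. xs ! 0) # map (\<lambda>i xs. xs ! (i + 2)) [0..<n])))
        = of_bool (P (xs ! 0 # drop 2 xs))"
      by (simp add: comp_def)
  qed
  have "computable n (\<lambda>xs. rec_nat 0 (\<lambda>k r.
      (\<lambda>ys. of_bool (P (ys ! 0 # drop 2 ys)) + ys ! 1) (k # r # xs)) (b xs))"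
    by (intro computable_prim_rec computable_const computable_add computable_proj P assms(2)) auto
  then have "decidable_pred n (\<lambda>xs. 0 < (rec_nat 0 (\<lambda>k r. of_bool (P (k # xs)) + r) (b xs) :: nat))"
    by (intro decidable_less computable_const) simp
  moreover have "0 < (rec_nat 0 (\<lambda>k r. of_bool (P (k # xs)) + r) c :: nat)
      \<longleftrightarrow> (\<exists>j < c. P (j # xs))" for c xs
    by (induction c) (auto simp: less_Suc_eq)
  ultimately show ?thesis by simp
qed

lemma decidable_bounded_All:
  assumes "decidable_pred (Suc n) P" "computable n b"
  shows "decidable_pred n (\<lambda>xs. \<forall>j < b xs. P (j # xs))"
  using decidable_not[OF decidable_bounded_Ex[OF decidable_not[OF assms(1)] assms(2)]] by simp

text \<open>
  Post's theorem. Searching for a witness of either kind always succeeds, so the minimisation is regular.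
\<close>

lemma recursive_set_Post:
  assumes P: "decidable_pred 2 (\<lambda>xs. P (xs ! 0) (xs ! 1))"
    and Q: "decidable_pred 2 (\<lambda>xs. Q (xs ! 0) (xs ! 1))"
    and PN: "\<And>n. n \<in> N \<longleftrightarrow> (\<exists>w. P w n)" and QN: "\<And>n. n \<notin> N \<longleftrightarrow> (\<exists>w. Q w n)"
  shows "recursive_set N"
proof -
  let ?g = "\<lambda>ys. of_bool (\<not> (P (ys ! 0) (ys ! 1) \<or> Q (ys ! 0) (ys ! 1))) :: nat"
  let ?w = "\<lambda>n. LEAST w. P w n \<or> Q w n"
  have ex: "\<exists>w. P w n \<or> Q w n" for n using PN QN by blast
  have "computable 2 ?g"
    using decidable_not[OF decidable_disj[OF P Q]] by (simp add: decidable_pred_def)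
  then have "computable 1 (\<lambda>xs. LEAST w. ?g (w # xs) = 0)"
    using ex by (intro computable_minimise) (auto simp: numeral_2_eq_2)
  then have "computable 1 (\<lambda>xs. ?w (xs ! 0))" by simp
  then have "computable 1 (\<lambda>xs. of_bool (P (?w (xs ! 0)) (xs ! 0)))"
    using computable_subst2[of "\<lambda>a b. of_bool (P a b)"] P
    by (auto simp: decidable_pred_def computable_proj)
  then obtain f where f: "recursive 1 f" "\<And>n. f [n] = of_bool (P (?w n) n)"
    unfolding computable_def by auto
  have "P (?w n) n \<longleftrightarrow> n \<in> N" for n
    using LeastI_ex[OF ex[of n]] PN QN by blast
  then show ?thesis unfolding recursive_set_def using f by (auto simp: of_bool_def)
qed

text \<open>
  Logic programs over the natural numbers, with the pairing function as the only constructor. Comparison of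
  numbers is built in; all negative conditions of the program below go back to it.
\<close>

datatype pat = V nat | K nat | P pat pat

primrec inst :: "(nat \<Rightarrow> nat) \<Rightarrow> pat \<Rightarrow> nat" where
  "inst \<rho> (V i) = \<rho> i"
| "inst \<rho> (K c) = c"
| "inst \<rho> (P p q) = prod_encode (inst \<rho> p, inst \<rho> q)"

datatype goal = Call pat | Less pat pat

type_synonym clause = "pat \<times> goal list"

primrec holds :: "(nat \<Rightarrow> bool) \<Rightarrow> (nat \<Rightarrow> nat) \<Rightarrow> goal \<Rightarrow> bool" where
  "holds D \<rho> (Call p) = D (inst \<rho> p)"
| "holds D \<rho> (Less p q) = (inst \<rho> p < inst \<rho> q)"

lemma holds_mono [mono]: "D \<le> D' \<Longrightarrow> holds D \<rho> g \<longrightarrow> holds D' \<rho> g"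
  by (cases g) auto

inductive derivable :: "clause list \<Rightarrow> nat \<Rightarrow> bool" for cs where
  clause: "(h, gs) \<in> set cs \<Longrightarrow> \<forall>g \<in> set gs. holds (derivable cs) \<rho> g \<Longrightarrow> derivable cs (inst \<rho> h)"

text \<open>
  Sequences of numbers are coded as iterated pairs without a marker for their end, so that every number codes an infinite
  sequence.
\<close>

definition entry :: "nat \<Rightarrow> nat \<Rightarrow> nat" where
  "entry i k = pfst ((psnd ^^ i) k)"

lemma ex_entries: "\<exists>k. \<forall>i < length xs. entry i k = xs ! i"
proof (induction xs)
  case (Cons x xs)
  then obtain k where k: "\<forall>i < length xs. entry i k = xs ! i" by blast
  have "entry i (prod_encode (x, k)) = (x # xs) ! i" if "i < length (x # xs)" for i
    using k that by (cases i) (auto simp: entry_def funpow_Suc_right simp del: funpow.simps(2))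
  then show ?case by blast
qed simp

lemma computable_entry:
  assumes "computable n f" "computable n g" shows "computable n (\<lambda>xs. entry (f xs) (g xs))"
proof (rule computable_subst2[OF _ assms, where h = entry])
  have "computable 2 (\<lambda>xs. pfst (rec_nat (xs ! 1) (\<lambda>k r. (\<lambda>ys. psnd (ys ! 1)) (k # r # xs)) (xs ! 0)))"
    by (intro computable_pfst computable_prim_rec computable_psnd computable_proj) auto
  moreover have "rec_nat k (\<lambda>_ r. psnd r) i = (psnd ^^ i) k" for i k by (induction i) auto
  ultimately show "computable 2 (\<lambda>xs. entry (xs ! 0) (xs ! 1))" by (simp add: entry_def)
qed

lemma computable_inst:
  assumes "computable n f" shows "computable n (\<lambda>xs. inst (\<lambda>i. entry i (f xs)) p)"
  by (induction p) (auto intro: computable_const computable_entry computable_prod_encode assms)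

text \<open>
  An entry of a derivation pairs the derived number with (a code of) the assignment used.
\<close>

definition step_ok :: "clause list \<Rightarrow> nat \<Rightarrow> nat \<Rightarrow> bool" where
  "step_ok cs i k \<longleftrightarrow> (\<exists>c \<in> set cs.
     pfst (entry i k) = inst (\<lambda>l. entry l (psnd (entry i k))) (fst c) \<and>
     (\<forall>g \<in> set (snd c). holds (\<lambda>m. \<exists>j < i. pfst (entry j k) = m) (\<lambda>l. entry l (psnd (entry i k))) g))"

text \<open>
  The witness \<open>w\<close> consists of a length and a sequence of entries.
\<close>

definition derivation :: "clause list \<Rightarrow> nat \<Rightarrow> nat \<Rightarrow> bool" where
  "derivation cs w n \<longleftrightarrow> (\<forall>i < pfst w. step_ok cs i (psnd w))
     \<and> (\<exists>i < pfst w. pfst (entry i (psnd w)) = n)"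

lemma decidable_step_ok: "decidable_pred 2 (\<lambda>xs. step_ok cs (xs ! 0) (xs ! 1))"
  unfolding step_ok_def
proof (intro decidable_Bex_list decidable_conj decidable_Ball_list decidable_eq)
  fix c g assume "c \<in> set cs" "g \<in> set (snd c)"
  let ?\<rho> = "\<lambda>xs l. entry l (psnd (entry (xs ! 0) (xs ! 1)))"
  have inst: "computable (Suc (Suc n)) (\<lambda>xs. inst (?\<rho> xs) p)" for p n
    by (intro computable_inst computable_psnd computable_entry computable_proj) auto
  show "decidable_pred 2 (\<lambda>xs. holds (\<lambda>m. \<exists>j < xs ! 0. pfst (entry j (xs ! 1)) = m) (?\<rho> xs) g)"
  proof (cases g)
    case (Call p)
    have "computable 3 (\<lambda>xs. inst (\<lambda>l. entry l (psnd (entry (xs ! 1) (xs ! 2)))) p)"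
      by (intro computable_inst computable_psnd computable_entry computable_proj) auto
    then have "decidable_pred 3 (\<lambda>xs. pfst (entry (xs ! 0) (xs ! 2))
        = inst (\<lambda>l. entry l (psnd (entry (xs ! 1) (xs ! 2)))) p)"
      by (intro decidable_eq computable_pfst computable_entry computable_proj) auto
    from decidable_bounded_Ex[of 2, OF this[unfolded numeral_3_eq_3 numeral_2_eq_2[symmetric]]
        computable_proj[of 0]] Call
    show ?thesis by (simp add: numeral_2_eq_2)
  next
    case (Less p q)
    then show ?thesis using inst[of 0] by (simp add: decidable_less numeral_2_eq_2)
  qed
qed (intro computable_inst computable_psnd computable_pfst computable_entry computable_proj; simp)+

lemma decidable_derivation: "decidable_pred 2 (\<lambda>xs. derivation cs (xs ! 0) (xs ! 1))"
  unfolding derivation_def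
proof (intro decidable_conj)
  have "decidable_pred 3 (\<lambda>xs. step_ok cs (xs ! 0) (psnd (xs ! 1)))"
    unfolding decidable_pred_def
    by (rule computable_subst2[of "\<lambda>a b. of_bool (step_ok cs a b)"])
      (use decidable_step_ok[of cs] in \<open>auto simp: decidable_pred_def intro!: computable_psnd computable_proj\<close>)
  from decidable_bounded_All[of 2, OF this[unfolded numeral_3_eq_3 numeral_2_eq_2[symmetric]]
      computable_pfst[OF computable_proj[of 0]]]
  show "decidable_pred 2 (\<lambda>xs. \<forall>i < pfst (xs ! 0). step_ok cs i (psnd (xs ! 0)))" by simp
  have "decidable_pred 3 (\<lambda>xs. pfst (entry (xs ! 0) (psnd (xs ! 1))) = xs ! 2)"
    by (intro decidable_eq computable_pfst computable_entry computable_psnd computable_proj) auto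
  from decidable_bounded_Ex[of 2, OF this[unfolded numeral_3_eq_3 numeral_2_eq_2[symmetric]]
      computable_pfst[OF computable_proj[of 0]]]
  show "decidable_pred 2 (\<lambda>xs. \<exists>i < pfst (xs ! 0). pfst (entry i (psnd (xs ! 0))) = xs ! 1)"
    by (simp add: numeral_2_eq_2)
qed


lemma derivation_sound:
  assumes "\<forall>i < m. step_ok cs i k" shows "i < m \<Longrightarrow> derivable cs (pfst (entry i k))"
proof (induction i rule: less_induct)
  case (less i)
  then obtain c where c: "c \<in> set cs"
      "pfst (entry i k) = inst (\<lambda>l. entry l (psnd (entry i k))) (fst c)"
      "\<forall>g \<in> set (snd c). holds (\<lambda>m. \<exists>j < i. pfst (entry j k) = m) (\<lambda>l. entry l (psnd (entry i k))) g"
    using assms unfolding step_ok_def by blast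
  have "holds (\<lambda>m. \<exists>j < i. pfst (entry j k) = m) \<rho> g \<longrightarrow> holds (derivable cs) \<rho> g" for \<rho> g
    by (rule holds_mono) (use less in auto)
  then show ?case
    using c derivable.clause[of "fst c" "snd c" cs] by (metis prod.collapse)
qed

text \<open>
  Only finitely many variables of an assignment matter for a program, so assignments can be coded by numbers.
\<close>

primrec pat_bound :: "pat \<Rightarrow> nat" where
  "pat_bound (V i) = Suc i"
| "pat_bound (K c) = 0"
| "pat_bound (P p q) = max (pat_bound p) (pat_bound q)"

lemma inst_cong: "(\<And>i. i < pat_bound p \<Longrightarrow> \<rho> i = \<rho>' i) \<Longrightarrow> inst \<rho> p = inst \<rho>' p"
  by (induction p) auto

primrec goal_bound :: "goal \<Rightarrow> nat" where
  "goal_bound (Call p) = pat_bound p"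
| "goal_bound (Less p q) = max (pat_bound p) (pat_bound q)"

lemma holds_cong: "(\<And>i. i < goal_bound g \<Longrightarrow> \<rho> i = \<rho>' i) \<Longrightarrow> holds D \<rho> g = holds D \<rho>' g"
  by (cases g) (auto simp: inst_cong[of _ \<rho> \<rho>'])

text \<open>
  A version of derivations with uncoded entries, which are easier to concatenate.
\<close>

definition justified :: "clause list \<Rightarrow> nat set \<Rightarrow> nat \<Rightarrow> (nat \<Rightarrow> nat) \<Rightarrow> bool" where
  "justified cs D n \<rho> \<longleftrightarrow> (\<exists>c \<in> set cs. n = inst \<rho> (fst c) \<and> (\<forall>g \<in> set (snd c). holds (\<lambda>m. m \<in> D) \<rho> g))"

inductive proof_list :: "clause list \<Rightarrow> (nat \<times> (nat \<Rightarrow> nat)) list \<Rightarrow> bool" for cs where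
  Nil: "proof_list cs []"
| snoc: "proof_list cs ps \<Longrightarrow> justified cs (fst ` set ps) n \<rho> \<Longrightarrow> proof_list cs (ps @ [(n, \<rho>)])"

lemma justified_mono: "justified cs D n \<rho> \<Longrightarrow> D \<subseteq> D' \<Longrightarrow> justified cs D' n \<rho>"
  unfolding justified_def using holds_mono[of "\<lambda>m. m \<in> D" "\<lambda>m. m \<in> D'"] by blast

lemma proof_list_append:
  assumes "proof_list cs ps" "proof_list cs qs" shows "proof_list cs (ps @ qs)"
  using assms(2)
proof (induction qs)
  case (snoc qs n \<rho>)
  have "justified cs (fst ` set (ps @ qs)) n \<rho>"
    by (rule justified_mono[OF snoc.hyps(2)]) auto
  with snoc.IH show ?case using proof_list.snoc by fastforce
qed (use assms(1) in simp)

lemma proof_list_goals: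
  assumes "\<forall>g \<in> set gs. holds (\<lambda>n. derivable cs n \<and> (\<exists>ps. proof_list cs ps \<and> n \<in> fst ` set ps)) \<rho> g"
  shows "\<exists>ps. proof_list cs ps \<and> (\<forall>g \<in> set gs. holds (\<lambda>m. m \<in> fst ` set ps) \<rho> g)"
  using assms
proof (induction gs)
  case Nil
  then show ?case using proof_list.Nil by auto
next
  case (Cons g gs)
  then obtain ps where ps: "proof_list cs ps" "\<forall>g \<in> set gs. holds (\<lambda>m. m \<in> fst ` set ps) \<rho> g"
    by auto
  obtain qs where qs: "proof_list cs qs" "holds (\<lambda>m. m \<in> fst ` set qs) \<rho> g"
    using Cons.prems proof_list.Nil by (cases g) fastforce+
  have "holds (\<lambda>m. m \<in> fst ` set ps) \<rho> g' \<longrightarrow> holds (\<lambda>m. m \<in> fst ` set (ps @ qs)) \<rho> g'"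
    "holds (\<lambda>m. m \<in> fst ` set qs) \<rho> g' \<longrightarrow> holds (\<lambda>m. m \<in> fst ` set (ps @ qs)) \<rho> g'" for g'
    by (rule holds_mono; auto)+
  then show ?case using ps qs proof_list_append[OF ps(1) qs(1)]
    by (metis set_ConsD)
qed

lemma derivable_proof_list: "derivable cs n \<Longrightarrow> \<exists>ps. proof_list cs ps \<and> n \<in> fst ` set ps"
proof (induction rule: derivable.induct)
  case (clause h gs \<rho>)
  then obtain ps where ps: "proof_list cs ps" "\<forall>g \<in> set gs. holds (\<lambda>m. m \<in> fst ` set ps) \<rho> g"
    using proof_list_goals[of gs cs \<rho>] by blast
  then have "justified cs (fst ` set ps) (inst \<rho> h) \<rho>"
    unfolding justified_def using clause(1) by force
  from proof_list.snoc[OF ps(1) this] show ?case by force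
qed

lemma proof_list_justified:
  "proof_list cs ps \<Longrightarrow> i < length ps \<Longrightarrow>
    justified cs (fst ` set (take i ps)) (fst (ps ! i)) (snd (ps ! i))"
proof (induction rule: proof_list.induct)
  case (snoc ps n \<rho>)
  then show ?case by (cases "i < length ps") (auto simp: nth_append less_Suc_eq)
qed simp

lemma proof_list_derivation:
  assumes ps: "proof_list cs ps" and n: "n \<in> fst ` set ps"
  shows "\<exists>w. derivation cs w n"
proof -
  define N where "N = Max (insert 0 (\<Union>c \<in> set cs. insert (pat_bound (fst c)) (goal_bound ` set (snd c))))"
  have N: "pat_bound (fst c) \<le> N" "g \<in> set (snd c) \<Longrightarrow> goal_bound g \<le> N" if "c \<in> set cs" for c g
    unfolding N_def using that by (auto intro!: Max_ge)
  have "\<exists>r. \<forall>l < N. entry l r = \<rho> l" for \<rho>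
    using ex_entries[of "map \<rho> [0..<N]"] by auto
  then obtain code where code: "\<And>\<rho> l. l < N \<Longrightarrow> entry l (code \<rho>) = \<rho> l" by metis
  obtain k where k: "\<And>i. i < length ps \<Longrightarrow> entry i k = prod_encode (fst (ps ! i), code (snd (ps ! i)))"
    using ex_entries[of "map (\<lambda>(n, \<rho>). prod_encode (n, code \<rho>)) ps"] by (auto simp: case_prod_beta)
  have "step_ok cs i k" if i: "i < length ps" for i
  proof -
    let ?\<rho> = "snd (ps ! i)" and ?\<rho>' = "\<lambda>l. entry l (code (snd (ps ! i)))"
    obtain c where c: "c \<in> set cs" "fst (ps ! i) = inst ?\<rho> (fst c)"
        "\<forall>g \<in> set (snd c). holds (\<lambda>m. m \<in> fst ` set (take i ps)) ?\<rho> g"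
      using proof_list_justified[OF ps i] unfolding justified_def by blast
    have "inst ?\<rho>' (fst c) = inst ?\<rho> (fst c)"
      by (rule inst_cong) (use N(1)[OF c(1)] code in auto)
    moreover have "holds (\<lambda>m. \<exists>j < i. pfst (entry j k) = m) ?\<rho>' g" if "g \<in> set (snd c)" for g
    proof -
      have "holds (\<lambda>m. m \<in> fst ` set (take i ps)) ?\<rho> g" using c(3) that by blast
      then have "holds (\<lambda>m. m \<in> fst ` set (take i ps)) ?\<rho>' g"
        using holds_cong[of g ?\<rho>' ?\<rho>] N(2)[OF c(1) that] code by auto
      moreover have "(\<lambda>m. m \<in> fst ` set (take i ps)) \<le> (\<lambda>m. \<exists>j < i. pfst (entry j k) = m)"
        using i k by (force simp: in_set_conv_nth)
      ultimately show ?thesis using holds_mono by blast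
    qed
    ultimately show ?thesis
      unfolding step_ok_def using c(1,2) k[OF i] by (intro bexI[of _ c]) auto
  qed
  moreover have "\<exists>i < length ps. pfst (entry i k) = n"
    using n k by (force simp: in_set_conv_nth)
  ultimately have "derivation cs (prod_encode (length ps, k)) n"
    unfolding derivation_def by simp
  then show ?thesis by blast
qed

lemma derivable_iff_derivation: "derivable cs n \<longleftrightarrow> (\<exists>w. derivation cs w n)"
  using derivable_proof_list proof_list_derivation derivation_sound
  unfolding derivation_def by metis

theorem recursive_set_of_program:
  assumes "\<And>n. n \<in> N \<longleftrightarrow> derivable cs (prod_encode (a, n))"
    and "\<And>n. n \<notin> N \<longleftrightarrow> derivable cs (prod_encode (b, n))"
  shows "recursive_set N"
proof -
  have "decidable_pred 2 (\<lambda>xs. derivation cs (xs ! 0) (prod_encode (c, xs ! 1)))" for c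
    unfolding decidable_pred_def
    by (rule computable_subst2[of "\<lambda>a b. of_bool (derivation cs a b)"])
      (use decidable_derivation[of cs] in \<open>auto simp: decidable_pred_def
        intro!: computable_prod_encode computable_const computable_proj\<close>)
  from recursive_set_Post[OF this this] assms show ?thesis
    unfolding derivable_iff_derivation by blast
qed

section \<open>A logic program for theorems and non-theorems\<close>

lemma psnd_le: "psnd n \<le> n"
  by (metis le_prod_encode_2 prod_encode_pfst_psnd)

lemma pfst_le: "pfst n \<le> n"
  by (metis le_prod_encode_1 prod_encode_pfst_psnd)

lemma psnd_less: "pfst n \<noteq> 0 \<Longrightarrow> psnd n < n"
proof -
  assume pos: "pfst n \<noteq> 0"
  have "n = triangle (pfst n + psnd n) + pfst n"
    using prod_encode_pfst_psnd[of n] unfolding prod_encode_def by simp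
  moreover have "x \<le> triangle x" for x by (induction x) auto
  then have "pfst n + psnd n \<le> triangle (pfst n + psnd n)" .
  ultimately show ?thesis using pos by linarith
qed

text \<open>
  A total decoding function. Program variables range over all numbers, so junk must have a meaning as well; that
  decoding commutes with the constructors is all that soundness of the program needs. The distinction between
  codes and junk is only made at the very end, by the clauses for \<open>aForm\<close> and \<open>aNonform\<close>.
\<close>

function decode :: "nat \<Rightarrow> form" where
  "decode n = (if pfst n = 0 then Var (psnd n)
    else if pfst n = 1 then Bot
    else if pfst n = 2 then Top
    else if pfst n = 3 then And (decode (pfst (psnd n))) (decode (psnd (psnd n)))
    else if pfst n = 4 then Or (decode (pfst (psnd n))) (decode (psnd (psnd n)))
    else if pfst n = 5 then Imp (decode (pfst (psnd n))) (decode (psnd (psnd n)))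
    else if pfst n = 6 then Box (decode (psnd n))
    else Bot)"
  by auto
termination
  by (relation "measure id")
    (auto intro: le_less_trans[OF pfst_le psnd_less] le_less_trans[OF psnd_le psnd_less] psnd_less)

declare decode.simps [simp del]

lemma decode_simps [simp]:
  "decode (prod_encode (0, n)) = Var n"
  "decode (prod_encode (Suc 0, n)) = Bot"
  "decode (prod_encode (2, n)) = Top"
  "decode (prod_encode (3, prod_encode (a, b))) = And (decode a) (decode b)"
  "decode (prod_encode (4, prod_encode (a, b))) = Or (decode a) (decode b)"
  "decode (prod_encode (5, prod_encode (a, b))) = Imp (decode a) (decode b)"
  "decode (prod_encode (6, a)) = Box (decode a)"
  by (subst decode.simps; simp)+

lemma decode_goedel [simp]: "decode (goedel A) = A"
  by (induction A) auto

function decode_list :: "nat \<Rightarrow> form list" where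
  "decode_list n = (if pfst n = 0 then [] else decode (pfst (psnd n)) # decode_list (psnd (psnd n)))"
  by auto
termination
  by (relation "measure id") (auto intro: le_less_trans[OF psnd_le psnd_less])

declare decode_list.simps [simp del]

lemma decode_list_simps [simp]:
  "decode_list 0 = []"
  "decode_list (prod_encode (Suc 0, prod_encode (a, l))) = decode a # decode_list l"
proof -
  have "pfst 0 = 0" using pfst_le[of 0] by simp
  then show "decode_list 0 = []" by (subst decode_list.simps) simp
qed (subst decode_list.simps; simp)

primrec encode_list :: "form list \<Rightarrow> nat" where
  "encode_list [] = 0"
| "encode_list (A # As) = prod_encode (Suc 0, prod_encode (goedel A, encode_list As))"

lemma decode_encode_list [simp]: "decode_list (encode_list As) = As"
  by (induction As) auto

text \<open>
  Fixes one enumeration of the disjuncts in B2; the others are equivalent by A1 and A2.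
\<close>

primrec antecedent :: "form \<Rightarrow> form" where
  "antecedent (Imp A B) = A"
| "antecedent (Var n) = Var n" | "antecedent Bot = Bot" | "antecedent Top = Top"
| "antecedent (And A B) = And A B" | "antecedent (Or A B) = Or A B" | "antecedent (Box A) = Box A"

lemma Disj_Cons: "As \<noteq> [] \<Longrightarrow> Disj (A # As) = Or A (Disj As)"
  by (cases As) auto

text \<open>
  Program variables, followed by patterns for formulas and lists of formulas, and by atoms with a numerical
  tag for each predicate of the program. Lists are coded like formulas, with 0 for the empty list.
\<close>

abbreviation "x0 \<equiv> V 0" abbreviation "x1 \<equiv> V 1" abbreviation "x2 \<equiv> V 2" abbreviation "x3 \<equiv> V 3"
abbreviation "x4 \<equiv> V 4" abbreviation "x5 \<equiv> V 5" abbreviation "x6 \<equiv> V 6" abbreviation "x7 \<equiv> V 7"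

abbreviation "pVar a \<equiv> P (K 0) a"
abbreviation "pBot \<equiv> P (K 1) (K 0)"
abbreviation "pTop \<equiv> P (K 2) (K 0)"
abbreviation "pAnd a b \<equiv> P (K 3) (P a b)"
abbreviation "pOr a b \<equiv> P (K 4) (P a b)"
abbreviation "pImp a b \<equiv> P (K 5) (P a b)"
abbreviation "pBox a \<equiv> P (K 6) a"
abbreviation "pNil \<equiv> K 0"
abbreviation "pCons a l \<equiv> P (K 1) (P a l)"

abbreviation "aIPC a \<equiv> P (K 0) a"
abbreviation "aK4 a \<equiv> P (K 1) a"
abbreviation "aBracket b e f \<equiv> P (K 2) (P b (P e f))"
abbreviation "aConj l b \<equiv> P (K 3) (P l b)"
abbreviation "aDisj b l c d \<equiv> P (K 4) (P b (P l (P c d)))"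
abbreviation "aBt a b \<equiv> P (K 5) (P a b)"
abbreviation "aH a \<equiv> P (K 6) a"
abbreviation "aStable a \<equiv> P (K 7) a"
abbreviation "aMem a l \<equiv> P (K 8) (P a l)"
abbreviation "aSubset l m \<equiv> P (K 9) (P l m)"
abbreviation "aUnbox l m \<equiv> P (K 10) (P l m)"
abbreviation "aSecured g a \<equiv> P (K 11) (P g a)"
abbreviation "aNeq m n \<equiv> P (K 12) (P m n)"
abbreviation "aNoVar n l \<equiv> P (K 13) (P n l)"
abbreviation "aLeft l g d \<equiv> P (K 14) (P l (P g d))"
abbreviation "aRight l k g d \<equiv> P (K 15) (P l (P k (P g d)))"
abbreviation "aRefuted k g d \<equiv> P (K 16) (P k (P g d))"
abbreviation "aForm n \<equiv> P (K 17) n"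
abbreviation "aNonform n \<equiv> P (K 18) n"
abbreviation "aYes n \<equiv> P (K 19) n"
abbreviation "aNo n \<equiv> P (K 20) n"

definition IPC_clauses :: "clause list" where
  "IPC_clauses = [
    (aIPC (pImp x0 (pImp x1 x0)), []),
    (aIPC (pImp (pImp x0 (pImp x1 x2)) (pImp (pImp x0 x1) (pImp x0 x2))), []),
    (aIPC (pImp x0 (pImp x1 (pAnd x0 x1))), []),
    (aIPC (pImp (pAnd x0 x1) x0), []),
    (aIPC (pImp (pAnd x0 x1) x1), []),
    (aIPC (pImp x0 (pOr x0 x1)), []),
    (aIPC (pImp x1 (pOr x0 x1)), []),
    (aIPC (pImp (pImp x0 x2) (pImp (pImp x1 x2) (pImp (pOr x0 x1) x2))), []),
    (aIPC (pImp pBot x0), []),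
    (aIPC pTop, []),
    (aIPC x1, [Call (aIPC (pImp x0 x1)), Call (aIPC x0)])]"

definition K4_clauses :: "clause list" where
  "K4_clauses = [
    (aK4 x0, [Call (aIPC x0)]),
    (aK4 (pImp (pBox (pImp x0 x1)) (pImp (pBox x0) (pBox x1))), []),
    (aK4 (pImp (pBox x0) (pBox (pBox x0))), []),
    (aK4 x1, [Call (aK4 (pImp x0 x1)), Call (aK4 x0)]),
    (aK4 (pBox x0), [Call (aK4 x0)])]"

definition bracket_clauses :: "clause list" where
  "bracket_clauses = [
    (aBracket x0 (pVar x1) (pVar x1), []),
    (aBracket x0 pBot pBot, []),
    (aBracket x0 pTop pTop, []),
    (aBracket x0 (pAnd x1 x2) (pAnd x3 x4), [Call (aBracket x0 x1 x3), Call (aBracket x0 x2 x4)]),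
    (aBracket x0 (pOr x1 x2) (pOr x3 x4), [Call (aBracket x0 x1 x3), Call (aBracket x0 x2 x4)]),
    (aBracket x0 (pImp x1 x2) (pImp x0 (pImp x1 x2)), []),
    (aBracket x0 (pBox x1) (pBox x1), []),
    (aConj pNil pTop, []),
    (aConj (pCons (pImp x0 x1) pNil) (pImp x0 x1), []),
    (aConj (pCons (pImp x0 x1) (pCons x2 x3)) (pAnd (pImp x0 x1) x4), [Call (aConj (pCons x2 x3) x4)]),
    (aDisj x0 pNil x1 x2, [Call (aBracket x0 x1 x2)]),
    (aDisj x0 (pCons (pImp x1 x2) x3) x4 (pOr x5 x6),
      [Call (aBracket x0 x1 x5), Call (aDisj x0 x3 x4 x6)])]"

definition bt_clauses :: "clause list" where
  "bt_clauses = [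
    (aBt x0 x1, [Call (aK4 (pImp x0 x1))]),
    (aBt x0 x2, [Call (aBt x0 x1), Call (aBt x1 x2)]),
    (aBt x2 (pAnd x0 x1), [Call (aBt x2 x0), Call (aBt x2 x1)]),
    (aBt (pBox x0) (pBox x1), [Call (aBt x0 x1)]),
    (aBt (pOr x0 x1) x2, [Call (aBt x0 x2), Call (aBt x1 x2)]),
    (aBt (pAnd (pImp x0 x1) (pBox x0)) x2, [Call (aConj x3 x0), Call (aDisj x0 x3 x1 x2)]),
    (aBt (pImp (pVar x2) x0) (pImp (pVar x2) x1), [Call (aBt x0 x1)]),
    (aBt (pImp (pBox x2) x0) (pImp (pBox x2) x1), [Call (aBt x0 x1)])]"

definition iH_clauses :: "clause list" where
  "iH_clauses = [
    (aH x0, [Call (aK4 x0)]),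
    (aH (pImp (pBox (pImp (pBox x0) x0)) (pBox x0)), []),
    (aH (pImp x0 (pBox x0)), []),
    (aH (pImp (pBox x0) (pBox x1)), [Call (aBt x0 x1)]),
    (aH x1, [Call (aH (pImp x0 x1)), Call (aH x0)])]"

definition stable_clauses :: "clause list" where
  "stable_clauses = [
    (aStable (pVar x0), []), (aStable pBot, []), (aStable pTop, []),
    (aStable (pAnd x0 x1), [Call (aStable x0), Call (aStable x1)]),
    (aStable (pOr x0 x1), [Call (aStable x0), Call (aStable x1)]),
    (aStable (pBox x0), [Call (aStable x0)]),
    (aStable (pImp (pVar x1) x0), [Call (aStable x0)]),
    (aStable (pImp (pBox x1) x0), [Call (aStable x1), Call (aStable x0)])]"

definition list_clauses :: "clause list" where
  "list_clauses = [
    (aMem x0 (pCons x0 x1), []),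
    (aMem x0 (pCons x2 x1), [Call (aMem x0 x1)]),
    (aSubset pNil x0, []),
    (aSubset (pCons x0 x1) x2, [Call (aMem x0 x2), Call (aSubset x1 x2)]),
    (aUnbox pNil x0, []),
    (aUnbox (pCons (pVar x0) x1) x2, [Call (aUnbox x1 x2)]),
    (aUnbox (pCons pBot x1) x2, [Call (aUnbox x1 x2)]),
    (aUnbox (pCons pTop x1) x2, [Call (aUnbox x1 x2)]),
    (aUnbox (pCons (pAnd x0 x3) x1) x2, [Call (aUnbox x1 x2)]),
    (aUnbox (pCons (pOr x0 x3) x1) x2, [Call (aUnbox x1 x2)]),
    (aUnbox (pCons (pImp x0 x3) x1) x2, [Call (aUnbox x1 x2)]),
    (aUnbox (pCons (pBox x0) x1) x2, [Call (aMem x0 x2), Call (aUnbox x1 x2)]),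
    (aSecured x0 x1, [Call (aStable x1)]),
    (aSecured x0 x1, [Call (aStable x2), Call (aMem (pBox x2) x0), Call (aH (pImp x2 x1))]),
    (aNeq x0 x1, [Less x0 x1]),
    (aNeq x0 x1, [Less x1 x0]),
    (aNoVar x0 pNil, []),
    (aNoVar x0 (pCons (pVar x2) x1), [Call (aNeq x0 x2), Call (aNoVar x0 x1)]),
    (aNoVar x0 (pCons pBot x1), [Call (aNoVar x0 x1)]),
    (aNoVar x0 (pCons pTop x1), [Call (aNoVar x0 x1)]),
    (aNoVar x0 (pCons (pAnd x2 x3) x1), [Call (aNoVar x0 x1)]),
    (aNoVar x0 (pCons (pOr x2 x3) x1), [Call (aNoVar x0 x1)]),
    (aNoVar x0 (pCons (pImp x2 x3) x1), [Call (aNoVar x0 x1)]),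
    (aNoVar x0 (pCons (pBox x2) x1), [Call (aNoVar x0 x1)])]"

text \<open>
  The predicates for left-hand and right-hand sides walk through a list; the first entry of each line is the
  pattern of its head, and the rest are the conditions imposed on the head.
\<close>

definition left_clauses :: "clause list" where
  "left_clauses = map (\<lambda>(a, gs). (aLeft (pCons a x2) x3 x4, Call (aLeft x2 x3 x4) # gs)) [
    (pVar x0, [Call (aNoVar x0 x4)]),
    (pTop, []),
    (pAnd x0 x1, [Call (aMem x0 x3), Call (aMem x1 x3)]),
    (pOr x0 x1, [Call (aMem x0 x3)]),
    (pOr x0 x1, [Call (aMem x1 x3)]),
    (pImp x0 x1, [Call (aMem x0 x4), Call (aSecured x3 (pImp x0 x1))]),
    (pImp x0 x1, [Call (aMem x1 x3), Call (aSecured x3 (pImp x0 x1))]),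
    (pBox x0, [Call (aSecured x3 x0)])]
  @ [(aLeft pNil x0 x1, [])]"

definition right_clauses :: "clause list" where
  "right_clauses = map (\<lambda>(a, gs). (aRight (pCons a x2) x5 x3 x4, Call (aRight x2 x5 x3 x4) # gs)) [
    (pVar x0, []),
    (pBot, []),
    (pAnd x0 x1, [Call (aMem x0 x4)]),
    (pAnd x0 x1, [Call (aMem x1 x4)]),
    (pOr x0 x1, [Call (aMem x0 x4), Call (aMem x1 x4)]),
    (pImp x0 x1, [Call (aMem x0 x3), Call (aMem x1 x4)]),
    (pImp x0 x1, [Call (aRefuted x5 x6 x7), Call (aSubset x3 x6), Call (aMem x0 x6), Call (aMem x1 x7)]),
    (pBox x0, [Less x1 x5, Call (aRefuted x1 x6 x7), Call (aSubset x3 x6), Call (aUnbox x3 x6),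
      Call (aMem x0 x7)])]
  @ [(aRight pNil x0 x1 x2, []),
     (aRefuted x0 x1 x2, [Call (aLeft x1 x1 x2), Call (aRight x2 x0 x1 x2)])]"

text \<open>
  The clauses for \<open>aNonform\<close> are the ways in which a number can fail to be the code of a formula: an unused tag, a
  non-zero argument of a constant, or a bad component.
\<close>

definition form_clauses :: "clause list" where
  "form_clauses = [
    (aForm (pVar x0), []), (aForm pBot, []), (aForm pTop, []),
    (aForm (pAnd x0 x1), [Call (aForm x0), Call (aForm x1)]),
    (aForm (pOr x0 x1), [Call (aForm x0), Call (aForm x1)]),
    (aForm (pImp x0 x1), [Call (aForm x0), Call (aForm x1)]),
    (aForm (pBox x0), [Call (aForm x0)]),
    (aNonform (P (K 1) x0), [Less (K 0) x0]),
    (aNonform (P (K 2) x0), [Less (K 0) x0]),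
    (aNonform (pAnd x0 x1), [Call (aNonform x0)]), (aNonform (pAnd x0 x1), [Call (aNonform x1)]),
    (aNonform (pOr x0 x1), [Call (aNonform x0)]), (aNonform (pOr x0 x1), [Call (aNonform x1)]),
    (aNonform (pImp x0 x1), [Call (aNonform x0)]), (aNonform (pImp x0 x1), [Call (aNonform x1)]),
    (aNonform (pBox x0), [Call (aNonform x0)]),
    (aNonform (P x0 x1), [Less (K 6) x0]),
    (aYes x0, [Call (aForm x0), Call (aH x0)]),
    (aNo x0, [Call (aNonform x0)]),
    (aNo x0, [Call (aRefuted x1 x2 x3), Call (aMem x0 x3)])]"

definition program :: "clause list" where
  "program = IPC_clauses @ K4_clauses @ bracket_clauses @ bt_clauses @ iH_clauses @ stable_clauses
    @ list_clauses @ left_clauses @ right_clauses @ form_clauses"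

definition meaning :: "nat \<Rightarrow> bool" where
  "meaning n = (let t = pfst n; m = psnd n; a = pfst m; b = psnd m in
    (t = 0 \<longrightarrow> decode m \<in> IPC) \<and>
    (t = 1 \<longrightarrow> decode m \<in> iK4) \<and>
    (t = 2 \<longrightarrow> bracket (decode a) (decode (pfst b)) = decode (psnd b)) \<and>
    (t = 3 \<longrightarrow> Conj (decode_list a) = decode b \<and> (\<forall>D \<in> set (decode_list a). \<exists>E F. D = Imp E F)) \<and>
    (t = 4 \<longrightarrow> Disj (map (bracket (decode a)) (map antecedent (decode_list (pfst b)) @ [decode (pfst (psnd b))]))
      = decode (psnd (psnd b))) \<and>
    (t = 5 \<longrightarrow> decode a \<triangleright> decode b) \<and>
    (t = 6 \<longrightarrow> decode m \<in> iH) \<and>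
    (t = 7 \<longrightarrow> stable (decode m)) \<and>
    (t = 8 \<longrightarrow> decode a \<in> set (decode_list b)) \<and>
    (t = 9 \<longrightarrow> set (decode_list a) \<subseteq> set (decode_list b)) \<and>
    (t = 10 \<longrightarrow> unbox (decode_list a) \<subseteq> set (decode_list b)) \<and>
    (t = 11 \<longrightarrow> secured (decode_list a) (decode b)) \<and>
    (t = 12 \<longrightarrow> a \<noteq> b) \<and>
    (t = 13 \<longrightarrow> Var a \<notin> set (decode_list b)) \<and>
    (t = 14 \<longrightarrow> (\<forall>A \<in> set (decode_list a). left_ok (decode_list (pfst b)) (decode_list (psnd b)) A)) \<and>
    (t = 15 \<longrightarrow> (\<forall>A \<in> set (decode_list a).
      right_ok refuted (pfst b) (decode_list (pfst (psnd b))) (decode_list (psnd (psnd b))) A)) \<and>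
    (t = 16 \<longrightarrow> refuted a (decode_list (pfst b)) (decode_list (psnd b))) \<and>
    (t = 17 \<longrightarrow> m \<in> range goedel) \<and>
    (t = 18 \<longrightarrow> m \<notin> range goedel) \<and>
    (t = 19 \<longrightarrow> m \<in> goedel ` iH) \<and>
    (t = 20 \<longrightarrow> m \<notin> goedel ` iH))"

lemma meaning_simps [simp]:
  "meaning (prod_encode (0, m)) \<longleftrightarrow> decode m \<in> IPC"
  "meaning (prod_encode (Suc 0, m)) \<longleftrightarrow> decode m \<in> iK4"
  "meaning (prod_encode (2, prod_encode (a, prod_encode (b, c)))) \<longleftrightarrow> bracket (decode a) (decode b) = decode c"
  "meaning (prod_encode (3, prod_encode (a, b))) \<longleftrightarrow>
     Conj (decode_list a) = decode b \<and> (\<forall>D \<in> set (decode_list a). \<exists>E F. D = Imp E F)"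
  "meaning (prod_encode (4, prod_encode (a, prod_encode (b, prod_encode (c, d))))) \<longleftrightarrow>
     Disj (map (bracket (decode a)) (map antecedent (decode_list b) @ [decode c])) = decode d"
  "meaning (prod_encode (5, prod_encode (a, b))) \<longleftrightarrow> decode a \<triangleright> decode b"
  "meaning (prod_encode (6, m)) \<longleftrightarrow> decode m \<in> iH"
  "meaning (prod_encode (7, m)) \<longleftrightarrow> stable (decode m)"
  "meaning (prod_encode (8, prod_encode (a, b))) \<longleftrightarrow> decode a \<in> set (decode_list b)"
  "meaning (prod_encode (9, prod_encode (a, b))) \<longleftrightarrow> set (decode_list a) \<subseteq> set (decode_list b)"
  "meaning (prod_encode (10, prod_encode (a, b))) \<longleftrightarrow> unbox (decode_list a) \<subseteq> set (decode_list b)"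
  "meaning (prod_encode (11, prod_encode (a, b))) \<longleftrightarrow> secured (decode_list a) (decode b)"
  "meaning (prod_encode (12, prod_encode (a, b))) \<longleftrightarrow> a \<noteq> b"
  "meaning (prod_encode (13, prod_encode (a, b))) \<longleftrightarrow> Var a \<notin> set (decode_list b)"
  "meaning (prod_encode (14, prod_encode (a, prod_encode (b, c)))) \<longleftrightarrow>
     (\<forall>A \<in> set (decode_list a). left_ok (decode_list b) (decode_list c) A)"
  "meaning (prod_encode (15, prod_encode (a, prod_encode (b, prod_encode (c, d))))) \<longleftrightarrow>
     (\<forall>A \<in> set (decode_list a). right_ok refuted b (decode_list c) (decode_list d) A)"
  "meaning (prod_encode (16, prod_encode (a, prod_encode (b, c)))) \<longleftrightarrow> refuted a (decode_list b) (decode_list c)"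
  "meaning (prod_encode (17, m)) \<longleftrightarrow> m \<in> range goedel"
  "meaning (prod_encode (18, m)) \<longleftrightarrow> m \<notin> range goedel"
  "meaning (prod_encode (19, m)) \<longleftrightarrow> m \<in> goedel ` iH"
  "meaning (prod_encode (20, m)) \<longleftrightarrow> m \<notin> goedel ` iH"
  by (simp_all add: meaning_def Let_def)

text \<open>
  Used in two directions: a predicate that obeys all clauses contains everything derivable, and derivability itself
  obeys the clauses, which is the source of the individual rules in the completeness lemmas.
\<close>

definition obeys :: "(nat \<Rightarrow> bool) \<Rightarrow> (nat \<Rightarrow> nat) \<Rightarrow> clause list \<Rightarrow> bool" where
  "obeys D \<rho> cs \<longleftrightarrow> (\<forall>c \<in> set cs. (\<forall>g \<in> set (snd c). holds D \<rho> g) \<longrightarrow> D (inst \<rho> (fst c)))"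

lemma derivable_least:
  assumes "\<And>\<rho>. obeys D \<rho> cs" shows "derivable cs n \<Longrightarrow> D n"
proof (induction rule: derivable.induct)
  case (clause h gs \<rho>)
  have "holds (\<lambda>n. derivable cs n \<and> D n) \<rho> g \<longrightarrow> holds D \<rho> g" for g
    by (rule holds_mono) auto
  then show ?case using clause assms[of \<rho>] unfolding obeys_def by fastforce
qed

lemma obeys_derivable: "set cs \<subseteq> set cs' \<Longrightarrow> obeys (derivable cs') \<rho> cs"
  unfolding obeys_def using derivable.clause[of _ _ cs' \<rho>] by (metis prod.collapse subsetD)

lemma IPC_meaning: "obeys meaning \<rho> IPC_clauses"
  unfolding obeys_def IPC_clauses_def by (auto intro: IPC.intros(1-10) elim: IPC.mp)

lemma K4_meaning: "obeys meaning \<rho> K4_clauses"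
  unfolding obeys_def K4_clauses_def
  using K4.IPC_subset by (auto intro: iK4_K iK4_4 iK4_nec elim: K4.closed_mp)

lemma bracket_meaning: "obeys meaning \<rho> bracket_clauses"
  unfolding obeys_def bracket_clauses_def by (auto simp: Disj_Cons)

lemma bt_B2_antecedents:
  assumes "Conj Xs = B \<and> (\<forall>D \<in> set Xs. \<exists>E F. D = Imp E F)"
    and "Disj (map (bracket B) (map antecedent Xs @ [C])) = D"
  shows "And (Imp B C) (Box B) \<triangleright> D"
proof -
  have "set (map antecedent Xs @ [C]) = {E. \<exists>F. Imp E F \<in> set Xs} \<union> {C}"
    using assms(1) by (force simp: image_iff)
  from bt.B2[OF _ _ refl this, of B] show ?thesis using assms by simp
qed

lemma bt_meaning: "obeys meaning \<rho> bt_clauses"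
  unfolding obeys_def bt_clauses_def
  by (auto intro: bt.A1 bt.A3 bt.A4 bt.B1 bt.B3 bt_B2_antecedents elim: bt.A2 simp del: map_append)

lemma iH_meaning: "obeys meaning \<rho> iH_clauses"
  unfolding obeys_def iH_clauses_def
  using iK4_subset_iH by (auto intro: iH_Loeb iH_CP iH_bt elim: iH_mp)

lemma stable_meaning: "obeys meaning \<rho> stable_clauses"
  unfolding obeys_def stable_clauses_def by (auto intro: stable.intros)

lemma list_meaning: "obeys meaning \<rho> list_clauses"
  unfolding obeys_def list_clauses_def by (auto simp: unbox_def secured_def)

lemma left_meaning: "obeys meaning \<rho> left_clauses"
  unfolding obeys_def left_clauses_def by auto

lemma right_meaning: "obeys meaning \<rho> right_clauses"
  unfolding obeys_def right_clauses_def by (auto intro: refuted.intro)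

text \<open>
  Formula codes recognised from the outside in; the clauses for \<open>aNonform\<close> negate this.
\<close>

lemma goedel_shapes:
  "prod_encode (t, m) \<in> range goedel \<longleftrightarrow> t = 0 \<or> (t = 1 \<and> m = 0) \<or> (t = 2 \<and> m = 0) \<or>
    (t \<in> {3, 4, 5} \<and> pfst m \<in> range goedel \<and> psnd m \<in> range goedel) \<or> (t = 6 \<and> m \<in> range goedel)"
    (is "?l \<longleftrightarrow> ?r")
proof
  assume ?l
  then obtain A where "prod_encode (t, m) = goedel A" by blast
  then show ?r by (cases A) (auto simp: prod_encode_eq)
next
  assume ?r
  then consider "t = 0" | "t = 1" "m = 0" | "t = 2" "m = 0"
    | A B where "t \<in> {3, 4, 5}" "pfst m = goedel A" "psnd m = goedel B" | A where "t = 6" "m = goedel A"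
    by blast
  then show ?l
  proof cases
    case (4 A B)
    then have m: "m = prod_encode (goedel A, goedel B)" by (metis prod_encode_pfst_psnd)
    have "goedel (And A B) = prod_encode (3, m)" "goedel (Or A B) = prod_encode (4, m)"
      "goedel (Imp A B) = prod_encode (5, m)" using m by simp_all
    then show ?thesis using 4(1) by (metis empty_iff insert_iff rangeI)
  qed (metis goedel.simps rangeI)+
qed

lemma form_meaning: "obeys meaning \<rho> form_clauses"
proof -
  have "m \<in> goedel ` iH \<longleftrightarrow> m \<in> range goedel \<and> decode m \<in> iH" for m by force
  then show ?thesis
    unfolding obeys_def form_clauses_def using refuted_not_iH
    by (auto simp: goedel_shapes)
qed

theorem program_sound: "derivable program n \<Longrightarrow> meaning n"
proof (rule derivable_least)
  fix \<rho>
  show "obeys meaning \<rho> program"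
    using IPC_meaning K4_meaning bracket_meaning bt_meaning iH_meaning stable_meaning list_meaning
      left_meaning right_meaning form_meaning
    unfolding obeys_def program_def by (simp add: ball_Un)
qed

abbreviation proves :: "nat \<Rightarrow> nat \<Rightarrow> bool" where
  "proves t m \<equiv> derivable program (prod_encode (t, m))"

abbreviation pair :: "nat \<Rightarrow> nat \<Rightarrow> nat" where "pair a b \<equiv> prod_encode (a, b)"

text \<open>
  Instantiated with an assignment given by a list, each of these facts simplifies to the rules of the group of clauses
  for the listed arguments.
\<close>

lemma program_obeys:
  "obeys (derivable program) \<rho> IPC_clauses" "obeys (derivable program) \<rho> K4_clauses"
  "obeys (derivable program) \<rho> bracket_clauses" "obeys (derivable program) \<rho> bt_clauses"
  "obeys (derivable program) \<rho> iH_clauses" "obeys (derivable program) \<rho> stable_clauses"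
  "obeys (derivable program) \<rho> list_clauses" "obeys (derivable program) \<rho> left_clauses"
  "obeys (derivable program) \<rho> right_clauses" "obeys (derivable program) \<rho> form_clauses"
  by (rule obeys_derivable; auto simp: program_def)+

lemma proves_IPC: "A \<in> IPC \<Longrightarrow> proves 0 (goedel A)"
proof (induction rule: IPC.induct)
  case (K A B)
  show ?case using program_obeys(1)[of "nth [goedel A, goedel B]"] by (simp add: obeys_def IPC_clauses_def)
next
  case (S A B C)
  show ?case using program_obeys(1)[of "nth [goedel A, goedel B, goedel C]"] by (simp add: obeys_def IPC_clauses_def)
next
  case (AndI A B)
  show ?case using program_obeys(1)[of "nth [goedel A, goedel B]"] by (simp add: obeys_def IPC_clauses_def)
next
  case (AndE1 A B)
  show ?case using program_obeys(1)[of "nth [goedel A, goedel B]"] by (simp add: obeys_def IPC_clauses_def)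
next
  case (AndE2 A B)
  show ?case using program_obeys(1)[of "nth [goedel A, goedel B]"] by (simp add: obeys_def IPC_clauses_def)
next
  case (OrI1 A B)
  show ?case using program_obeys(1)[of "nth [goedel A, goedel B]"] by (simp add: obeys_def IPC_clauses_def)
next
  case (OrI2 B A)
  show ?case using program_obeys(1)[of "nth [goedel A, goedel B]"] by (simp add: obeys_def IPC_clauses_def)
next
  case (OrE A C B)
  show ?case using program_obeys(1)[of "nth [goedel A, goedel B, goedel C]"] by (simp add: obeys_def IPC_clauses_def)
next
  case (BotE A)
  show ?case using program_obeys(1)[of "nth [goedel A]"] by (simp add: obeys_def IPC_clauses_def)
next
  case TopI
  show ?case using program_obeys(1) by (simp add: obeys_def IPC_clauses_def)
next
  case (mp A B)
  then show ?case using program_obeys(1)[of "nth [goedel A, goedel B]"] by (simp add: obeys_def IPC_clauses_def)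
qed

lemma proves_K4: "A \<in> iK4 \<Longrightarrow> proves 1 (goedel A)"
  unfolding iK4_def
proof (induction rule: closure.induct)
  case (ax A)
  then consider "A \<in> IPC" | B C where "A = Imp (Box (Imp B C)) (Imp (Box B) (Box C))"
    | B where "A = Imp (Box B) (Box (Box B))" by blast
  then show ?case
  proof cases
    case 1
    then show ?thesis using program_obeys(2)[of "nth [goedel A]"] proves_IPC by (simp add: obeys_def K4_clauses_def)
  next
    case (2 B C)
    then show ?thesis using program_obeys(2)[of "nth [goedel B, goedel C]"] by (simp add: obeys_def K4_clauses_def)
  next
    case (3 B)
    then show ?thesis using program_obeys(2)[of "nth [goedel B]"] by (simp add: obeys_def K4_clauses_def)
  qed
next
  case (mp A B)
  then show ?case using program_obeys(2)[of "nth [goedel A, goedel B]"] by (simp add: obeys_def K4_clauses_def)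
next
  case (nec A)
  then show ?case using program_obeys(2)[of "nth [goedel A]"] by (simp add: obeys_def K4_clauses_def)
qed

lemma proves_bracket: "proves 2 (pair (goedel B) (pair (goedel E) (goedel (bracket B E))))"
proof (induction E)
  case (Var n)
  show ?case using program_obeys(3)[of "nth [goedel B, n]"] by (simp add: obeys_def bracket_clauses_def)
next
  case (And E F)
  then show ?case
    using program_obeys(3)[of "nth [goedel B, goedel E, goedel F, goedel (bracket B E), goedel (bracket B F)]"]
    by (simp add: obeys_def bracket_clauses_def)
next
  case (Or E F)
  then show ?case
    using program_obeys(3)[of "nth [goedel B, goedel E, goedel F, goedel (bracket B E), goedel (bracket B F)]"]
    by (simp add: obeys_def bracket_clauses_def)
next
  case (Imp E F)
  show ?case using program_obeys(3)[of "nth [goedel B, goedel E, goedel F]"] by (simp add: obeys_def bracket_clauses_def)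
qed (use program_obeys(3)[of "nth [goedel B, goedel _]"] in \<open>simp add: obeys_def bracket_clauses_def\<close>)+

lemma proves_Conj:
  "\<forall>D \<in> set Xs. \<exists>E F. D = Imp E F \<Longrightarrow> proves 3 (pair (encode_list Xs) (goedel (Conj Xs)))"
proof (induction Xs rule: Conj.induct)
  case 1
  show ?case using program_obeys(3) by (simp add: obeys_def bracket_clauses_def)
next
  case (2 A)
  then obtain E F where "A = Imp E F" by auto
  then show ?case using program_obeys(3)[of "nth [goedel E, goedel F]"] by (simp add: obeys_def bracket_clauses_def)
next
  case (3 A B As)
  then obtain E F where "A = Imp E F" by auto
  then show ?case
    using 3 program_obeys(3)[of "nth [goedel E, goedel F, goedel B, encode_list As, goedel (Conj (B # As))]"]
    by (simp add: obeys_def bracket_clauses_def)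
qed

lemma proves_Disj:
  "\<forall>D \<in> set Xs. \<exists>E F. D = Imp E F \<Longrightarrow> proves 4 (pair (goedel B) (pair (encode_list Xs) (pair (goedel C)
     (goedel (Disj (map (bracket B) (map antecedent Xs @ [C])))))))"
proof (induction Xs)
  case Nil
  show ?case using program_obeys(3)[of "nth [goedel B, goedel C, goedel (bracket B C)]"] proves_bracket
    by (simp add: obeys_def bracket_clauses_def)
next
  case (Cons A As)
  then obtain E F where "A = Imp E F" by auto
  then show ?case
    using Cons proves_bracket[of B E]
      program_obeys(3)[of "nth [goedel B, goedel E, goedel F, encode_list As, goedel C, goedel (bracket B E),
        goedel (Disj (map (bracket B) (map antecedent As @ [C])))]"]
    by (simp add: obeys_def bracket_clauses_def Disj_Cons)
qed

lemma proves_bt: "A \<triangleright> B \<Longrightarrow> proves 5 (pair (goedel A) (goedel B))"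
proof (induction rule: bt.induct)
  case (A1 A B)
  then show ?case using proves_K4[OF A1] program_obeys(4)[of "nth [goedel A, goedel B]"] by (simp add: obeys_def bt_clauses_def)
next
  case (A2 A B C)
  then show ?case using program_obeys(4)[of "nth [goedel A, goedel B, goedel C]"] by (simp add: obeys_def bt_clauses_def)
next
  case (A3 C A B)
  then show ?case using program_obeys(4)[of "nth [goedel A, goedel B, goedel C]"] by (simp add: obeys_def bt_clauses_def)
next
  case (A4 A B)
  then show ?case using program_obeys(4)[of "nth [goedel A, goedel B]"] by (simp add: obeys_def bt_clauses_def)
next
  case (B1 A C B)
  then show ?case using program_obeys(4)[of "nth [goedel A, goedel B, goedel C]"] by (simp add: obeys_def bt_clauses_def)
next
  case (B2 Xs B A C Zs)
  let ?D = "Disj (map (bracket B) (map antecedent Xs @ [C]))" and ?D' = "Disj (map (bracket B) Zs)"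
  have "proves 5 (pair (goedel (And A (Box B))) (goedel ?D))"
    using program_obeys(4)[of "nth [goedel B, goedel C, goedel ?D, encode_list Xs]"] B2(2,3)
      proves_Conj[OF B2(1)] proves_Disj[OF B2(1), of B C]
    by (simp add: obeys_def bt_clauses_def del: map_append)
  moreover have "proves 5 (pair (goedel ?D) (goedel ?D'))"
  proof -
    have "set (map antecedent Xs @ [C]) \<subseteq> set Zs" using B2(1,4) by fastforce
    then have "Imp ?D ?D' \<in> iK4" unfolding K4.in_L_Imp by (intro K4.ded_Disj_subset) (simp only: set_map image_mono)
    from proves_K4[OF this] show ?thesis
      using program_obeys(4)[of "nth [goedel ?D, goedel ?D']"] by (simp add: obeys_def bt_clauses_def del: map_append)
  qed
  ultimately show ?case
    using program_obeys(4)[of "nth [goedel (And A (Box B)), goedel ?D, goedel ?D']"]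
    by (simp add: obeys_def bt_clauses_def del: map_append goedel.simps)
next
  case (B3 A B p)
  then consider n where "p = Var n" | D where "p = Box D" by blast
  then show ?case
  proof cases
    case (1 n)
    then show ?thesis using B3 program_obeys(4)[of "nth [goedel A, goedel B, n]"] by (simp add: obeys_def bt_clauses_def)
  next
    case (2 D)
    then show ?thesis using B3 program_obeys(4)[of "nth [goedel A, goedel B, goedel D]"] by (simp add: obeys_def bt_clauses_def)
  qed
qed

lemma proves_iH: "A \<in> iH \<Longrightarrow> proves 6 (goedel A)"
proof -
  have "iH \<subseteq> {A. proves 6 (goedel A)}"
  proof (rule iH_least)
    show "iK4 \<subseteq> {A. proves 6 (goedel A)}"
    proof
      fix A assume "A \<in> iK4"
      then show "A \<in> {A. proves 6 (goedel A)}"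
        using proves_K4[of A] program_obeys(5)[of "nth [goedel A]"] by (simp add: obeys_def iH_clauses_def)
    qed
    fix A
    show "Imp (Box (Imp (Box A) A)) (Box A) \<in> {A. proves 6 (goedel A)}" "Imp A (Box A) \<in> {A. proves 6 (goedel A)}"
      using program_obeys(5)[of "nth [goedel A]"] by (simp_all add: obeys_def iH_clauses_def)
    fix B
    show "A \<triangleright> B \<Longrightarrow> Imp (Box A) (Box B) \<in> {A. proves 6 (goedel A)}"
      using program_obeys(5)[of "nth [goedel A, goedel B]"] proves_bt[of A B] by (simp add: obeys_def iH_clauses_def)
    show "Imp A B \<in> {A. proves 6 (goedel A)} \<Longrightarrow> A \<in> {A. proves 6 (goedel A)} \<Longrightarrow> B \<in> {A. proves 6 (goedel A)}"
      using program_obeys(5)[of "nth [goedel A, goedel B]"] by (simp add: obeys_def iH_clauses_def)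
  qed
  then show "A \<in> iH \<Longrightarrow> proves 6 (goedel A)" by blast
qed

lemma proves_stable: "stable A \<Longrightarrow> proves 7 (goedel A)"
proof (induction rule: stable.induct)
  case (Var n)
  show ?case using program_obeys(6)[of "nth [n]"] by (simp add: obeys_def stable_clauses_def)
next
  case (And A B)
  then show ?case using program_obeys(6)[of "nth [goedel A, goedel B]"] by (simp add: obeys_def stable_clauses_def)
next
  case (Or A B)
  then show ?case using program_obeys(6)[of "nth [goedel A, goedel B]"] by (simp add: obeys_def stable_clauses_def)
next
  case (Box A)
  then show ?case using program_obeys(6)[of "nth [goedel A]"] by (simp add: obeys_def stable_clauses_def)
next
  case (Imp_Var A n)
  then show ?case using program_obeys(6)[of "nth [goedel A, n]"] by (simp add: obeys_def stable_clauses_def)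
next
  case (Imp_Box D A)
  then show ?case using program_obeys(6)[of "nth [goedel A, goedel D]"] by (simp add: obeys_def stable_clauses_def)
qed (use program_obeys(6) in \<open>simp add: obeys_def stable_clauses_def\<close>)+

lemma proves_mem: "A \<in> set L \<Longrightarrow> proves 8 (pair (goedel A) (encode_list L))"
proof (induction L)
  case (Cons B L)
  then show ?case
    using program_obeys(7)[of "nth [goedel A, encode_list L, goedel B]"]
    by (cases "A = B") (simp_all add: obeys_def list_clauses_def)
qed simp

lemma proves_subset: "set L \<subseteq> set M \<Longrightarrow> proves 9 (pair (encode_list L) (encode_list M))"
proof (induction L)
  case Nil
  show ?case using program_obeys(7)[of "nth [encode_list M]"] by (simp add: obeys_def list_clauses_def)
next
  case (Cons B L)
  then show ?case
    using program_obeys(7)[of "nth [goedel B, encode_list L, encode_list M]"] proves_mem[of B M]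
    by (simp add: obeys_def list_clauses_def)
qed

lemma proves_unbox: "unbox L \<subseteq> set M \<Longrightarrow> proves 10 (pair (encode_list L) (encode_list M))"
proof (induction L)
  case Nil
  show ?case using program_obeys(7)[of "nth [encode_list M]"] by (simp add: obeys_def list_clauses_def)
next
  case (Cons F L)
  then have IH: "proves 10 (pair (encode_list L) (encode_list M))" by (auto simp: unbox_def)
  show ?case
  proof (cases F)
    case (Box A)
    then have "A \<in> set M" using Cons.prems by (auto simp: unbox_def)
    then show ?thesis
      using program_obeys(7)[of "nth [goedel A, encode_list L, encode_list M]"] IH Box proves_mem[of A M]
      by (simp add: obeys_def list_clauses_def)
  next
    case (Var n)
    then show ?thesis
      using program_obeys(7)[of "nth [n, encode_list L, encode_list M]"] IH by (simp add: obeys_def list_clauses_def)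
  next
    case (And A B)
    then show ?thesis
      using program_obeys(7)[of "nth [goedel A, encode_list L, encode_list M, goedel B]"] IH
      by (simp add: obeys_def list_clauses_def)
  next
    case (Or A B)
    then show ?thesis
      using program_obeys(7)[of "nth [goedel A, encode_list L, encode_list M, goedel B]"] IH
      by (simp add: obeys_def list_clauses_def)
  next
    case (Imp A B)
    then show ?thesis
      using program_obeys(7)[of "nth [goedel A, encode_list L, encode_list M, goedel B]"] IH
      by (simp add: obeys_def list_clauses_def)
  qed (use program_obeys(7)[of "nth [0, encode_list L, encode_list M]"] IH in
      \<open>simp add: obeys_def list_clauses_def\<close>)+
qed

lemma proves_secured: "secured G F \<Longrightarrow> proves 11 (pair (encode_list G) (goedel F))"
  unfolding secured_def
proof (elim disjE exE conjE)
  assume "stable F"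
  then show ?thesis
    using program_obeys(7)[of "nth [encode_list G, goedel F]"] proves_stable
    by (simp add: obeys_def list_clauses_def)
next
  fix N assume "stable N" "Box N \<in> set G" "Imp N F \<in> iH"
  then show ?thesis
    using program_obeys(7)[of "nth [encode_list G, goedel F, goedel N]"] proves_stable[of N]
      proves_mem[of "Box N" G] proves_iH[of "Imp N F"]
    by (simp add: obeys_def list_clauses_def)
qed

lemma proves_NoVar: "Var n \<notin> set L \<Longrightarrow> proves 13 (pair n (encode_list L))"
proof (induction L)
  case Nil
  show ?case using program_obeys(7)[of "nth [n]"] by (simp add: obeys_def list_clauses_def)
next
  case (Cons F L)
  then have IH: "proves 13 (pair n (encode_list L))" by simp
  show ?case
  proof (cases F)
    case (Var m)
    then have "n < m \<or> m < n" using Cons.prems by auto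
    then have "proves 12 (pair n m)"
      using program_obeys(7)[of "nth [n, m]"] by (auto simp: obeys_def list_clauses_def)
    then show ?thesis
      using program_obeys(7)[of "nth [n, encode_list L, m]"] IH Var by (simp add: obeys_def list_clauses_def)
  next
    case (Box A)
    then show ?thesis
      using program_obeys(7)[of "nth [n, encode_list L, goedel A]"] IH by (simp add: obeys_def list_clauses_def)
  next
    case (And A B)
    then show ?thesis
      using program_obeys(7)[of "nth [n, encode_list L, goedel A, goedel B]"] IH
      by (simp add: obeys_def list_clauses_def)
  next
    case (Or A B)
    then show ?thesis
      using program_obeys(7)[of "nth [n, encode_list L, goedel A, goedel B]"] IH
      by (simp add: obeys_def list_clauses_def)
  next
    case (Imp A B)
    then show ?thesis
      using program_obeys(7)[of "nth [n, encode_list L, goedel A, goedel B]"] IH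
      by (simp add: obeys_def list_clauses_def)
  qed (use program_obeys(7)[of "nth [n, encode_list L]"] IH in \<open>simp add: obeys_def list_clauses_def\<close>)+
qed

lemma proves_left:
  "\<forall>A \<in> set L. left_ok G D A \<Longrightarrow> proves 14 (pair (encode_list L) (pair (encode_list G) (encode_list D)))"
proof (induction L)
  case Nil
  show ?case
    using program_obeys(8)[of "nth [encode_list G, encode_list D]"] by (simp add: obeys_def left_clauses_def)
next
  case (Cons F L)
  then have IH: "proves 14 (pair (encode_list L) (pair (encode_list G) (encode_list D)))"
    and F: "left_ok G D F" by simp_all
  have step: "obeys (derivable program) (nth [a, b, encode_list L, encode_list G, encode_list D]) left_clauses" for a b
    by (rule program_obeys)
  show ?case
  proof (cases F)
    case (Var n)
    then show ?thesis
      using step[of n] IH F proves_NoVar by (simp add: obeys_def left_clauses_def)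
  next
    case Bot
    then show ?thesis using F by simp
  next
    case Top
    then show ?thesis using step IH by (simp add: obeys_def left_clauses_def)
  next
    case (And A B)
    then show ?thesis
      using step[of "goedel A" "goedel B"] IH F proves_mem by (simp add: obeys_def left_clauses_def)
  next
    case (Or A B)
    then show ?thesis
      using step[of "goedel A" "goedel B"] IH F proves_mem[of A G] proves_mem[of B G]
      by (auto simp: obeys_def left_clauses_def)
  next
    case (Imp A B)
    then show ?thesis
      using step[of "goedel A" "goedel B"] IH F proves_mem[of A D] proves_mem[of B G]
        proves_secured[of G "Imp A B"]
      by (auto simp: obeys_def left_clauses_def)
  next
    case (Box A)
    then show ?thesis
      using step[of "goedel A"] IH F proves_secured[of G A] by (simp add: obeys_def left_clauses_def)
  qed
qed

lemma proves_right:
  "\<forall>A \<in> set L. right_ok (\<lambda>k G D. proves 16 (pair k (pair (encode_list G) (encode_list D)))) k G D A \<Longrightarrow>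
    proves 15 (pair (encode_list L) (pair k (pair (encode_list G) (encode_list D))))"
proof (induction L)
  case Nil
  show ?case
    using program_obeys(9)[of "nth [k, encode_list G, encode_list D]"] by (simp add: obeys_def right_clauses_def)
next
  case (Cons F L)
  then have IH: "proves 15 (pair (encode_list L) (pair k (pair (encode_list G) (encode_list D))))"
    and F: "right_ok (\<lambda>k G D. proves 16 (pair k (pair (encode_list G) (encode_list D)))) k G D F" by simp_all
  have step: "obeys (derivable program) (nth [a, b, encode_list L, encode_list G, encode_list D, k, c, d])
      right_clauses" for a b c d
    by (rule program_obeys)
  show ?case
  proof (cases F)
    case (Var n)
    then show ?thesis using step[of n] IH by (simp add: obeys_def right_clauses_def)
  next
    case Bot
    then show ?thesis using step IH by (simp add: obeys_def right_clauses_def)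
  next
    case Top
    then show ?thesis using F by simp
  next
    case (And A B)
    then show ?thesis
      using step[of "goedel A" "goedel B"] IH F proves_mem[of A D] proves_mem[of B D]
      by (auto simp: obeys_def right_clauses_def)
  next
    case (Or A B)
    then show ?thesis
      using step[of "goedel A" "goedel B"] IH F proves_mem[of A D] proves_mem[of B D]
      by (simp add: obeys_def right_clauses_def)
  next
    case (Imp A B)
    then consider "A \<in> set G" "B \<in> set D" | G' D' where
        "proves 16 (pair k (pair (encode_list G') (encode_list D')))" "set G \<subseteq> set G'" "A \<in> set G'" "B \<in> set D'"
      using F by auto
    then show ?thesis
    proof cases
      case 1
      then show ?thesis
        using Imp step[of "goedel A" "goedel B"] IH proves_mem by (simp add: obeys_def right_clauses_def)
    next
      case (2 G' D')
      then show ?thesis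
        using Imp step[of "goedel A" "goedel B" "encode_list G'" "encode_list D'"] IH
          proves_subset[of G G'] proves_mem[of A G'] proves_mem[of B D']
        by (simp add: obeys_def right_clauses_def)
    qed
  next
    case (Box A)
    then obtain k' G' D' where "k' < k" "proves 16 (pair k' (pair (encode_list G') (encode_list D')))"
        "set G \<subseteq> set G'" "unbox G \<subseteq> set G'" "A \<in> set D'"
      using F by auto
    then show ?thesis
      using Box step[of "goedel A" k' "encode_list G'" "encode_list D'"] IH
        proves_subset[of G G'] proves_unbox[of G G'] proves_mem[of A D']
      by (simp add: obeys_def right_clauses_def)
  qed
qed

lemma proves_refuted: "refuted k G D \<Longrightarrow> proves 16 (pair k (pair (encode_list G) (encode_list D)))"
proof (induction rule: refuted.induct)
  case (intro G D k)
  have "right_ok (\<lambda>k G D. proves 16 (pair k (pair (encode_list G) (encode_list D)))) k G D A"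
    if "A \<in> set D" for A
    using intro(2)[rule_format, OF that] by (rule right_ok_mono[THEN HOL.mp, rotated]) (auto simp: le_fun_def)
  then show ?case
    using program_obeys(9)[of "nth [k, encode_list G, encode_list D]"] proves_left[OF intro(1)] proves_right[of D k G D]
    by (simp add: obeys_def right_clauses_def)
qed

lemma proves_form: "proves 17 (goedel A)"
proof (induction A)
  case (Var n)
  show ?case using program_obeys(10)[of "nth [n]"] by (simp add: obeys_def form_clauses_def)
next
  case (And A B)
  then show ?case using program_obeys(10)[of "nth [goedel A, goedel B]"] by (simp add: obeys_def form_clauses_def)
next
  case (Or A B)
  then show ?case using program_obeys(10)[of "nth [goedel A, goedel B]"] by (simp add: obeys_def form_clauses_def)
next
  case (Imp A B)
  then show ?case using program_obeys(10)[of "nth [goedel A, goedel B]"] by (simp add: obeys_def form_clauses_def)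
next
  case (Box A)
  then show ?case using program_obeys(10)[of "nth [goedel A]"] by (simp add: obeys_def form_clauses_def)
qed (use program_obeys(10) in \<open>simp add: obeys_def form_clauses_def\<close>)+

lemma proves_nonform: "n \<notin> range goedel \<Longrightarrow> proves 18 n"
proof (induction n rule: less_induct)
  case (less n)
  obtain t m where n: "n = pair t m" by (metis prod_encode_pfst_psnd)
  have step: "obeys (derivable program) (nth [a, b]) form_clauses" for a b
    by (rule program_obeys)
  consider "6 < t" | "t = 0" | "t = 1" | "t = 2" | "t \<in> {3, 4, 5}" | "t = 6" by fastforce
  then show ?case
  proof cases
    case 1
    then show ?thesis using step[of t m] n by (simp add: obeys_def form_clauses_def)
  next
    case 5
    then have "m < n" using n psnd_less[of n] by auto
    then have IH: "pfst m \<notin> range goedel \<Longrightarrow> proves 18 (pfst m)" "psnd m \<notin> range goedel \<Longrightarrow> proves 18 (psnd m)"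
      using less.IH[of "pfst m"] less.IH[of "psnd m"] pfst_le[of m] psnd_le[of m] by auto
    have "pfst m \<notin> range goedel \<or> psnd m \<notin> range goedel"
      using less.prems 5 unfolding n goedel_shapes by auto
    then have "proves 18 (pfst m) \<or> proves 18 (psnd m)" using IH by blast
    moreover have "proves 18 (pair t (pair a b))" if "proves 18 a \<or> proves 18 b" for a b
      using step[of a b] 5 that by (elim disjE insertE emptyE; simp add: obeys_def form_clauses_def)
    ultimately have "proves 18 (pair t (pair (pfst m) (psnd m)))" by blast
    then show ?thesis using n by simp
  next
    case 6
    then have "m < n" using n psnd_less[of n] by auto
    then show ?thesis
      using step[of m] n 6 less goedel_shapes[of 6 m] by (simp add: obeys_def form_clauses_def)
  qed (use less.prems n goedel_shapes[of t m] step[of m] in \<open>simp_all add: obeys_def form_clauses_def\<close>)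
qed

lemma iH_codes_iff:
  "n \<in> goedel ` iH \<longleftrightarrow> proves 19 n" "n \<notin> goedel ` iH \<longleftrightarrow> proves 20 n"
proof -
  have "proves 19 n" if n: "n \<in> goedel ` iH"
  proof -
    obtain A where "n = goedel A" "A \<in> iH" using n by blast
    then show ?thesis
      using program_obeys(10)[of "nth [n]"] proves_form[of A] proves_iH[of A]
      by (simp add: obeys_def form_clauses_def)
  qed
  moreover have "proves 20 n" if n: "n \<notin> goedel ` iH"
  proof (cases "n \<in> range goedel")
    case False
    then show ?thesis
      using program_obeys(10)[of "nth [n]"] proves_nonform by (simp add: obeys_def form_clauses_def)
  next
    case True
    then obtain A where A: "n = goedel A" "A \<notin> iH" using n by blast
    then obtain k G D where "refuted k G D" "A \<in> set D" using not_iH_refuted by blast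
    then show ?thesis
      using program_obeys(10)[of "nth [n, k, encode_list G, encode_list D]"] proves_refuted[of k G D]
        proves_mem[of A D] A by (simp add: obeys_def form_clauses_def)
  qed
  ultimately show "n \<in> goedel ` iH \<longleftrightarrow> proves 19 n" "n \<notin> goedel ` iH \<longleftrightarrow> proves 20 n"
    using program_sound by fastforce+
qed

theorem corollary4p12: "decidable iH"
  unfolding decidable_def by (rule recursive_set_of_program) (rule iH_codes_iff)+

end
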